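(* There is an algorithm that, given a program $P\in\mathcal P_2^n$, computes all stable models of $P$ in time $O(m\times 1.23651^n)$, where $n$ is the number of atoms and $m$ is the size of $P$.
   Context: A clause is $p\leftarrow B$ (definite) or $\leftarrow B$ (a constraint), where $p$ is an atom and $B$ is a finite set of literals (atoms $a$ or negated atoms $\mathrm{not}(a)$). A propositional logic program is a finite set of clauses. $\mathcal P_2^n$ is the class of programs $P$ such that every clause of $P$ is definite, has at most 2 literals counting the head, and has no positive atoms in its body (purely negative), and $P$ contains no pair of dual clauses, i.e. no pair $a\leftarrow\mathrm{not}(b)$ and $b\leftarrow\mathrm{not}(a)$. The size $m$ is the size of the standard representation (total number of occurrences of atoms). $M\subseteq\mathit{At}(P)$ is a stable model of $P$ if $M$ is the least model of the Gelfond–Lifschitz reduct $P^M$, obtained by deleting every clause with some $\mathrm{not}(a)$, $a\in M$, in its body and deleting negated literals from the remaining clauses. *)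

theory Defs
  imports Complex_Main
begin

section \<open>Propositional logic programs and stable models\<close>

datatype 'a literal = Pos 'a | Neg 'a

text \<open>The head is \<open>None\<close> for a constraint.\<close>
type_synonym 'a clause = "'a option \<times> 'a literal set"

definition logic_program :: "'a clause set \<Rightarrow> bool" where
  "logic_program P \<longleftrightarrow> finite P \<and> (\<forall>(h, B) \<in> P. finite B)"

fun lit_atom :: "'a literal \<Rightarrow> 'a" where
  "lit_atom (Pos a) = a"
| "lit_atom (Neg a) = a"

definition atoms :: "'a clause set \<Rightarrow> 'a set" where
  "atoms P = (\<Union>(h, B) \<in> P. set_option h \<union> lit_atom ` B)"

definition program_size :: "'a clause set \<Rightarrow> nat" where
  "program_size P = (\<Sum>(h, B) \<in> P. card (set_option h) + card B)"

fun lit_true :: "'a set \<Rightarrow> 'a literal \<Rightarrow> bool" where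
  "lit_true M (Pos a) \<longleftrightarrow> a \<in> M"
| "lit_true M (Neg a) \<longleftrightarrow> a \<notin> M"

definition is_model :: "'a set \<Rightarrow> 'a clause set \<Rightarrow> bool" where
  "is_model M P \<longleftrightarrow> (\<forall>(h, B) \<in> P. (\<forall>l \<in> B. lit_true M l) \<longrightarrow> (\<exists>p \<in> set_option h. p \<in> M))"

definition is_least_model :: "'a set \<Rightarrow> 'a clause set \<Rightarrow> bool" where
  "is_least_model M P \<longleftrightarrow> is_model M P \<and> (\<forall>M'. is_model M' P \<longrightarrow> M \<subseteq> M')"

definition reduct :: "'a clause set \<Rightarrow> 'a set \<Rightarrow> 'a clause set" where
  "reduct P M = {(h, B - range Neg) | h B. (h, B) \<in> P \<and> (\<forall>a \<in> M. Neg a \<notin> B)}"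

definition stable_model :: "'a clause set \<Rightarrow> 'a set \<Rightarrow> bool" where
  "stable_model P M \<longleftrightarrow> M \<subseteq> atoms P \<and> is_least_model M (reduct P M)"

text \<open>
  In the name \<open>P2n\<close> the letter n stands for ``negative''.
  A dual pair consists of two different clauses, so a clause \<open>a \<leftarrow> not(a)\<close> is allowed.
\<close>
definition P2n :: "'a clause set set" where
  "P2n = {P. logic_program P
     \<and> (\<forall>(h, B) \<in> P. h \<noteq> None \<and> 1 + card B \<le> 2 \<and> (\<forall>a. Pos a \<notin> B))
     \<and> \<not> (\<exists>a b. a \<noteq> b \<and> (Some a, {Neg b}) \<in> P \<and> (Some b, {Neg a}) \<in> P)}"


section \<open>Machine model: first-order pure Lisp with unit costs\<close>

text \<open>
  Algorithms are finite systems of recursive first-order functions over S-expressions, built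
  from McCarthy's primitives.  Each primitive takes constant time on a unit-cost random access
  machine (cells are never compared or copied, only pointers to them are), so for a fixed
  program the costs below bound the running time on such a machine up to a constant factor.
  There is no arithmetic; symbols can only be compared for equality.
\<close>

datatype sexp = NIL | Sym nat | Cell sexp sexp

datatype lexp =
    Param nat
  | Quote sexp
  | Cons_exp lexp lexp
  | Car lexp
  | Cdr lexp
  | Atom_exp lexp
  | Eq lexp lexp
  | If_exp lexp lexp lexp
  | Call nat "lexp list"

text \<open>The \<open>i\<close>-th entry is the body of function number \<open>i\<close>; function \<open>0\<close> is the entry point.\<close>
type_synonym code = "lexp list"

fun car :: "sexp \<Rightarrow> sexp" where
  "car (Cell x y) = x"
| "car _ = NIL"

fun cdr :: "sexp \<Rightarrow> sexp" where
  "cdr (Cell x y) = y"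
| "cdr _ = NIL"

fun is_atom :: "sexp \<Rightarrow> bool" where
  "is_atom (Cell x y) = False"
| "is_atom _ = True"

definition truth :: "bool \<Rightarrow> sexp" where
  "truth b = (if b then Sym 0 else NIL)"

text \<open>
  \<open>eval F env e v t\<close>: with the function bodies \<open>F\<close> and the arguments \<open>env\<close> of the current call,
  \<open>e\<close> evaluates (call by value) to \<open>v\<close> at cost \<open>t\<close>, where every evaluation of a subexpression
  costs one unit.  \<open>Eq\<close> yields true only on atoms, hence needs no traversal.
\<close>
inductive eval :: "code \<Rightarrow> sexp list \<Rightarrow> lexp \<Rightarrow> sexp \<Rightarrow> nat \<Rightarrow> bool"
  and eval_list :: "code \<Rightarrow> sexp list \<Rightarrow> lexp list \<Rightarrow> sexp list \<Rightarrow> nat \<Rightarrow> bool"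
  for F :: code
where
  eval_Param: "i < length env \<Longrightarrow> eval F env (Param i) (env ! i) 1"
| eval_Quote: "eval F env (Quote v) v 1"
| eval_Cons: "eval F env e1 v1 t1 \<Longrightarrow> eval F env e2 v2 t2 \<Longrightarrow>
    eval F env (Cons_exp e1 e2) (Cell v1 v2) (t1 + t2 + 1)"
| eval_Car: "eval F env e v t \<Longrightarrow> eval F env (Car e) (car v) (t + 1)"
| eval_Cdr: "eval F env e v t \<Longrightarrow> eval F env (Cdr e) (cdr v) (t + 1)"
| eval_Atom: "eval F env e v t \<Longrightarrow> eval F env (Atom_exp e) (truth (is_atom v)) (t + 1)"
| eval_Eq: "eval F env e1 v1 t1 \<Longrightarrow> eval F env e2 v2 t2 \<Longrightarrow>
    eval F env (Eq e1 e2) (truth (is_atom v1 \<and> v1 = v2)) (t1 + t2 + 1)"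
| eval_If_true: "eval F env e v t \<Longrightarrow> v \<noteq> NIL \<Longrightarrow> eval F env e1 v1 t1 \<Longrightarrow>
    eval F env (If_exp e e1 e2) v1 (t + t1 + 1)"
| eval_If_false: "eval F env e NIL t \<Longrightarrow> eval F env e2 v2 t2 \<Longrightarrow>
    eval F env (If_exp e e1 e2) v2 (t + t2 + 1)"
| eval_Call: "eval_list F env es vs t1 \<Longrightarrow> f < length F \<Longrightarrow> eval F vs (F ! f) v t2 \<Longrightarrow>
    eval F env (Call f es) v (t1 + t2 + 1)"
| eval_list_Nil: "eval_list F env [] [] 0"
| eval_list_Cons: "eval F env e v t1 \<Longrightarrow> eval_list F env es vs t2 \<Longrightarrow>
    eval_list F env (e # es) (v # vs) (t1 + t2)"

definition runs :: "code \<Rightarrow> sexp \<Rightarrow> sexp \<Rightarrow> nat \<Rightarrow> bool" where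
  "runs F x y t \<longleftrightarrow> eval F [x] (Call 0 [Param 0]) y t"

inductive_cases eval_ParamE: "eval F env (Param i) v t"
inductive_cases eval_QuoteE: "eval F env (Quote c) v t"
inductive_cases eval_ConsE: "eval F env (Cons_exp e1 e2) v t"
inductive_cases eval_CarE: "eval F env (Car e) v t"
inductive_cases eval_CdrE: "eval F env (Cdr e) v t"
inductive_cases eval_AtomE: "eval F env (Atom_exp e) v t"
inductive_cases eval_EqE: "eval F env (Eq e1 e2) v t"
inductive_cases eval_IfE: "eval F env (If_exp e e1 e2) v t"
inductive_cases eval_CallE: "eval F env (Call f es) v t"
inductive_cases eval_list_NilE: "eval_list F env [] vs t"
inductive_cases eval_list_ConsE: "eval_list F env (e # es) vs t"

lemma eval_deterministic:
  "eval F env e v t \<Longrightarrow> (\<forall>v' t'. eval F env e v' t' \<longrightarrow> v' = v \<and> t' = t)"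
  "eval_list F env es vs t \<Longrightarrow> (\<forall>vs' t'. eval_list F env es vs' t' \<longrightarrow> vs' = vs \<and> t' = t)"
proof (induction rule: eval_eval_list.inducts)
  case eval_Param then show ?case by (intro allI impI, elim eval_ParamE) simp_all
next
  case eval_Quote then show ?case by (intro allI impI, elim eval_QuoteE) simp_all
next
  case eval_Cons then show ?case by (intro allI impI, elim eval_ConsE) (metis Suc_eq_plus1 add_Suc_right add_0_right)+
next
  case eval_Car then show ?case by (intro allI impI, elim eval_CarE) (metis Suc_eq_plus1 add_Suc_right add_0_right)+
next
  case eval_Cdr then show ?case by (intro allI impI, elim eval_CdrE) (metis Suc_eq_plus1 add_Suc_right add_0_right)+
next
  case eval_Atom then show ?case by (intro allI impI, elim eval_AtomE) (metis Suc_eq_plus1 add_Suc_right add_0_right)+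
next
  case eval_Eq then show ?case by (intro allI impI, elim eval_EqE) (metis Suc_eq_plus1 add_Suc_right add_0_right)+
next
  case eval_If_true then show ?case by (intro allI impI, elim eval_IfE) (metis Suc_eq_plus1 add_Suc_right add_0_right)+
next
  case eval_If_false then show ?case by (intro allI impI, elim eval_IfE) (metis Suc_eq_plus1 add_Suc_right add_0_right)+
next
  case eval_Call then show ?case by (intro allI impI, elim eval_CallE) (metis Suc_eq_plus1 add_Suc_right add_0_right)+
next
  case eval_list_Nil then show ?case by (intro allI impI, elim eval_list_NilE) (metis Suc_eq_plus1 add_Suc_right add_0_right)+
next
  case eval_list_Cons then show ?case by (intro allI impI, elim eval_list_ConsE) (metis Suc_eq_plus1 add_Suc_right add_0_right)+
qed

lemma runs_deterministic:
  "runs F x y t \<Longrightarrow> runs F x y' t' \<Longrightarrow> y' = y \<and> t' = t"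
  unfolding runs_def using eval_deterministic(1) by blast


section \<open>Input and output formats\<close>

fun slist :: "sexp list \<Rightarrow> sexp" where
  "slist [] = NIL"
| "slist (x # xs) = Cell x (slist xs)"

text \<open>
  \<open>R a z\<close> means that \<open>z\<close> is a representation of \<open>a\<close>.  A finite set is represented by any list
  containing exactly one representation of each of its elements, in any order.
\<close>
definition rep_set :: "('a \<Rightarrow> sexp \<Rightarrow> bool) \<Rightarrow> 'a set \<Rightarrow> sexp \<Rightarrow> bool" where
  "rep_set R A x \<longleftrightarrow>
     (\<exists>as zs. distinct as \<and> set as = A \<and> list_all2 R as zs \<and> x = slist zs)"

definition rep_atom :: "nat \<Rightarrow> sexp \<Rightarrow> bool" where
  "rep_atom a x \<longleftrightarrow> x = Sym a"

fun rep_head :: "nat option \<Rightarrow> sexp \<Rightarrow> bool" where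
  "rep_head None x \<longleftrightarrow> x = NIL"
| "rep_head (Some p) x \<longleftrightarrow> x = Sym p"

fun rep_literal :: "nat literal \<Rightarrow> sexp \<Rightarrow> bool" where
  "rep_literal (Pos a) x \<longleftrightarrow> x = Sym a"
| "rep_literal (Neg a) x \<longleftrightarrow> x = Cell NIL (Sym a)"

fun rep_clause :: "nat clause \<Rightarrow> sexp \<Rightarrow> bool" where
  "rep_clause (h, B) x \<longleftrightarrow>
     (\<exists>y z. rep_head h y \<and> rep_set rep_literal B z \<and> x = Cell y z)"

end

theory Submission
  imports Defs
begin

text \<open>
  Read \<open>v \<leftarrow> not(u)\<close> as an edge from \<open>v\<close> to \<open>u\<close>.  The complements of the stable models are the kernels of
  this digraph that contain no fact: independent sets that meet the closed out-neighbourhood of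
  every atom that is not a fact.  The algorithm keeps a set \<open>K\<close> of selected and a set \<open>U\<close> of undecided
  atoms; selecting an atom removes its closed neighbourhood from \<open>U\<close>.  It backtracks as soon as some
  out-neighbourhood can no longer be met, selects \<open>z\<close> if only \<open>z\<close> can meet some out-neighbourhood, and
  otherwise branches.  Progress is measured by the core of \<open>U\<close>, the largest subset in which all
  in-degrees are positive: atoms outside the core are decided by the others.

  As there are no 2-cycles, a suitable branching always exists.  With degrees taken in the core, the
  cases are: out-degree 1 (core decreases by 3 and 4), in-degree 1 (2 and 5, or 3 and 4),
  degree at least 7 (1 and 8), out-degree 2 where the closed out-neighbourhood is not a transitive
  triangle of vertices of degree 4 (5, 5 and 6), squares of directed cycles (6, 6 and 6), and in- and
  out-degrees all 3 (7 four times).  The worst case is \<open>T(n) = T(n - 2) + T(n - 5)\<close>.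
\<close>

text \<open>Counting undecided atoms would be too weak a measure: an atom of out-degree 1 without
  in-neighbours has a closed neighbourhood of only two atoms. Inside the core each closed
  neighbourhood has at least three once propagation is exhausted, and rejections gain as well, since
  an atom whose in-neighbours all disappear leaves the core. Nothing is lost by measuring there: the
  undecided options for meeting a core atom lie in the core.

  Selecting an atom settles its in-neighbours, but it merely disqualifies its out-neighbours, which
  still have to be met. Failure and forcing therefore refer to all atoms, not only to undecided
  ones.

  The absence of dual clauses makes in- and out-neighbours disjoint. A loop
  \<open>a <- not(a)\<close> survives as an atom that has to be met, unless it is a fact, but may
  not be selected.

  List scanning costs a polynomial in the number of clauses, which is at most quadratic in the
  number of atoms; this is why the overhead fits into the gap between the two growth rates.\<close>

section \<open>Branching on the vertices of a digraph without 2-cycles\<close>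

text \<open>
  Slightly above the root of \<open>x\<^sup>5 = x\<^sup>3 + 1\<close>, which belongs to the recurrence above, and below
  1.23651, so that the remaining gap absorbs all polynomial factors.
\<close>
definition lam :: real where "lam = 1.236507"

text \<open>One inequality for each branching vector: a child that loses \<open>p\<close> core
  vertices has at most the fraction \<open>1 / lam ^ p\<close> of its parent's weight, so the
  children together weigh no more than the parent.\<close>

lemma lam_sums:
  "1 / lam ^ 3 + 1 / lam ^ 4 \<le> 1" "1 / lam ^ 2 + 1 / lam ^ 5 \<le> 1" "1 / lam ^ 1 + 1 / lam ^ 8 \<le> 1"
  "2 / lam ^ 5 + 1 / lam ^ 6 \<le> 1" "3 / lam ^ 6 \<le> 1" "4 / lam ^ 7 \<le> 1"
  by (simp_all add: lam_def power_divide divide_simps)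

lemma lam_ge_1: "1 \<le> lam" and lam_pos: "0 < lam"
  by (simp_all add: lam_def)

lemma card_2_insert:
  assumes "card S = 2" "x \<in> S"
  obtains y where "S = {x, y}" "y \<noteq> x"
  using assms by (metis card_2_iff insert_iff singletonD doubleton_eq_iff)

text \<open>\<open>T\<close> stands for the atoms that must be met, later the atoms that are not
  facts. \<open>asym\<close> excludes 2-cycles but admits loops, as only pairs of different clauses
  count as dual.\<close>

locale kernel_search =
  fixes E :: "nat \<Rightarrow> nat \<Rightarrow> bool" and T :: "nat set"
  assumes asym: "E a b \<Longrightarrow> E b a \<Longrightarrow> a = b"
begin

section \<open>Neighbourhoods and the core\<close>

definition out_nbh :: "nat \<Rightarrow> nat set" where "out_nbh v = {u. u = v \<or> E v u}"
definition nbh :: "nat \<Rightarrow> nat set" where "nbh v = {u. u = v \<or> E v u \<or> E u v}"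
definition in_nbh :: "nat \<Rightarrow> nat set" where "in_nbh v = {u. E u v}"

definition core :: "nat set \<Rightarrow> nat set" where
  "core U = \<Union>{C. C \<subseteq> U \<and> (\<forall>v\<in>C. \<exists>w\<in>C. E w v)}"

lemma core_subset: "core U \<subseteq> U"
  unfolding core_def by auto

lemma core_in_edge: "v \<in> core U \<Longrightarrow> \<exists>w\<in>core U. E w v"
  unfolding core_def by blast

lemma core_greatest: "C \<subseteq> U \<Longrightarrow> (\<And>v. v \<in> C \<Longrightarrow> \<exists>w\<in>C. E w v) \<Longrightarrow> C \<subseteq> core U"
  unfolding core_def by blast

lemma core_mono: "U \<subseteq> V \<Longrightarrow> core U \<subseteq> core V"
  unfolding core_def by blast

text \<open>Adding \<open>u\<close> to the core keeps all in-degrees positive, since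
  \<open>v\<close> supplies \<open>u\<close>; maximality does the rest. Hence the out-degree of a
  core vertex is the same in \<open>U\<close> and in the core.\<close>

lemma core_out_edge:
  assumes "v \<in> core U" "u \<in> U" "E v u"
  shows "u \<in> core U"
proof -
  have "insert u (core U) \<subseteq> core U"
    by (rule core_greatest) (use assms core_subset core_in_edge in blast)+
  then show ?thesis by blast
qed

lemma core_self:
  assumes "\<And>v. v \<in> W \<Longrightarrow> \<exists>w\<in>W. E w v"
  shows "core W = W"
  using core_subset core_greatest[of W W] assms by blast

text \<open>Take a minimal nonempty subset of \<open>U\<close> closed under edges into
  \<open>U\<close>. Its vertices with an in-neighbour inside form another such set, so by minimality
  every vertex has one and the subset lies in the core.\<close>

lemma core_nonempty:
  assumes "finite U" "U \<noteq> {}" "\<And>v. v \<in> U \<Longrightarrow> \<exists>u\<in>U. E v u"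
  shows "core U \<noteq> {}"
proof -
  define Q where "Q S \<longleftrightarrow> S \<subseteq> U \<and> S \<noteq> {} \<and> (\<forall>v\<in>S. \<forall>u\<in>U. E v u \<longrightarrow> u \<in> S)" for S
  have "Q U" using assms by (auto simp: Q_def)
  then obtain S where S: "Q S" and S_min: "\<And>S'. Q S' \<Longrightarrow> card S \<le> card S'"
    by (metis ex_has_least_nat[of Q U card])
  define C where "C = {v \<in> S. \<exists>w\<in>S. E w v}"
  have "C \<noteq> {}" using S assms(3) unfolding Q_def C_def by blast
  then have "Q C" using S unfolding Q_def C_def by blast
  then have "card S \<le> card C" by (rule S_min)
  moreover have "C \<subseteq> S" by (auto simp: C_def)
  moreover have "finite S" using S assms(1) finite_subset unfolding Q_def by blast
  ultimately have "C = S" by (metis card_seteq)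
  then have "S \<subseteq> core U" using S unfolding Q_def C_def
    by (intro core_greatest) blast+
  then show ?thesis using S by (auto simp: Q_def)
qed

section \<open>Propagation and the weight of a state\<close>

definition unsat :: "nat set \<Rightarrow> nat \<Rightarrow> bool" where
  "unsat K v \<longleftrightarrow> v \<in> T \<and> out_nbh v \<inter> K = {}"

definition failing :: "nat set \<Rightarrow> nat set \<Rightarrow> bool" where
  "failing K U \<longleftrightarrow> (\<exists>v. unsat K v \<and> out_nbh v \<inter> U = {})"

definition forced :: "nat set \<Rightarrow> nat set \<Rightarrow> nat set" where
  "forced K U = {z. \<exists>v. unsat K v \<and> out_nbh v \<inter> U = {z}}"

definition star :: "nat set \<Rightarrow> nat set \<Rightarrow> nat set" where
  "star K U = U - (\<Union>z\<in>forced K U. nbh z)"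

text \<open>
  The weight of a state bounds the number of leaves below it.  It looks one propagation step ahead,
  since one of the branches at a vertex of out-degree 1 gains its fourth vertex only there.
\<close>
definition weight :: "nat set \<Rightarrow> nat set \<Rightarrow> real" where
  "weight K U = (if failing K U then 0 else lam ^ card (core (star K U)))"

text \<open>The children form a comb: the one that selects \<open>u\<close> has already rejected the
  vertices listed before \<open>u\<close>, which keeps the children disjoint; the last child rejects
  all of them.\<close>

fun branch_weight :: "nat set \<Rightarrow> nat set \<Rightarrow> nat list \<Rightarrow> real" where
  "branch_weight K U [] = weight K U"
| "branch_weight K U (u # us) = weight (insert u K) (U - nbh u) + branch_weight K (U - {u}) us"

lemma weight_nonneg: "0 \<le> weight K U"
  using lam_pos by (simp add: weight_def)

lemma weight_ge_1: "\<not> failing K U \<Longrightarrow> 1 \<le> weight K U"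
  using lam_ge_1 by (simp add: weight_def)

lemma weight_failing: "failing K U \<Longrightarrow> weight K U = 0"
  by (simp add: weight_def)

lemma nbh_sym: "u \<in> nbh v \<longleftrightarrow> v \<in> nbh u"
  by (auto simp: nbh_def)

lemma nbh_self: "v \<in> nbh v"
  by (auto simp: nbh_def)

text \<open>Let \<open>y\<close> be another forced vertex and \<open>v\<close> its witness. As
  \<open>z\<close> is no option for \<open>v\<close>, selecting \<open>z\<close> leaves
  \<open>v\<close> unmet, and then \<open>y\<close> is either still its only option or lost, in
  which case the child fails. So the look-ahead of the child removes all that the look-ahead of the
  parent removes.\<close>

lemma weight_forced:
  assumes "finite U" "z \<in> forced K U"
  shows "weight (insert z K) (U - nbh z) \<le> weight K U"
proof (cases "failing (insert z K) (U - nbh z)")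
  case True then show ?thesis by (simp add: weight_failing weight_nonneg)
next
  case nf: False
  have "\<not> failing K U"
  proof
    assume "failing K U"
    then obtain v where v: "unsat K v" "out_nbh v \<inter> U = {}" by (auto simp: failing_def)
    then have "unsat (insert z K) v" using assms(2) by (auto simp: unsat_def forced_def)
    then show False using v nf by (auto simp: failing_def)
  qed
  moreover have "star (insert z K) (U - nbh z) \<subseteq> star K U"
  proof
    fix x assume x: "x \<in> star (insert z K) (U - nbh z)"
    have "x \<notin> nbh y" if "y \<in> forced K U" for y
    proof (cases "y = z")
      case True then show ?thesis using x by (auto simp: star_def)
    next
      case False
      obtain v where v: "unsat K v" "out_nbh v \<inter> U = {y}" using \<open>y \<in> forced K U\<close> by (auto simp: forced_def)
      have "z \<in> U" using assms(2) by (auto simp: forced_def)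
      then have u: "unsat (insert z K) v" using v False by (auto simp: unsat_def)
      then have "out_nbh v \<inter> (U - nbh z) \<noteq> {}" using nf by (auto simp: failing_def)
      moreover have "out_nbh v \<inter> (U - nbh z) \<subseteq> {y}" using v(2) by blast
      ultimately have "out_nbh v \<inter> (U - nbh z) = {y}" by blast
      then have "y \<in> forced (insert z K) (U - nbh z)" using u by (auto simp: forced_def)
      then show ?thesis using x by (auto simp: star_def)
    qed
    then show "x \<in> star K U" using x by (auto simp: star_def)
  qed
  moreover have "finite (star K U)" using assms(1) by (auto simp: star_def)
  ultimately show ?thesis using nf lam_ge_1
    by (auto simp: weight_def intro!: power_increasing card_mono core_mono
        intro: finite_subset[OF core_subset])
qed

text \<open>\<open>W\<close> is meant to be the core of the parent, and \<open>S\<close> a set of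
  its vertices that the child provably loses.\<close>

lemma weight_gain:
  assumes "finite W" "S \<subseteq> W" "p \<le> card S" "core (star K U) \<subseteq> W - S"
  shows "weight K U \<le> lam ^ card W / lam ^ p"
proof -
  have "card (core (star K U)) \<le> card (W - S)" using assms by (intro card_mono) auto
  also have "card (W - S) = card W - card S" using assms by (metis card_Diff_subset finite_subset)
  finally have "card (core (star K U)) + p \<le> card W"
    using assms card_mono[of W S] by linarith
  then have "lam ^ (card (core (star K U)) + p) \<le> lam ^ card W"
    using lam_ge_1 by (rule power_increasing)
  then show ?thesis using lam_pos
    by (auto simp: weight_def power_add pos_le_divide_eq)
qed

lemma star_subset: "star K U \<subseteq> U"
  by (auto simp: star_def)

lemma weight_gain_core:
  assumes "finite W" "S \<subseteq> W" "p \<le> card S" "core U \<subseteq> W - S"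
  shows "weight K U \<le> lam ^ card W / lam ^ p"
  using assms core_mono[OF star_subset, of K U] by (intro weight_gain) auto

text \<open>\<open>D\<close> stands for the vertices rejected before \<open>u\<close>; asking for
  all \<open>D\<close> makes the bound independent of the place of \<open>u\<close> in the
  list.\<close>

lemma branch_weight_le_sum:
  assumes "\<And>u D. u \<in> set us \<Longrightarrow> weight (insert u K) (U - D - nbh u) \<le> f u"
  shows "branch_weight K U us \<le> sum_list (map f us) + weight K (U - set us)"
  using assms
proof (induction us arbitrary: U)
  case (Cons u us)
  have "weight (insert u K) (U - nbh u) \<le> f u" using Cons.prems[of u "{}"] by simp
  moreover have "branch_weight K (U - {u}) us \<le> sum_list (map f us) + weight K (U - {u} - set us)"
  proof (rule Cons.IH)
    fix x D assume "x \<in> set us"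
    then show "weight (insert x K) (U - {u} - D - nbh x) \<le> f x"
      using Cons.prems[of x "insert u D"] Diff_insert2[of U u D] by simp
  qed
  moreover have "U - {u} - set us = U - set (u # us)" by auto
  ultimately show ?case by simp
qed simp

end

section \<open>States in which propagation is exhausted\<close>

locale branch_state = kernel_search +
  fixes K U :: "nat set"
  assumes fin: "finite U" and UT: "U \<subseteq> T" and noloop: "u \<in> U \<Longrightarrow> \<not> E u u"
    and sep: "k \<in> K \<Longrightarrow> U \<inter> nbh k = {}"
    and not_failing: "\<not> failing K U" and not_forced: "forced K U = {}"
begin

definition W where "W = core U"

text \<open>\<open>odeg\<close> and \<open>deg\<close> count the vertex itself, \<open>ideg\<close> does not.\<close>
definition "odeg v = card (out_nbh v \<inter> W)"
definition "deg v = card (nbh v \<inter> W)"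
definition "ideg v = card (in_nbh v \<inter> W)"

lemma WU: "W \<subseteq> U" by (simp add: W_def core_subset)
lemma finW: "finite W" using WU fin finite_subset by blast
lemma W_out: "v \<in> W \<Longrightarrow> u \<in> U \<Longrightarrow> E v u \<Longrightarrow> u \<in> W" by (simp add: W_def core_out_edge)
lemma W_in: "v \<in> W \<Longrightarrow> \<exists>w\<in>W. E w v" by (simp add: W_def core_in_edge)
lemma out_nbh_W: "v \<in> W \<Longrightarrow> out_nbh v \<inter> U = out_nbh v \<inter> W"
  using W_out WU by (auto simp: out_nbh_def)
lemma noloopW: "u \<in> W \<Longrightarrow> \<not> E u u" using noloop WU by blast
lemma asymW: "E a b \<Longrightarrow> a \<in> W \<Longrightarrow> \<not> E b a" using asym noloopW by blast

lemma unsat_U: "u \<in> U \<Longrightarrow> unsat K u"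
  using UT sep unfolding unsat_def out_nbh_def nbh_def by blast

text \<open>An undecided vertex is not adjacent to a selected one, hence not yet met. Without
  options the state would fail, and a single option would be forced.\<close>

lemma odeg_ge_2: assumes "v \<in> W" shows "2 \<le> odeg v"
proof -
  have u: "unsat K v" using assms WU unsat_U by blast
  then have "out_nbh v \<inter> U \<noteq> {}" using not_failing by (auto simp: failing_def)
  moreover have "\<nexists>z. out_nbh v \<inter> U = {z}" using u not_forced by (auto simp: forced_def)
  ultimately have "card (out_nbh v \<inter> U) \<noteq> 0 \<and> card (out_nbh v \<inter> U) \<noteq> 1"
    using fin by (simp add: card_1_singleton_iff)
  then show ?thesis by (simp add: odeg_def out_nbh_W assms)
qed

text \<open>The two parts are disjoint because the core has neither loops nor 2-cycles. Here the
  exclusion of dual clauses enters: it makes in- and out-degrees add up to what a selection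
  removes.\<close>

lemma deg_eq: assumes "v \<in> W" shows "deg v = odeg v + ideg v"
proof -
  have "nbh v \<inter> W = (out_nbh v \<inter> W) \<union> (in_nbh v \<inter> W)"
    by (auto simp: nbh_def out_nbh_def in_nbh_def)
  moreover have "(out_nbh v \<inter> W) \<inter> (in_nbh v \<inter> W) = {}"
    using assms asymW noloopW by (auto simp: out_nbh_def in_nbh_def)
  ultimately show ?thesis unfolding deg_def odeg_def ideg_def
    using finW by (simp add: card_Un_disjoint)
qed

lemma ideg_ge_1: assumes "v \<in> W" shows "1 \<le> ideg v"
proof -
  have "in_nbh v \<inter> W \<noteq> {}" using W_in assms by (auto simp: in_nbh_def)
  then show ?thesis using finW unfolding ideg_def by (simp add: Suc_leI card_gt_0_iff)
qed

lemma weight_eq: "weight K U = lam ^ card W"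
  by (simp add: weight_def not_failing star_def not_forced W_def)

abbreviation "\<Lambda> \<equiv> lam ^ card W"

lemma \<Lambda>_sums: 
  "\<Lambda> / lam ^ 3 + \<Lambda> / lam ^ 4 \<le> \<Lambda>" "\<Lambda> / lam ^ 2 + \<Lambda> / lam ^ 5 \<le> \<Lambda>" "\<Lambda> / lam ^ 1 + \<Lambda> / lam ^ 8 \<le> \<Lambda>"
  "2 * (\<Lambda> / lam ^ 5) + \<Lambda> / lam ^ 6 \<le> \<Lambda>" "3 * (\<Lambda> / lam ^ 6) \<le> \<Lambda>" "4 * (\<Lambda> / lam ^ 7) \<le> \<Lambda>"
proof -
  have *: "0 \<le> \<Lambda>" using lam_pos by simp
  note m = mult_left_mono[OF _ *]
  show "\<Lambda> / lam ^ 3 + \<Lambda> / lam ^ 4 \<le> \<Lambda>" using m[OF lam_sums(1)] by (simp add: distrib_left)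
  show "\<Lambda> / lam ^ 2 + \<Lambda> / lam ^ 5 \<le> \<Lambda>" using m[OF lam_sums(2)] by (simp add: distrib_left)
  show "\<Lambda> / lam ^ 1 + \<Lambda> / lam ^ 8 \<le> \<Lambda>" using m[OF lam_sums(3)] by (simp add: distrib_left)
  show "2 * (\<Lambda> / lam ^ 5) + \<Lambda> / lam ^ 6 \<le> \<Lambda>" using m[OF lam_sums(4)] by (simp add: distrib_left mult.commute)
  show "3 * (\<Lambda> / lam ^ 6) \<le> \<Lambda>" using m[OF lam_sums(5)] by (simp add: mult.commute)
  show "4 * (\<Lambda> / lam ^ 7) \<le> \<Lambda>" using m[OF lam_sums(6)] by (simp add: mult.commute)
qed

lemma weight_nbh:
  assumes "S \<subseteq> W" "p \<le> card S" "core V \<inter> S = {}" "V \<subseteq> U"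
  shows "weight K' V \<le> \<Lambda> / lam ^ p"
proof (rule weight_gain_core[OF finW assms(1,2)])
  show "core V \<subseteq> W - S" using core_mono[OF assms(4)] assms(3) by (auto simp: W_def)
qed

lemma weight_deg:
  assumes "p \<le> deg u"
  shows "weight K' (U - D - nbh u) \<le> \<Lambda> / lam ^ p"
  by (rule weight_nbh[of "nbh u \<inter> W"])
    (use assms core_subset[of "U - D - nbh u"] in \<open>auto simp: deg_def\<close>)

lemma weight_decr:
  "p \<le> q \<Longrightarrow> \<Lambda> / lam ^ q \<le> \<Lambda> / lam ^ p"
  using lam_ge_1 lam_pos by (simp add: frac_le power_increasing)

text \<open>One vertex of the closed out-neighbourhood has to be selected, so the child that rejects
  all of it fails and weighs nothing.\<close>

lemma none_branch:
  assumes "v \<in> W" "set us = out_nbh v \<inter> W"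
  shows "weight K (U - set us) = 0"
proof -
  have "out_nbh v \<inter> (U - set us) = {}" using assms out_nbh_W by blast
  moreover have "unsat K v" using assms(1) unsat_U WU by blast
  ultimately show ?thesis by (intro weight_failing) (auto simp: failing_def)
qed

section \<open>The branching cases\<close>

lemma branch_out_nbh:
  assumes "v \<in> W" "set us = out_nbh v \<inter> W"
    and "\<And>u D. u \<in> set us \<Longrightarrow> weight (insert u K) (U - D - nbh u) \<le> f u"
  shows "branch_weight K U us \<le> sum_list (map f us)"
  using branch_weight_le_sum[of us K U f] assms none_branch[OF assms(1,2)] by simp

text \<open>Either \<open>u\<close> or its only out-neighbour \<open>y\<close> must be selected, and
  both choices remove at least three vertices; one of them has to remove a fourth. This is clear if
  one of the two has degree 4. Otherwise selecting \<open>u\<close> leaves at most one option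
  \<open>z\<close> for \<open>y\<close>: the child fails, or \<open>z\<close> is forced and is
  removed by the look-ahead.\<close>

lemma branch_out_degree_1:
  assumes "u \<in> W" "odeg u \<le> 2" "set us = out_nbh u \<inter> W" "distinct us"
  shows "branch_weight K U us \<le> \<Lambda>"
proof -
  have "card (out_nbh u \<inter> W) = 2" using odeg_ge_2[OF assms(1)] assms(2) by (simp add: odeg_def)
  then obtain y where y: "out_nbh u \<inter> W = {u, y}" "y \<noteq> u"
    using assms(1) by (elim card_2_insert[of _ u]) (auto simp: out_nbh_def)
  then have yW: "y \<in> W" and uy: "E u y" by (auto simp: out_nbh_def)
  have len: "length us = 2" using distinct_card[OF assms(4)] assms(3) y by simp
  have sum: "sum_list (map f us) = f u + f y" for f :: "nat \<Rightarrow> real"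
    using sum_list_distinct_conv_sum_set[OF assms(4), of f] assms(3) y by simp
  have deg3: "3 \<le> deg x" if "x \<in> W" for x
    using deg_eq ideg_ge_1 odeg_ge_2 that by fastforce
  have w3: "weight K' (U - D - nbh x) \<le> \<Lambda> / lam ^ 3" if "x \<in> W" for K' D x
    using deg3 that by (intro weight_deg) auto
  have w4: "weight K' (U - D - nbh x) \<le> \<Lambda> / lam ^ 4" if "4 \<le> deg x" for K' D x
    using that by (intro weight_deg) auto
  consider "4 \<le> deg u" | "4 \<le> deg y" | "deg u = 3" "deg y = 3"
    using deg3 assms(1) yW by force
  then show ?thesis
  proof cases
    case 1
    have "branch_weight K U us \<le> sum_list (map (\<lambda>x. if x = u then \<Lambda> / lam ^ 4 else \<Lambda> / lam ^ 3) us)"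
      using assms(1,3) w3 w4 1 by (intro branch_out_nbh[of u]) auto
    then show ?thesis using sum[of "\<lambda>x. if x = u then \<Lambda> / lam ^ 4 else \<Lambda> / lam ^ 3"] \<Lambda>_sums(1) y(2) by simp
  next
    case 2
    have "branch_weight K U us \<le> sum_list (map (\<lambda>x. if x = y then \<Lambda> / lam ^ 4 else \<Lambda> / lam ^ 3) us)"
      using assms(1,3) w3 w4 2 by (intro branch_out_nbh[of u]) auto
    then show ?thesis using sum[of "\<lambda>x. if x = y then \<Lambda> / lam ^ 4 else \<Lambda> / lam ^ 3"] \<Lambda>_sums(1) y(2) by simp
  next
    case 3
    have "odeg y = 2" using 3 deg_eq[OF yW] odeg_ge_2[OF yW] ideg_ge_1[OF yW] by linarith
    then obtain z where z: "out_nbh y \<inter> W = {y, z}" "z \<noteq> y"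
      using yW unfolding odeg_def by (elim card_2_insert[of _ y]) (auto simp: out_nbh_def)
    obtain w where w: "w \<in> W" "E w u" using W_in assms(1) by blast
    have ne: "w \<noteq> u" "w \<noteq> y" "z \<noteq> u"
      using w noloopW asymW uy z assms(1) by (auto simp: out_nbh_def)
    have nu: "nbh u \<inter> W = {w, u, y}"
    proof (rule sym, rule card_seteq)
      show "{w, u, y} \<subseteq> nbh u \<inter> W" using w yW uy assms(1) by (auto simp: nbh_def)
      show "card (nbh u \<inter> W) \<le> card {w, u, y}" using 3(1) ne y(2) by (simp add: deg_def)
    qed (use finW in auto)
    have zW: "z \<in> W" and yz: "E y z" using z by (auto simp: out_nbh_def)
    have unsat_y: "unsat (insert u K) y"
      using unsat_U[of y] yW WU asymW[OF uy assms(1)] y(2) by (auto simp: unsat_def out_nbh_def)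
    have w4u: "weight (insert u K) (U - D - nbh u) \<le> \<Lambda> / lam ^ 4" for D
    \<comment> \<open>In this case \<open>z\<close> disappears as well, so no option for
      \<open>y\<close> is left.\<close>
    proof (cases "z = w \<or> z \<in> D")
      case True
      have "out_nbh y \<inter> (U - D - nbh u) = {}"
        using out_nbh_W[OF yW] z nu True by auto
      then have "failing (insert u K) (U - D - nbh u)" using unsat_y by (auto simp: failing_def)
      then show ?thesis using lam_pos by (simp add: weight_failing)
    next
      case False
      let ?V = "U - D - nbh u"
      have "z \<in> ?V" using False nu zW WU ne z(2) by auto
      then have "out_nbh y \<inter> ?V = {z}"
        using out_nbh_W[OF yW] z nu by auto
      then have "z \<in> forced (insert u K) ?V" using unsat_y by (auto simp: forced_def)
      then have "z \<notin> star (insert u K) ?V" by (auto simp: star_def nbh_def)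
      then have "core (star (insert u K) ?V) \<subseteq> W - {w, u, y, z}"
        using core_subset[of "star (insert u K) ?V"] star_subset[of "insert u K" ?V]
          core_mono[of "star (insert u K) ?V" U] nu unfolding W_def by blast
      then show ?thesis using w zW yW assms(1) ne y(2) z(2) False
        by (intro weight_gain[of _ "{w, u, y, z}"] finW) auto
    qed
    have "branch_weight K U us \<le> sum_list (map (\<lambda>x. if x = u then \<Lambda> / lam ^ 4 else \<Lambda> / lam ^ 3) us)"
      using assms(1,3) w3 w4u y by (intro branch_out_nbh[of u]) auto
    then show ?thesis using sum[of "\<lambda>x. if x = u then \<Lambda> / lam ^ 4 else \<Lambda> / lam ^ 3"] \<Lambda>_sums(1) y(2) by simp
  qed
qed

text \<open>A core vertex needs an in-neighbour in the core, so losses spread along the edges. The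
  rejecting children owe their gain to this.\<close>

lemma core_removed:
  assumes "\<And>w. w \<in> W \<Longrightarrow> E w y \<Longrightarrow> w \<notin> core V" "V \<subseteq> U"
  shows "y \<notin> core V"
  using core_in_edge[of y V] assms core_mono[OF assms(2)] by (auto simp: W_def)

text \<open>Rejecting \<open>p\<close>, the only in-neighbour of \<open>y\<close>, also removes
  \<open>y\<close>; this gives 2 and 5 if \<open>p\<close> has degree at least 5. Otherwise
  \<open>p\<close> in turn has a single in-neighbour \<open>x\<close>, and rejecting
  \<open>x\<close> removes \<open>x\<close>, \<open>p\<close> and \<open>y\<close>, while selecting
  \<open>x\<close> removes at least four vertices.\<close>

lemma branch_in_degree_1:
  assumes "\<And>v. v \<in> W \<Longrightarrow> 3 \<le> odeg v" and y: "y \<in> W" "in_nbh y \<inter> W = {p}"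
  shows "5 \<le> deg p \<Longrightarrow> branch_weight K U [p] \<le> \<Lambda>"
    and "deg p < 5 \<Longrightarrow> in_nbh p \<inter> W \<noteq> {} \<and> (\<forall>x \<in> in_nbh p \<inter> W. branch_weight K U [x] \<le> \<Lambda>)"
proof -
  have p: "p \<in> W" "E p y" using y by (auto simp: in_nbh_def)
  have py: "p \<noteq> y" using p noloopW by blast
  { assume d: "5 \<le> deg p"
    have "weight (insert p K) (U - nbh p) \<le> \<Lambda> / lam ^ 5"
      using weight_deg[OF d, of _ "{}"] by simp
    moreover have "weight K (U - {p}) \<le> \<Lambda> / lam ^ 2"
    proof (rule weight_nbh[of "{p, y}"])
      have pn: "p \<notin> core (U - {p})" using core_subset by blast
      moreover have "y \<notin> core (U - {p})"
        by (rule core_removed) (use y pn in \<open>auto simp: in_nbh_def\<close>)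
      ultimately show "core (U - {p}) \<inter> {p, y} = {}" by blast
    qed (use p y py in auto)
    ultimately show "branch_weight K U [p] \<le> \<Lambda>" using \<Lambda>_sums(2) by simp
  }
  { assume d: "deg p < 5"
    have "ideg p = 1" using d deg_eq[OF p(1)] assms(1)[OF p(1)] ideg_ge_1[OF p(1)] by linarith
    then obtain x where x: "in_nbh p \<inter> W = {x}" by (auto simp: ideg_def card_1_singleton_iff)
    have xW: "x \<in> W" "E x p" using x by (auto simp: in_nbh_def)
    have "4 \<le> deg x" using deg_eq assms(1) ideg_ge_1 xW by fastforce
    then have "weight (insert x K) (U - nbh x) \<le> \<Lambda> / lam ^ 4"
      using weight_deg[of 4 x _ "{}"] by simp
    moreover have "weight K (U - {x}) \<le> \<Lambda> / lam ^ 3"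
    proof (rule weight_nbh[of "{x, p, y}"])
      have xn: "x \<notin> core (U - {x})" using core_subset by blast
      moreover have pn: "p \<notin> core (U - {x})"
        by (rule core_removed) (use x xn in \<open>auto simp: in_nbh_def\<close>)
      moreover have "y \<notin> core (U - {x})"
        by (rule core_removed) (use y pn in \<open>auto simp: in_nbh_def\<close>)
      ultimately show "core (U - {x}) \<inter> {x, p, y} = {}" by blast
      \<comment> \<open>The case \<open>x = y\<close> would be a 2-cycle through
        \<open>p\<close>.\<close>
      have "x \<noteq> p" "p \<noteq> y" "x \<noteq> y" using p xW noloopW asymW by blast+
      then show "3 \<le> card {x, p, y}" by simp
    qed (use xW p y in auto)
    ultimately have "branch_weight K U [x] \<le> \<Lambda>" using \<Lambda>_sums(1) by simp
    then show "in_nbh p \<inter> W \<noteq> {} \<and> (\<forall>x \<in> in_nbh p \<inter> W. branch_weight K U [x] \<le> \<Lambda>)"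
      using x by simp
  }
qed

lemma branch_high_degree:
  assumes "x \<in> W" "8 \<le> deg x"
  shows "branch_weight K U [x] \<le> \<Lambda>"
proof -
  have "weight (insert x K) (U - nbh x) \<le> \<Lambda> / lam ^ 8"
    using weight_deg[OF assms(2), of _ "{}"] by simp
  moreover have "weight K (U - {x}) \<le> \<Lambda> / lam ^ 1"
    by (rule weight_nbh[of "{x}"]) (use assms core_subset in auto)
  ultimately show ?thesis using \<Lambda>_sums(3) by simp
qed

text \<open>All three children lose at least five vertices, so it suffices that one of them loses
  six. If two of the three vertices are not adjacent, the child selecting the later one also loses
  the earlier one, which has been rejected and lies outside the removed neighbourhood.\<close>

lemma branch_spread:
  assumes out: "\<And>v. v \<in> W \<Longrightarrow> 3 \<le> odeg v" and inn: "\<And>v. v \<in> W \<Longrightarrow> 2 \<le> ideg v"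
    and v: "v \<in> W" "odeg v \<le> 3" "set us = out_nbh v \<inter> W" "distinct us"
    and u: "u \<in> out_nbh v \<inter> W" "6 \<le> deg u \<or> (\<exists>u' \<in> out_nbh v \<inter> W. u' \<notin> nbh u)"
  shows "branch_weight K U us \<le> \<Lambda>"
proof -
  have deg5: "5 \<le> deg x" if "x \<in> W" for x
    using deg_eq inn out that by fastforce
  have w5: "weight K' (U - D - nbh x) \<le> \<Lambda> / lam ^ 5" if "x \<in> W" for K' D x
    using deg5 that by (intro weight_deg) auto
  have len: "length us = 3" using distinct_card[OF v(4)] v out[OF v(1)] by (simp add: odeg_def)
  from u(2) show ?thesis
  proof
    assume d: "6 \<le> deg u"
    let ?f = "\<lambda>x. if x = u then \<Lambda> / lam ^ 6 else \<Lambda> / lam ^ 5"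
    have "branch_weight K U us \<le> sum_list (map ?f us)"
      using v w5 weight_deg[OF d] by (intro branch_out_nbh[of v]) auto
    also have "sum_list (map ?f us) = sum ?f (set us)"
      by (rule sum_list_distinct_conv_sum_set[OF v(4)])
    also have "\<dots> = \<Lambda> / lam ^ 6 + sum ?f (set us - {u})"
      using u(1) v(3)[symmetric] by (subst sum.remove[of "set us" u]) simp_all
    also have "sum ?f (set us - {u}) = sum (\<lambda>_. \<Lambda> / lam ^ 5) (set us - {u})"
      by (rule sum.cong) auto
    also have "\<dots> = 2 * (\<Lambda> / lam ^ 5)"
      using u(1) v(3) len distinct_card[OF v(4)] by (simp add: card_Diff_singleton)
    finally show ?thesis using \<Lambda>_sums(4) by simp
  next
    assume "\<exists>u' \<in> out_nbh v \<inter> W. u' \<notin> nbh u"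
    then obtain u' where u': "u' \<in> out_nbh v \<inter> W" "u' \<notin> nbh u" by blast
    obtain a b c where us: "us = [a, b, c]"
      using len by (auto simp: length_Suc_conv numeral_3_eq_3)
    have W3: "a \<in> W" "b \<in> W" "c \<in> W" using v(3) us by auto
    have w6: "weight K' (U - D - nbh x) \<le> \<Lambda> / lam ^ 6"
      if "x \<in> W" "d \<in> D" "d \<in> W" "d \<notin> nbh x" for K' D x d
    proof (rule weight_nbh[of "insert d (nbh x \<inter> W)"])
      show "6 \<le> card (insert d (nbh x \<inter> W))" using deg5[OF that(1)] that finW by (simp add: deg_def)
      show "core (U - D - nbh x) \<inter> insert d (nbh x \<inter> W) = {}" using core_subset[of "U - D - nbh x"] that by auto
    qed (use that in auto)
    \<comment> \<open>The gain depends on which vertices were rejected before, so the sum is written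
      out; the child that rejects all three contributes nothing.\<close>
    have w: "branch_weight K U us = weight (insert a K) (U - {} - nbh a) + weight (insert b K) (U - {a} - nbh b)
       + weight (insert c K) (U - {a,b} - nbh c)"
      using none_branch[OF v(1,3)] us by (simp add: Diff_insert[symmetric] insert_commute)
    have d6: "\<Lambda> / lam ^ 6 \<le> \<Lambda> / lam ^ 5" by (rule weight_decr) simp
    \<comment> \<open>Adjacency is symmetric, so the non-adjacent pair can be ordered as it occurs
      in the list.\<close>
    have "a \<notin> nbh b \<or> b \<notin> nbh c \<or> a \<notin> nbh c"
    proof -
      have uu: "u \<in> {a, b, c}" "u' \<in> {a, b, c}" using u(1) u'(1) v(3) us by auto
      show ?thesis
        using uu u'(2) nbh_sym[of a b] nbh_sym[of b c] nbh_sym[of a c] nbh_self by auto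
    qed
    then show ?thesis
    proof (elim disjE)
      assume "a \<notin> nbh b"
      then have "weight (insert b K) (U - {a} - nbh b) \<le> \<Lambda> / lam ^ 6" using W3 by (intro w6) auto
      then show ?thesis unfolding w
        using w5[OF W3(1), of "insert a K" "{}"] w5[OF W3(3), of "insert c K" "{a,b}"] \<Lambda>_sums(4) by linarith
    next
      assume "b \<notin> nbh c"
      then have "weight (insert c K) (U - {a,b} - nbh c) \<le> \<Lambda> / lam ^ 6" using W3 by (intro w6[where d=b]) auto
      then show ?thesis unfolding w
        using w5[OF W3(1), of "insert a K" "{}"] w5[OF W3(2), of "insert b K" "{a}"] \<Lambda>_sums(4) by linarith
    next
      assume "a \<notin> nbh c"
      then have "weight (insert c K) (U - {a,b} - nbh c) \<le> \<Lambda> / lam ^ 6" using W3 by (intro w6[where d=a]) auto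
      then show ?thesis unfolding w
        using w5[OF W3(1), of "insert a K" "{}"] w5[OF W3(2), of "insert b K" "{a}"] \<Lambda>_sums(4) by linarith
    qed
  qed
qed

text \<open>
  When the previous case does not apply, the vertices of out-degree 2 form squares of oriented cycles,
  \<open>x\<^sub>i \<rightarrow> x\<^sub>i\<^sub>+\<^sub>1, x\<^sub>i\<^sub>+\<^sub>2\<close>: selecting \<open>x\<^sub>0\<close> leaves \<open>x\<^sub>3\<close> without in-neighbours,
  unless \<open>x\<^sub>3 \<rightarrow> x\<^sub>0\<close>, and then \<open>x\<^sub>1\<close> can no longer be dominated.
\<close>
lemma branch_cycle_square:
  assumes out: "\<And>v. v \<in> W \<Longrightarrow> 3 \<le> odeg v" and inn: "\<And>v. v \<in> W \<Longrightarrow> 2 \<le> ideg v"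
    and no4: "\<And>v u. v \<in> W \<Longrightarrow> odeg v \<le> 3 \<Longrightarrow> u \<in> out_nbh v \<inter> W \<Longrightarrow> deg u \<le> 5 \<and> out_nbh v \<inter> W \<subseteq> nbh u"
    and v: "v \<in> W" "odeg v \<le> 3" "set us = out_nbh v \<inter> W" "distinct us"
  shows "branch_weight K U us \<le> \<Lambda>"
proof -
  have deg5: "odeg u = 3 \<and> ideg u = 2 \<and> deg u = 5" if "x \<in> W" "odeg x \<le> 3" "u \<in> out_nbh x \<inter> W" for x u
    using no4[OF that] deg_eq[of u] inn[of u] out[of u] that(3) by auto
  \<comment> \<open>The vertices of the closed out-neighbourhood are pairwise adjacent, so they form
    a transitive triangle; \<open>a\<close> is its middle vertex.\<close>
  have step: "\<exists>a b. a \<in> W \<and> b \<in> W \<and> E x a \<and> E x b \<and> E a b \<and> out_nbh x \<inter> W = {x, a, b} \<and> odeg a = 3 \<and> odeg b = 3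
      \<and> ideg b = 2"
    if "x \<in> W" "odeg x \<le> 3" for x
  proof -
    have "card (out_nbh x \<inter> W - {x}) = 2"
      using out[OF that(1)] that finW by (auto simp: odeg_def out_nbh_def)
    then obtain a b where ab: "out_nbh x \<inter> W - {x} = {a, b}" "a \<noteq> b" by (auto simp: card_2_iff)
    then have *: "a \<in> out_nbh x \<inter> W" "b \<in> out_nbh x \<inter> W" "a \<noteq> x" "b \<noteq> x" by blast+
    then have o: "out_nbh x \<inter> W = {x, a, b}" using ab that by (auto simp: out_nbh_def)
    have "b \<in> nbh a" using no4[OF that *(1)] * by blast
    then have "E a b \<or> E b a" using ab(2) by (auto simp: nbh_def)
    then show ?thesis
    proof
      assume "E a b" then show ?thesis using * o deg5[OF that *(1)] deg5[OF that *(2)] by (auto simp: out_nbh_def)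
    next
      assume "E b a" then show ?thesis using * o deg5[OF that *(1)] deg5[OF that *(2)]
        by (intro exI[of _ b] exI[of _ a]) (auto simp: out_nbh_def)
    qed
  qed
  have w6: "weight (insert x K) (U - D - nbh x) \<le> \<Lambda> / lam ^ 6" if x: "x \<in> W" "odeg x \<le> 3" for x D
  proof -
    obtain a b where ab: "a \<in> W" "b \<in> W" "E x a" "E x b" "E a b" "out_nbh x \<inter> W = {x, a, b}"
      "odeg a = 3" "odeg b = 3" using step[OF x] by blast
    have "a \<noteq> b" using ab noloopW by blast
    \<comment> \<open>Once \<open>b = c\<close> is known, \<open>x\<close>, \<open>a\<close>,
      \<open>b\<close>, \<open>d\<close> are four consecutive vertices of the cycle.\<close>
    obtain c d where cd: "c \<in> W" "d \<in> W" "E a c" "E a d" "E c d" "out_nbh a \<inter> W = {a, c, d}" "ideg d = 2"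
      using step[OF ab(1)] ab(7) by auto
    have "b \<in> {a, c, d}" using ab cd(6) by (auto simp: out_nbh_def)
    then have "b = c \<or> b = d" using \<open>a \<noteq> b\<close> by blast
    \<comment> \<open>Otherwise \<open>b = d\<close> would have the three in-neighbours
      \<open>x\<close>, \<open>a\<close> and \<open>c\<close>, against its in-degree 2.\<close>
    have cn: "b = c" 
    proof (rule ccontr)
      assume "b \<noteq> c"
      then have "b = d" using \<open>b = c \<or> b = d\<close> by blast
      have "c \<noteq> x" "c \<noteq> a" using cd(3) asymW[OF ab(3) x(1)] noloopW[OF ab(1)] by auto
      then have "{x, a, c} \<subseteq> in_nbh d \<inter> W" using x cd ab \<open>b = d\<close> by (auto simp: in_nbh_def)
      moreover have "card {x, a, c} = 3" using \<open>c \<noteq> x\<close> \<open>c \<noteq> a\<close> ab(3) noloopW[OF ab(1)] by (cases "x = a") auto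
      ultimately have "3 \<le> ideg d" unfolding ideg_def using finW by (metis card_mono finite_Int)
      then show False using cd(7) by simp
    qed
    have bd: "E b d" using cd cn by simp
    have "in_nbh d \<inter> W = {a, b}"
    proof (rule sym, rule card_seteq)
      show "{a, b} \<subseteq> in_nbh d \<inter> W" using ab cd bd by (auto simp: in_nbh_def)
      show "card (in_nbh d \<inter> W) \<le> card {a, b}" using cd(7) \<open>a \<noteq> b\<close> by (simp add: ideg_def)
    qed (use finW in auto)
    then have d_in: "w \<in> {a, b}" if "w \<in> W" "E w d" for w using that by (auto simp: in_nbh_def)
    let ?V = "U - D - nbh x"
    have ab_nbh: "{a, b} \<subseteq> nbh x" using ab by (auto simp: nbh_def)
    have d5: "5 \<le> deg x" using deg_eq inn out x by fastforce
    show ?thesis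
    proof (cases "d \<in> nbh x")
      case True
      have "out_nbh a \<inter> ?V = {}" using out_nbh_W[OF ab(1)] cd(6) cn True ab_nbh by blast
      moreover have "unsat (insert x K) a"
        using unsat_U[of a] ab WU asymW[OF ab(3) x(1)] noloopW by (auto simp: unsat_def out_nbh_def)
      ultimately have "failing (insert x K) ?V" by (auto simp: failing_def)
      then show ?thesis using lam_pos by (simp add: weight_failing)
    next
      case False
      have "d \<notin> core ?V"
        by (rule core_removed) (use d_in ab_nbh core_subset[of ?V] in auto)
      then show ?thesis using d5 False cd(2) finW core_subset[of ?V]
        by (intro weight_nbh[of "insert d (nbh x \<inter> W)"]) (auto simp: deg_def)
    qed
  qed
  have "branch_weight K U us \<le> sum_list (map (\<lambda>_. \<Lambda> / lam ^ 6) us)"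
  proof (rule branch_out_nbh[OF v(1,3)])
    fix u D assume "u \<in> set us"
    then have "u \<in> out_nbh v \<inter> W" using v(3) by simp
    then show "weight (insert u K) (U - D - nbh u) \<le> \<Lambda> / lam ^ 6"
      using deg5[OF v(1,2)] by (intro w6) auto
  qed
  also have "\<dots> = 3 * (\<Lambda> / lam ^ 6)"
    using distinct_card[OF v(4)] v out[OF v(1)] by (simp add: odeg_def sum_list_triv)
  finally show ?thesis using \<Lambda>_sums(5) by simp
qed

text \<open>The edges of the core are counted from both ends; the \<open>+ 1\<close> makes up for
  the vertex itself, which only \<open>odeg\<close> counts.\<close>

lemma sum_ideg: "(\<Sum>v\<in>W. ideg v + 1) = (\<Sum>v\<in>W. odeg v)"
proof -
  have "ideg v = card {u \<in> W. E u v}" for v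
    unfolding ideg_def in_nbh_def by (rule arg_cong[of _ _ card]) auto
  moreover have "odeg v = card {u \<in> W. E v u} + 1" if "v \<in> W" for v
  proof -
    have "out_nbh v \<inter> W = insert v {u \<in> W. E v u}" using that by (auto simp: out_nbh_def)
    then show ?thesis using noloopW[OF that] finW by (simp add: odeg_def)
  qed
  moreover have "(\<Sum>v\<in>W. card {u \<in> W. E u v}) = (\<Sum>v\<in>W. card {u \<in> W. E v u})"
    using finW by (intro sum_multicount_gen) auto
  ultimately show ?thesis by (simp only: sum.distrib cong: sum.cong)
qed

text \<open>The assumptions give \<open>ideg x + 1 \<le> odeg x\<close> at every vertex. Both sides
  have the same sum over the core, so equality holds everywhere, and it pins down
  \<open>odeg x = 4\<close> and \<open>deg x = 7\<close>.\<close>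

lemma branch_regular:
  assumes out: "\<And>v. v \<in> W \<Longrightarrow> 4 \<le> odeg v" and deg: "\<And>v. v \<in> W \<Longrightarrow> deg v \<le> 7"
    and v: "v \<in> W" "set us = out_nbh v \<inter> W" "distinct us"
  shows "branch_weight K U us \<le> \<Lambda> \<and> length us = 4"
proof -
  have i: "ideg x + 1 \<le> odeg x" if "x \<in> W" for x
    using deg_eq out deg that by fastforce
  have eq: "odeg x = 4 \<and> deg x = 7" if "x \<in> W" for x
  proof -
    have "\<not> ideg x + 1 < odeg x"
      using sum_strict_mono_ex1[OF finW, of "\<lambda>x. ideg x + 1" odeg] i sum_ideg that by fastforce
    then show ?thesis using i[OF that] deg_eq[OF that] out[OF that] deg[OF that] by linarith
  qed
  have len: "length us = 4" using distinct_card[OF v(3)] v eq[OF v(1)] by (simp add: odeg_def)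
  have "branch_weight K U us \<le> sum_list (map (\<lambda>_. \<Lambda> / lam ^ 7) us)"
    using v eq by (intro branch_out_nbh[of v] weight_deg) auto
  also have "\<dots> = 4 * (\<Lambda> / lam ^ 7)" using len by (simp add: sum_list_triv)
  finally show ?thesis using \<Lambda>_sums(6) len by simp
qed

end

section \<open>Choosing the pivots from a list of the core vertices\<close>

context kernel_search
begin

definition outs :: "nat list \<Rightarrow> nat \<Rightarrow> nat list" where "outs ws v = filter (\<lambda>x. x = v \<or> E v x) ws"
definition ins :: "nat list \<Rightarrow> nat \<Rightarrow> nat list" where "ins ws v = filter (\<lambda>x. E x v) ws"
definition nbs :: "nat list \<Rightarrow> nat \<Rightarrow> nat list" where
  "nbs ws v = filter (\<lambda>x. x = v \<or> E v x \<or> E x v) ws"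

definition low_out :: "nat \<Rightarrow> nat list \<Rightarrow> nat list" where
  "low_out k ws = filter (\<lambda>v. length (outs ws v) \<le> k) ws"
definition single_in :: "nat list \<Rightarrow> nat list" where
  "single_in ws = filter (\<lambda>v. length (ins ws v) \<le> 1) ws"
definition high_deg :: "nat list \<Rightarrow> nat list" where
  "high_deg ws = filter (\<lambda>v. 8 \<le> length (nbs ws v)) ws"
definition spread :: "nat list \<Rightarrow> nat \<Rightarrow> nat \<Rightarrow> bool" where
  "spread ws v u \<longleftrightarrow> 6 \<le> length (nbs ws u) \<or> filter (\<lambda>x. x \<notin> nbh u) (outs ws v) \<noteq> []"
definition spread_out :: "nat list \<Rightarrow> nat list" where
  "spread_out ws = filter (\<lambda>v. length (outs ws v) \<le> 3 \<and> filter (spread ws v) (outs ws v) \<noteq> []) ws"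

text \<open>The order of the tests matters, since the analysis of a case uses that the earlier tests
  have failed. The result is either a closed out-neighbourhood, one of whose members must be
  selected, or a single vertex to be selected or rejected.\<close>

definition pivots :: "nat list \<Rightarrow> nat list" where
  "pivots ws =
    (if low_out 2 ws \<noteq> [] then outs ws (hd (low_out 2 ws))
     else if single_in ws \<noteq> [] then
       (let p = hd (ins ws (hd (single_in ws))) in
        if 5 \<le> length (nbs ws p) then [p] else [hd (ins ws p)])
     else if high_deg ws \<noteq> [] then [hd (high_deg ws)]
     else if spread_out ws \<noteq> [] then outs ws (hd (spread_out ws))
     else if low_out 3 ws \<noteq> [] then outs ws (hd (low_out 3 ws))
     else outs ws (hd ws))"

end

lemma hd_filter:
  assumes "filter P xs \<noteq> []"
  shows "hd (filter P xs) \<in> set xs \<and> P (hd (filter P xs))"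
  using hd_in_set[OF assms] by simp

context branch_state
begin

text \<open>An undecided vertex without undecided out-neighbours would itself be forced, so all
  out-degrees in \<open>U\<close> are positive.\<close>

lemma W_nonempty: assumes "U \<noteq> {}" shows "W \<noteq> {}"
  unfolding W_def
proof (rule core_nonempty[OF fin assms])
  fix v assume v: "v \<in> U"
  have "out_nbh v \<inter> U \<noteq> {v}" using unsat_U[OF v] not_forced by (auto simp: forced_def)
  then show "\<exists>u\<in>U. E v u" using v by (auto simp: out_nbh_def)
qed

text \<open>Besides the weight inequality, the recursion needs a nonempty list, to make progress,
  and a constant bound on its length, to keep the overhead of a node independent of its
  degree.\<close>

lemma pivots_spec:
  assumes "U \<noteq> {}" and ws: "set ws = W" "distinct ws"
  shows "pivots ws \<noteq> [] \<and> distinct (pivots ws) \<and> set (pivots ws) \<subseteq> U \<and> length (pivots ws) \<le> 4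
    \<and> branch_weight K U (pivots ws) \<le> weight K U"
proof -
  have set_outs: "set (outs ws v) = out_nbh v \<inter> W" for v using ws by (auto simp: outs_def out_nbh_def)
  have set_ins: "set (ins ws v) = in_nbh v \<inter> W" for v using ws by (auto simp: ins_def in_nbh_def)
  have set_nbs: "set (nbs ws v) = nbh v \<inter> W" for v using ws by (auto simp: nbs_def nbh_def)
  have d_outs: "distinct (outs ws v)" for v using ws(2) by (simp add: outs_def)
  have len_outs: "length (outs ws v) = odeg v" for v
    using distinct_card[OF d_outs] set_outs by (simp add: odeg_def)
  have len_ins: "length (ins ws v) = ideg v" for v
    using distinct_card[of "ins ws v"] set_ins ws(2) by (simp add: ideg_def ins_def)
  have len_nbs: "length (nbs ws v) = deg v" for v
    using distinct_card[of "nbs ws v"] set_nbs ws(2) by (simp add: deg_def nbs_def)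
  have hd_low: "hd (low_out k ws) \<in> W \<and> odeg (hd (low_out k ws)) \<le> k" if "low_out k ws \<noteq> []" for k
    using hd_filter[OF that[unfolded low_out_def]] ws(1) len_outs by (simp add: low_out_def)
  have all_low: "k < odeg v" if "low_out k ws = []" "v \<in> W" for k v
    using that ws(1) len_outs by (auto simp: low_out_def filter_empty_conv)
  have outs_spec: ?thesis
    if "pivots ws = outs ws v" "v \<in> W" "odeg v \<le> 4" "branch_weight K U (outs ws v) \<le> \<Lambda>" for v
  proof -
    have "v \<in> set (outs ws v)" using set_outs[of v] that(2) by (simp add: out_nbh_def)
    then have "outs ws v \<noteq> []" by auto
    moreover have "set (outs ws v) \<subseteq> U" using set_outs[of v] WU by auto
    ultimately show ?thesis using that(1,3,4) d_outs len_outs weight_eq by simp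
  qed
  have single_spec: ?thesis
    if "pivots ws = [v]" "v \<in> W" "branch_weight K U [v] \<le> \<Lambda>" for v
    using that WU weight_eq by auto
  show ?thesis
  proof (cases "low_out 2 ws = []")
    case False
    define u where "u = hd (low_out 2 ws)"
    have u: "u \<in> W" "odeg u \<le> 2" using hd_low[OF False] by (auto simp: u_def)
    moreover have "pivots ws = outs ws u" using False by (simp add: pivots_def u_def)
    ultimately show ?thesis
      using branch_out_degree_1[OF u set_outs d_outs] by (intro outs_spec[of u]) auto
  next
    case low2: True
    have out3: "3 \<le> odeg v" if "v \<in> W" for v using all_low[OF low2 that] by simp
    show ?thesis
    proof (cases "single_in ws = []")
      case False
      define y where "y = hd (single_in ws)"
      have y: "y \<in> W" "ideg y \<le> 1" using hd_filter[OF False[unfolded single_in_def]] ws(1) len_ins by (simp_all add: y_def single_in_def)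
      then have "ideg y = 1" using ideg_ge_1 by fastforce
      then obtain p where p: "in_nbh y \<inter> W = {p}" by (auto simp: ideg_def card_1_singleton_iff)
      have "set (ins ws y) = {p}" using set_ins p by simp
      then have hdp: "hd (ins ws y) = p" by (metis hd_in_set insert_not_empty list.set(1) singletonD)
      have pW: "p \<in> W" using p by blast
      note in1 = branch_in_degree_1[OF out3 y(1) p]
      show ?thesis
      proof (cases "5 \<le> deg p")
        case True
        have "pivots ws = [p]" using True low2 False hdp by (simp add: pivots_def len_nbs y_def)
        then show ?thesis using pW in1(1)[OF _ True] by (intro single_spec[of p]) auto
      next
        case deg: False
        define x where "x = hd (ins ws p)"
        have c2: "in_nbh p \<inter> W \<noteq> {} \<and> (\<forall>x \<in> in_nbh p \<inter> W. branch_weight K U [x] \<le> \<Lambda>)"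
          using in1(2) deg by simp
        then have "x \<in> in_nbh p \<inter> W" using set_ins[of p] hd_in_set[of "ins ws p"] unfolding x_def by fastforce
        moreover have "pivots ws = [x]" using deg low2 False hdp by (simp add: pivots_def len_nbs y_def x_def)
        ultimately show ?thesis using c2 by (intro single_spec[of x]) auto
      qed
    next
      case single: True
      have in2: "2 \<le> ideg v" if "v \<in> W" for v
        using single that ws(1) len_ins by (fastforce simp: single_in_def filter_empty_conv)
      show ?thesis
      proof (cases "high_deg ws = []")
        case False
        define x where "x = hd (high_deg ws)"
        have x: "x \<in> W" "8 \<le> deg x" using hd_filter[OF False[unfolded high_deg_def]] ws(1) len_nbs by (simp_all add: x_def high_deg_def)
        have "pivots ws = [x]" using low2 single False by (simp add: pivots_def x_def)
        then show ?thesis using x branch_high_degree[OF x] by (intro single_spec[of x]) auto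
      next
        case high: True
        have deg7: "deg v \<le> 7" if "v \<in> W" for v
          using high that ws(1) len_nbs by (fastforce simp: high_deg_def filter_empty_conv)
        have spread_iff: "spread ws v u \<longleftrightarrow> 6 \<le> deg u \<or> (\<exists>u' \<in> out_nbh v \<inter> W. u' \<notin> nbh u)" for v u
          using set_outs[of v] by (auto simp: spread_def len_nbs filter_empty_conv)
        show ?thesis
        proof (cases "spread_out ws = []")
          case False
          define v where "v = hd (spread_out ws)"
          have v: "v \<in> W" "odeg v \<le> 3" "filter (spread ws v) (outs ws v) \<noteq> []"
            using hd_filter[OF False[unfolded spread_out_def]] ws(1) len_outs by (simp_all add: v_def spread_out_def)
          then obtain u where u: "u \<in> out_nbh v \<inter> W" "spread ws v u"
            using set_outs[of v] by (metis filter_False)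
          have "pivots ws = outs ws v" using low2 single high False by (simp add: pivots_def v_def)
          then show ?thesis using v
              branch_spread[OF out3 in2 v(1,2) set_outs d_outs u(1) u(2)[unfolded spread_iff]]
            by (intro outs_spec[of v]) auto
        next
          case spr: True
          have no4: "deg u \<le> 5 \<and> out_nbh v \<inter> W \<subseteq> nbh u"
            if v: "v \<in> W" "odeg v \<le> 3" and u: "u \<in> out_nbh v \<inter> W" for v u
          proof -
            have "\<not> spread ws v u"
              using spr v u ws(1) len_outs set_outs[of v] by (auto simp: spread_out_def filter_empty_conv)
            then show ?thesis unfolding spread_iff by auto
          qed
          show ?thesis
          proof (cases "low_out 3 ws = []")
            case False
            define v where "v = hd (low_out 3 ws)"
            have v: "v \<in> W" "odeg v \<le> 3" using hd_low[OF False] by (auto simp: v_def)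
            have "pivots ws = outs ws v" using low2 single high spr False by (simp add: pivots_def v_def)
            then show ?thesis using v
                branch_cycle_square[OF out3 in2 no4 v(1,2) set_outs d_outs]
              by (intro outs_spec[of v]) auto
          next
            case low3: True
            define v where "v = hd ws"
            have "ws \<noteq> []" using W_nonempty[OF assms(1)] ws(1) by auto
            then have v: "v \<in> W" using ws(1) hd_in_set[of ws] by (simp add: v_def)
            have out4: "4 \<le> odeg v" if "v \<in> W" for v using all_low[OF low3 that] by simp
            have "pivots ws = outs ws v" using low2 single high spr low3 by (simp add: pivots_def v_def)
            moreover have "branch_weight K U (outs ws v) \<le> \<Lambda> \<and> length (outs ws v) = 4"
              by (rule branch_regular[OF out4 deg7 v set_outs d_outs])
            ultimately show ?thesis using v len_outs[of v] by (intro outs_spec[of v]) simp_all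
          qed
        qed
      qed
    qed
  qed
qed

end

section \<open>Kernels compatible with a state\<close>

context kernel_search
begin

definition kernels :: "nat set \<Rightarrow> nat set \<Rightarrow> nat set set" where
  "kernels K U = {X. K \<subseteq> X \<and> X \<subseteq> K \<union> U \<and> (\<forall>v\<in>X. \<forall>u\<in>X. \<not> E v u) \<and> (\<forall>v\<in>T. out_nbh v \<inter> X \<noteq> {})}"

definition valid :: "nat set \<Rightarrow> nat set \<Rightarrow> bool" where
  "valid K U \<longleftrightarrow> finite U \<and> U \<subseteq> T \<and> (\<forall>u\<in>U. \<not> E u u) \<and> (\<forall>k\<in>K. U \<inter> nbh k = {})
     \<and> (\<forall>a\<in>K. \<forall>b\<in>K. \<not> E a b)"

lemma valid_branch_state:
  "valid K U \<Longrightarrow> \<not> failing K U \<Longrightarrow> forced K U = {} \<Longrightarrow> branch_state E T K U"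
  by unfold_locales (auto simp: valid_def)

lemma valid_select: "valid K U \<Longrightarrow> u \<in> U \<Longrightarrow> valid (insert u K) (U - nbh u)"
  unfolding valid_def nbh_def by auto

lemma valid_subset: "valid K U \<Longrightarrow> V \<subseteq> U \<Longrightarrow> valid K V"
  unfolding valid_def by (meson disjoint_iff finite_subset subset_iff)

lemma valid_unsat: "valid K U \<Longrightarrow> u \<in> U \<Longrightarrow> unsat K u"
  unfolding valid_def unsat_def out_nbh_def nbh_def by blast

lemma kernels_failing: "failing K U \<Longrightarrow> kernels K U = {}"
  unfolding failing_def kernels_def unsat_def by blast

text \<open>Undecided atoms are never met by \<open>K\<close>; so when all atoms of \<open>T\<close>
  are met, nothing is undecided and \<open>K\<close> itself is the only kernel.\<close>

lemma kernels_leaf: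
  assumes "valid K U" "\<And>v. \<not> unsat K v"
  shows "kernels K U = {K}" "U = {}" "\<not> failing K U"
proof -
  show "U = {}" using assms valid_unsat by blast
  then show "kernels K U = {K}" using assms unfolding kernels_def valid_def unsat_def by auto
  show "\<not> failing K U" using assms(2) by (auto simp: failing_def)
qed

lemma kernels_select:
  assumes "valid K U" "u \<in> U"
  shows "{X \<in> kernels K U. u \<in> X} = kernels (insert u K) (U - nbh u)"
  using assms unfolding kernels_def valid_def nbh_def by auto

lemma kernels_reject:
  assumes "valid K U" "u \<in> U"
  shows "{X \<in> kernels K U. u \<notin> X} = kernels K (U - {u})"
proof -
  have "u \<notin> K" using assms by (auto simp: valid_def nbh_def)
  then show ?thesis unfolding kernels_def by auto
qed

text \<open>Disjointness of the two parts is what keeps the list of results free of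
  repetitions.\<close>

lemma kernels_branch:
  assumes "valid K U" "u \<in> U"
  shows "kernels K U = kernels K (U - {u}) \<union> kernels (insert u K) (U - nbh u)"
    and "kernels K (U - {u}) \<inter> kernels (insert u K) (U - nbh u) = {}"
  unfolding kernels_select[OF assms, symmetric] kernels_reject[OF assms, symmetric] by blast+

lemma kernels_forced:
  assumes "valid K U" "z \<in> forced K U"
  shows "kernels K U = kernels (insert z K) (U - nbh z)" "z \<in> U"
proof -
  obtain v where v: "unsat K v" "out_nbh v \<inter> U = {z}" using assms(2) by (auto simp: forced_def)
  then show z: "z \<in> U" by blast
  have "z \<in> X" if "X \<in> kernels K U" for X
  proof -
    have "out_nbh v \<inter> X \<noteq> {}" "X \<subseteq> K \<union> U"
      using that v(1) by (simp_all add: kernels_def unsat_def)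
    moreover have "out_nbh v \<inter> K = {}" using v(1) by (simp add: unsat_def)
    ultimately have "out_nbh v \<inter> X \<subseteq> {z}" unfolding v(2)[symmetric] by blast
    then show ?thesis using \<open>out_nbh v \<inter> X \<noteq> {}\<close> by blast
  qed
  then show "kernels K U = kernels (insert z K) (U - nbh z)"
    unfolding kernels_select[OF assms(1) z, symmetric] by blast
qed

end

section \<open>Evaluation with cost bounds\<close>

text \<open>Costs are tracked as real upper bounds, so that they compose by weakening and can be
  compared with powers of \<open>lam\<close>.\<close>

definition ev :: "code \<Rightarrow> sexp list \<Rightarrow> lexp \<Rightarrow> sexp \<Rightarrow> real \<Rightarrow> bool" where
  "ev F env e v B \<longleftrightarrow> (\<exists>t. eval F env e v t \<and> real t \<le> B)"

definition evs :: "code \<Rightarrow> sexp list \<Rightarrow> lexp list \<Rightarrow> sexp list \<Rightarrow> real \<Rightarrow> bool" where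
  "evs F env es vs B \<longleftrightarrow> (\<exists>t. eval_list F env es vs t \<and> real t \<le> B)"

definition fn :: "code \<Rightarrow> nat \<Rightarrow> sexp list \<Rightarrow> sexp \<Rightarrow> real \<Rightarrow> bool" where
  "fn F f vs v B \<longleftrightarrow> f < length F \<and> ev F vs (F ! f) v B"

text \<open>Only the distinction between \<open>NIL\<close> and other values is recorded; a filtered
  list can thus serve as the test for its own nonemptiness.\<close>

definition evb :: "code \<Rightarrow> sexp list \<Rightarrow> lexp \<Rightarrow> bool \<Rightarrow> real \<Rightarrow> bool" where
  "evb F env e p B \<longleftrightarrow> (\<exists>v. ev F env e v B \<and> (v \<noteq> NIL \<longleftrightarrow> p))"

definition fnb :: "code \<Rightarrow> nat \<Rightarrow> sexp list \<Rightarrow> bool \<Rightarrow> real \<Rightarrow> bool" where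
  "fnb F f vs p B \<longleftrightarrow> (\<exists>v. fn F f vs v B \<and> (v \<noteq> NIL \<longleftrightarrow> p))"

lemma ev_weaken: "ev F env e v B \<Longrightarrow> v = v' \<Longrightarrow> B \<le> B' \<Longrightarrow> ev F env e v' B'"
  unfolding ev_def by force
lemma evb_weaken: "evb F env e p B \<Longrightarrow> p = p' \<Longrightarrow> B \<le> B' \<Longrightarrow> evb F env e p' B'"
  unfolding evb_def using ev_weaken by blast
lemma fn_weaken: "fn F f vs v B \<Longrightarrow> v = v' \<Longrightarrow> B \<le> B' \<Longrightarrow> fn F f vs v' B'"
  unfolding fn_def using ev_weaken by blast
lemma fnb_weaken: "fnb F f vs p B \<Longrightarrow> p = p' \<Longrightarrow> B \<le> B' \<Longrightarrow> fnb F f vs p' B'"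
  unfolding fnb_def using fn_weaken by blast

lemma ev_Param:
  "ev F (x0 # env) (Param 0) x0 1"
  "ev F (x0 # x1 # env) (Param 1) x1 1"
  "ev F (x0 # x1 # x2 # env) (Param 2) x2 1"
  "ev F (x0 # x1 # x2 # x3 # env) (Param 3) x3 1"
  "ev F (x0 # x1 # x2 # x3 # x4 # env) (Param 4) x4 1"
  "ev F (x0 # x1 # x2 # x3 # x4 # x5 # env) (Param 5) x5 1"
proof -
  have *: "i < length env \<Longrightarrow> env ! i = v \<Longrightarrow> ev F env (Param i) v 1" for i v and env :: "sexp list"
    unfolding ev_def using eval_Param[of i env F] by auto
  show
    "ev F (x0 # env) (Param 0) x0 1"
    "ev F (x0 # x1 # env) (Param 1) x1 1"
    "ev F (x0 # x1 # x2 # env) (Param 2) x2 1"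
    "ev F (x0 # x1 # x2 # x3 # env) (Param 3) x3 1"
    "ev F (x0 # x1 # x2 # x3 # x4 # env) (Param 4) x4 1"
    "ev F (x0 # x1 # x2 # x3 # x4 # x5 # env) (Param 5) x5 1"
    by (intro *; simp)+
qed

lemma ev_Quote: "ev F env (Quote v) v 1"
  unfolding ev_def using eval_Quote[of F env v] by (intro exI[of _ 1]) auto

lemma ev_Cons:
  assumes "ev F env e1 v1 B1" "ev F env e2 v2 B2"
  shows "ev F env (Cons_exp e1 e2) (Cell v1 v2) (B1 + B2 + 1)"
proof -
  obtain t1 t2 where "eval F env e1 v1 t1" "real t1 \<le> B1" "eval F env e2 v2 t2" "real t2 \<le> B2"
    using assms by (auto simp: ev_def)
  then show ?thesis unfolding ev_def
    by (intro exI[of _ "t1 + t2 + 1"]) (auto intro: eval_Cons[simplified])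
qed

lemma ev_Car: assumes "ev F env e v B" shows "ev F env (Car e) (car v) (B + 1)"
proof -
  obtain t where "eval F env e v t" "real t \<le> B" using assms by (auto simp: ev_def)
  then show ?thesis unfolding ev_def by (intro exI[of _ "t + 1"]) (auto intro: eval_Car[simplified])
qed

lemma ev_Cdr: assumes "ev F env e v B" shows "ev F env (Cdr e) (cdr v) (B + 1)"
proof -
  obtain t where "eval F env e v t" "real t \<le> B" using assms by (auto simp: ev_def)
  then show ?thesis unfolding ev_def by (intro exI[of _ "t + 1"]) (auto intro: eval_Cdr[simplified])
qed

lemma evb_ev: "ev F env e v B \<Longrightarrow> evb F env e (v \<noteq> NIL) B"
  unfolding evb_def by blast

lemma fnb_fn: "fn F f vs v B \<Longrightarrow> fnb F f vs (v \<noteq> NIL) B"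
  unfolding fnb_def by blast

lemma evb_Eq:
  assumes "ev F env e1 v1 B1" "ev F env e2 v2 B2"
  shows "evb F env (Eq e1 e2) (is_atom v1 \<and> v1 = v2) (B1 + B2 + 1)"
proof -
  obtain t1 t2 where "eval F env e1 v1 t1" "real t1 \<le> B1" "eval F env e2 v2 t2" "real t2 \<le> B2"
    using assms by (auto simp: ev_def)
  then have "ev F env (Eq e1 e2) (truth (is_atom v1 \<and> v1 = v2)) (B1 + B2 + 1)"
    unfolding ev_def using eval_Eq by (intro exI[of _ "t1 + t2 + 1"]) auto
  then show ?thesis unfolding evb_def by (intro exI[of _ "truth (is_atom v1 \<and> v1 = v2)"]) (auto simp: truth_def)
qed

text \<open>The premise for the branch not taken is vacuous, so that its bound can be chosen freely;
  it is mostly set to 0 when the condition is known.\<close>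

lemma ev_If:
  assumes "evb F env e p B0" "p \<Longrightarrow> ev F env e1 v B1" "\<not> p \<Longrightarrow> ev F env e2 v B2"
  shows "ev F env (If_exp e e1 e2) v (B0 + max B1 B2 + 1)"
proof -
  obtain w t0 where e: "eval F env e w t0" "real t0 \<le> B0" "w \<noteq> NIL \<longleftrightarrow> p"
    using assms(1) by (auto simp: evb_def ev_def)
  show ?thesis
  proof (cases p)
    case True
    then obtain t1 where "eval F env e1 v t1" "real t1 \<le> B1" using assms(2) by (auto simp: ev_def)
    then show ?thesis unfolding ev_def using eval_If_true[of F env e w t0 e1 v t1 e2] e True
      by (intro exI[of _ "t0 + t1 + 1"]) auto
  next
    case False
    then obtain t2 where "eval F env e2 v t2" "real t2 \<le> B2" using assms(3) by (auto simp: ev_def)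
    then show ?thesis unfolding ev_def using eval_If_false[of F env e t0 e2 v t2 e1] e False
      by (intro exI[of _ "t0 + t2 + 1"]) auto
  qed
qed

lemma evb_If:
  assumes "evb F env e p B0" "p \<Longrightarrow> evb F env e1 q B1" "\<not> p \<Longrightarrow> evb F env e2 q B2"
  shows "evb F env (If_exp e e1 e2) q (B0 + max B1 B2 + 1)"
  using assms ev_If[OF assms(1)] unfolding evb_def by (cases p) blast+

lemma ev_Call:
  assumes "evs F env es vs B1" "fn F f vs v B2"
  shows "ev F env (Call f es) v (B1 + B2 + 1)"
proof -
  obtain t1 t2 where "eval_list F env es vs t1" "real t1 \<le> B1" "eval F vs (F ! f) v t2" "real t2 \<le> B2"
    using assms by (auto simp: ev_def evs_def fn_def)
  then show ?thesis unfolding ev_def using eval_Call assms(2)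
    by (intro exI[of _ "t1 + t2 + 1"]) (auto simp: fn_def)
qed

lemma evb_Call:
  assumes "evs F env es vs B1" "fnb F f vs p B2"
  shows "evb F env (Call f es) p (B1 + B2 + 1)"
  using assms ev_Call unfolding evb_def fnb_def by blast

lemma evs_Nil: "evs F env [] [] 0"
  unfolding evs_def by (auto intro: eval_list_Nil)

lemma evs_Cons:
  assumes "ev F env e v B1" "evs F env es vs B2"
  shows "evs F env (e # es) (v # vs) (B1 + B2)"
proof -
  obtain t1 t2 where "eval F env e v t1" "real t1 \<le> B1" "eval_list F env es vs t2" "real t2 \<le> B2"
    using assms by (auto simp: ev_def evs_def)
  then show ?thesis unfolding evs_def using eval_list_Cons
    by (intro exI[of _ "t1 + t2"]) auto
qed

definition Not_exp :: "lexp \<Rightarrow> lexp" where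
  "Not_exp e = If_exp e (Quote NIL) (Quote (Sym 0))"
definition And_exp :: "lexp \<Rightarrow> lexp \<Rightarrow> lexp" where
  "And_exp e1 e2 = If_exp e1 e2 (Quote NIL)"
definition Or_exp :: "lexp \<Rightarrow> lexp \<Rightarrow> lexp" where
  "Or_exp e1 e2 = If_exp e1 (Quote (Sym 0)) e2"

lemma evb_Not: assumes "evb F env e p B" shows "evb F env (Not_exp e) (\<not> p) (B + 2)"
proof -
  have "evb F env (Not_exp e) (\<not> p) (B + max 1 1 + 1)"
    unfolding Not_exp_def
    by (rule evb_If[OF assms]) (use evb_ev[OF ev_Quote] in \<open>force intro: evb_weaken\<close>)+
  then show ?thesis by (simp add: add.commute)
qed

lemma evb_And:
  assumes "evb F env e1 p B1" "evb F env e2 q B2"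
  shows "evb F env (And_exp e1 e2) (p \<and> q) (B1 + max B2 1 + 1)"
  unfolding And_exp_def
  by (rule evb_If[OF assms(1)]) (use assms(2) evb_ev[OF ev_Quote] in \<open>force intro: evb_weaken\<close>)+

lemma evb_Or:
  assumes "evb F env e1 p B1" "evb F env e2 q B2"
  shows "evb F env (Or_exp e1 e2) (p \<or> q) (B1 + max 1 B2 + 1)"
  unfolding Or_exp_def
  by (rule evb_If[OF assms(1)]) (use assms(2) evb_ev[OF ev_Quote] in \<open>force intro: evb_weaken\<close>)+

lemmas ev_rules = ev_Param ev_Quote ev_Cons ev_Car ev_Cdr ev_If ev_Call evs_Nil evs_Cons
lemmas evb_rules = evb_Eq evb_Not evb_And evb_Or evb_Call

fun cdrs :: "nat \<Rightarrow> lexp \<Rightarrow> lexp" where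
  "cdrs 0 e = e"
| "cdrs (Suc n) e = Cdr (cdrs n e)"

lemma ev_cdrs:
  assumes "ev F env e (slist xs) B"
  shows "ev F env (cdrs n e) (slist (drop n xs)) (B + n)"
proof (induction n)
  case (Suc n)
  \<comment> \<open>This includes the empty list: \<open>cdr NIL\<close> is \<open>NIL\<close>, just
    as \<open>tl []\<close> is \<open>[]\<close>.\<close>
  have "cdr (slist ys) = slist (tl ys)" for ys by (cases ys) auto
  then show ?case using ev_Cdr[OF Suc] by (simp add: drop_Suc tl_drop add.commute add.left_commute)
qed (use assms in simp)

lemma slist_eq_NIL: "slist xs = NIL \<longleftrightarrow> xs = []"
  by (cases xs) auto

text \<open>In the absence of arithmetic, lengths are compared with constants by testing whether an
  iterated tail is \<open>NIL\<close>.\<close>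

lemma evb_cdrs:
  assumes "ev F env e (slist xs) B"
  shows "evb F env (cdrs n e) (n < length xs) (B + n)"
  by (rule evb_weaken[OF evb_ev[OF ev_cdrs[OF assms, of n]]]) (auto simp: slist_eq_NIL)

section \<open>The code\<close>

text \<open>
  There are no higher-order functions, so function 1 filters a list by the predicate whose number
  it gets as first argument, and function 2 dispatches on that number.  A predicate finds the tested
  element in parameter 1, two further arguments in parameters 2 and 3, and the program in parameter 4.
  Functions 8 to 11 end with the parameters selected atoms, undecided atoms, all atoms, program and
  accumulator; threading the accumulator avoids appending lists of models.
\<close>

definition Filt :: "nat \<Rightarrow> lexp \<Rightarrow> lexp \<Rightarrow> lexp \<Rightarrow> lexp \<Rightarrow> lexp" where
  "Filt m xs a b g = Call 1 [Quote (Sym m), xs, a, b, g]"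

abbreviation "nil \<equiv> Quote NIL"

text \<open>An edge is found by scanning the program for its clause. With \<open>nil\<close> in
  place of \<open>b\<close> the scan looks for a fact, because the access path to the body atom
  yields \<open>NIL\<close> on an empty body.\<close>

definition Edge :: "lexp \<Rightarrow> lexp \<Rightarrow> lexp" where
  "Edge a b = Filt 1 (Param 4) a b nil"

definition eq_test :: lexp where
  "eq_test = Eq (Param 1) (Param 2)"
definition clause_test :: lexp where
  "clause_test = And_exp (Eq (Car (Param 1)) (Param 2)) (Eq (Cdr (Car (Cdr (Param 1)))) (Param 3))"
definition notin_test :: lexp where
  "notin_test = Not_exp (Filt 0 (Param 2) (Param 1) nil nil)"
definition hit_test :: lexp where
  "hit_test = Or_exp (Eq (Param 1) (Param 2)) (Edge (Param 2) (Param 1))"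
definition free_test :: lexp where
  "free_test = Not_exp (Or_exp (Eq (Param 1) (Param 2)) (Or_exp (Edge (Param 2) (Param 1)) (Edge (Param 1) (Param 2))))"
definition adj_test :: lexp where
  "adj_test = Or_exp (Eq (Param 1) (Param 2)) (Or_exp (Edge (Param 2) (Param 1)) (Edge (Param 1) (Param 2)))"
definition in_test :: lexp where
  "in_test = Edge (Param 1) (Param 2)"
definition neq_test :: lexp where
  "neq_test = Not_exp (Eq (Param 1) (Param 2))"
definition unsat_test :: lexp where
  "unsat_test = And_exp (Not_exp (Edge (Param 1) nil)) (Not_exp (Filt 3 (Param 2) (Param 1) nil (Param 4)))"
definition unhit_test :: lexp where
  "unhit_test = Not_exp (Filt 3 (Param 2) (Param 1) nil (Param 4))"
definition unit_test :: lexp where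
  "unit_test = Not_exp (cdrs 1 (Filt 3 (Param 2) (Param 1) nil (Param 4)))"
definition has_in_test :: lexp where
  "has_in_test = Filt 6 (Param 2) (Param 1) nil (Param 4)"
definition no_in_test :: lexp where
  "no_in_test = Not_exp (Filt 6 (Param 2) (Param 1) nil (Param 4))"
definition low_out2_test :: lexp where
  "low_out2_test = Not_exp (cdrs 2 (Filt 3 (Param 2) (Param 1) nil (Param 4)))"
definition single_in_test :: lexp where
  "single_in_test = Not_exp (cdrs 1 (Filt 6 (Param 2) (Param 1) nil (Param 4)))"
definition high_deg_test :: lexp where
  "high_deg_test = cdrs 7 (Filt 5 (Param 2) (Param 1) nil (Param 4))"
definition low_out3_test :: lexp where
  "low_out3_test = Not_exp (cdrs 3 (Filt 3 (Param 2) (Param 1) nil (Param 4)))"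
definition spread_test :: lexp where
  "spread_test = Or_exp (cdrs 5 (Filt 5 (Param 2) (Param 1) nil (Param 4))) (Filt 4 (Filt 3 (Param 2) (Param 3) nil (Param 4)) (Param 1) nil (Param 4))"
definition spread_out_test :: lexp where
  "spread_out_test = And_exp (Not_exp (cdrs 3 (Filt 3 (Param 2) (Param 1) nil (Param 4)))) (Filt 17 (Filt 3 (Param 2) (Param 1) nil (Param 4)) (Param 2) (Param 1) (Param 4))"
definition init_test :: lexp where
  "init_test = And_exp (Not_exp (Edge (Param 1) nil)) (Not_exp (Edge (Param 1) (Param 1)))"

definition tests :: "lexp list" where
  "tests = [eq_test, clause_test, notin_test, hit_test, free_test, adj_test,
    in_test, neq_test, unsat_test, unhit_test, unit_test, has_in_test, no_in_test,
    low_out2_test, single_in_test, high_deg_test, low_out3_test, spread_test, spread_out_test, init_test]"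

fun dispatch :: "nat \<Rightarrow> lexp list \<Rightarrow> lexp" where
  "dispatch k [] = nil"
| "dispatch k (e # es) = If_exp (Eq (Param 0) (Quote (Sym k))) e (dispatch (Suc k) es)"

definition main_body :: lexp where
  "main_body =
    Call 12 [Call 3 [Param 0, nil], Param 0]"

definition filter_body :: lexp where
  "filter_body =
    If_exp (Param 1)
      (If_exp (Call 2 [Param 0, Car (Param 1), Param 2, Param 3, Param 4])
        (Cons_exp (Car (Param 1)) (Call 1 [Param 0, Cdr (Param 1), Param 2, Param 3, Param 4]))
        (Call 1 [Param 0, Cdr (Param 1), Param 2, Param 3, Param 4]))
      nil"

definition test_body :: lexp where
  "test_body =
    dispatch 0 tests"

definition atoms_body :: lexp where
  "atoms_body =
    If_exp (Param 0)
      (Call 3 [Cdr (Param 0), Call 4 [Cdr (Car (Cdr (Car (Param 0)))), Call 4 [Car (Car (Param 0)), Param 1]]])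
      (Param 1)"

text \<open>The outer test skips the missing body atom of a fact, which is read as
  \<open>NIL\<close>.\<close>

definition insert_body :: lexp where
  "insert_body =
    If_exp (Param 0)
      (If_exp (Filt 0 (Param 1) (Param 0) nil nil) (Param 1) (Cons_exp (Param 0) (Param 1)))
      (Param 1)"

definition core_body :: lexp where
  "core_body =
    If_exp (Filt 12 (Param 0) (Param 0) nil (Param 1))
      (Call 5 [Filt 11 (Param 0) (Param 0) nil (Param 1), Param 1])
      (Param 0)"

text \<open>The \<open>let\<close> belongs to the metalanguage: each list is recomputed wherever it
  occurs, which costs only a constant factor.\<close>

definition pivots_body :: lexp where
  "pivots_body =
    (let w = Param 0; g = Param 1; low_out2 = Filt 13 w w nil g; single_in = Filt 14 w w nil g;
       high_deg = Filt 15 w w nil g; spread_out = Filt 18 w w nil g; low_out3 = Filt 16 w w nil g in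
     If_exp low_out2 (Filt 3 w (Car low_out2) nil g)
     (If_exp single_in (Call 7 [Car (Filt 6 w (Car single_in) nil g), w, g])
     (If_exp high_deg (Cons_exp (Car high_deg) nil)
     (If_exp spread_out (Filt 3 w (Car spread_out) nil g)
     (If_exp low_out3 (Filt 3 w (Car low_out3) nil g)
       (Filt 3 w (Car w) nil g))))))"

definition single_in_body :: lexp where
  "single_in_body =
    If_exp (cdrs 4 (Filt 5 (Param 1) (Param 0) nil (Param 2)))
      (Cons_exp (Param 0) nil)
      (Cons_exp (Car (Filt 6 (Param 1) (Param 0) nil (Param 2))) nil)"

text \<open>If no atom is left to be met, the complement of the selected atoms, a stable model, is
  put in front of the accumulator.\<close>

definition solve_body :: lexp where
  "solve_body =
    If_exp (Filt 8 (Param 2) (Param 0) nil (Param 3))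
      (Call 9 [Filt 8 (Param 2) (Param 0) nil (Param 3), Param 0, Param 1, Param 2, Param 3, Param 4])
      (Cons_exp (Filt 2 (Param 2) (Param 0) nil nil) (Param 4))"

definition propagate_body :: lexp where
  "propagate_body =
    If_exp (Filt 9 (Param 0) (Param 2) nil (Param 4))
      (Param 5)
      (If_exp (Filt 10 (Param 0) (Param 2) nil (Param 4))
        (Call 10 [Car (Filt 3 (Param 2) (Car (Filt 10 (Param 0) (Param 2) nil (Param 4))) nil (Param 4)),
           Param 1, Param 2, Param 3, Param 4, Param 5])
        (Call 11 [Call 6 [Call 5 [Param 2, Param 4], Param 4],
           Param 1, Param 2, Param 3, Param 4, Param 5]))"

definition select_body :: lexp where
  "select_body =
    Call 8 [Cons_exp (Param 0) (Param 1), Filt 4 (Param 2) (Param 0) nil (Param 4), Param 3, Param 4, Param 5]"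

text \<open>The child that selects the first pivot is evaluated as an argument: its result is the
  accumulator for the children that reject this pivot.\<close>

definition branch_body :: lexp where
  "branch_body =
    If_exp (Param 0)
      (Call 11 [Cdr (Param 0), Param 1, Filt 7 (Param 2) (Car (Param 0)) nil nil, Param 3, Param 4,
         Call 10 [Car (Param 0), Param 1, Param 2, Param 3, Param 4, Param 5]])
      (Call 8 [Param 1, Param 2, Param 3, Param 4, Param 5])"

definition init_body :: lexp where
  "init_body =
    Call 8 [nil, Filt 19 (Param 0) nil nil (Param 1), Param 0, Param 1, nil]"

definition the_code :: code where
  "the_code = [main_body, filter_body, test_body, atoms_body, insert_body,
    core_body, pivots_body, single_in_body, solve_body,
    propagate_body, select_body, branch_body, init_body]"

lemma fnI:
  "ev the_code vs main_body v B \<Longrightarrow> fn the_code 0 vs v B"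
  "ev the_code vs filter_body v B \<Longrightarrow> fn the_code 1 vs v B"
  "ev the_code vs test_body v B \<Longrightarrow> fn the_code 2 vs v B"
  "ev the_code vs atoms_body v B \<Longrightarrow> fn the_code 3 vs v B"
  "ev the_code vs insert_body v B \<Longrightarrow> fn the_code 4 vs v B"
  "ev the_code vs core_body v B \<Longrightarrow> fn the_code 5 vs v B"
  "ev the_code vs pivots_body v B \<Longrightarrow> fn the_code 6 vs v B"
  "ev the_code vs single_in_body v B \<Longrightarrow> fn the_code 7 vs v B"
  "ev the_code vs solve_body v B \<Longrightarrow> fn the_code 8 vs v B"
  "ev the_code vs propagate_body v B \<Longrightarrow> fn the_code 9 vs v B"
  "ev the_code vs select_body v B \<Longrightarrow> fn the_code 10 vs v B"
  "ev the_code vs branch_body v B \<Longrightarrow> fn the_code 11 vs v B"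
  "ev the_code vs init_body v B \<Longrightarrow> fn the_code 12 vs v B"
  by (simp_all add: fn_def the_code_def)

text \<open>A comparison costs 3 for \<open>Eq\<close> with its arguments and 1 for the conditional,
  hence 4 per entry passed.\<close>

lemma ev_dispatch:
  assumes "i < length es" "ev F (Sym (k + i) # env) (es ! i) v B"
  shows "ev F (Sym (k + i) # env) (dispatch k es) v (B + 4 * real (length es))"
  using assms
proof (induction k es arbitrary: i rule: dispatch.induct)
  case (2 k e es)
  have B: "0 \<le> B" using "2.prems"(2) by (auto simp: ev_def)
  have eq: "evb F (Sym (k + i) # env) (Eq (Param 0) (Quote (Sym k))) (k + i = k) 3"
    by (rule evb_weaken[OF evb_Eq[OF ev_Param(1) ev_Quote]]) auto
  show ?case
  proof (cases i)
    case 0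
    have "ev F (Sym (k + i) # env) (dispatch k (e # es)) v (3 + max B 0 + 1)"
      unfolding dispatch.simps by (rule ev_If[OF eq]) (use "2.prems" 0 in auto)
    then show ?thesis using B by (auto intro: ev_weaken)
  next
    case (Suc j)
    have "ev F (Sym (k + i) # env) (dispatch (Suc k) es) v (B + 4 * real (length es))"
      using "2.IH"[of j] "2.prems" Suc by simp
    then have "ev F (Sym (k + i) # env) (dispatch k (e # es)) v (3 + max 0 (B + 4 * real (length es)) + 1)"
      unfolding dispatch.simps by (intro ev_If[OF eq]) (use Suc in auto)
    then show ?thesis using B by (auto intro: ev_weaken)
  qed
qed simp

text \<open>\<open>B\<close> bounds a single test; 30 generously covers the calls and the
  construction of a cell for one element.\<close>

lemma fn_filt:
  assumes "\<And>x. x \<in> set xs \<Longrightarrow> fnb the_code 2 [m, x, a, b, g] (P x) B" and B: "0 \<le> B"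
  shows "fn the_code 1 [m, slist xs, a, b, g] (slist (filter P xs)) ((B + 30) * (real (length xs) + 1))"
  using assms(1)
proof (induction xs)
  case Nil
  have "evb the_code [m, slist [], a, b, g] (Param 1) False 1"
    by (rule evb_weaken[OF evb_ev[OF ev_Param(2)]]) auto
  then have "ev the_code [m, slist [], a, b, g] filter_body NIL (1 + max 0 1 + 1)"
    unfolding filter_body_def by (rule ev_If) (auto intro: ev_Quote)
  then show ?case using B by (intro fnI) (auto elim: ev_weaken)
next
  case (Cons x xs)
  let ?env = "[m, slist (x # xs), a, b, g]" and ?C = "(B + 30) * (real (length xs) + 1)"
  have IH: "fn the_code 1 [m, cdr (slist (x # xs)), a, b, g] (slist (filter P xs)) ?C"
    using Cons by simp
  have t: "fnb the_code 2 [m, car (slist (x # xs)), a, b, g] (P x) B" using Cons.prems by simp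
  have c: "ev the_code ?env (Call 1 [Param 0, Cdr (Param 1), Param 2, Param 3, Param 4])
    (slist (filter P xs)) (?C + 7)"
    by (rule ev_weaken, (rule ev_rules IH)+) simp_all
  have d: "evb the_code ?env (Call 2 [Param 0, Car (Param 1), Param 2, Param 3, Param 4]) (P x) (B + 7)"
    by (rule evb_weaken, (rule evb_rules ev_rules t)+) simp_all
  have h: "ev the_code ?env (Cons_exp (Car (Param 1)) (Call 1 [Param 0, Cdr (Param 1), Param 2, Param 3, Param 4]))
    (Cell x (slist (filter P xs))) (?C + 10)"
    by (rule ev_weaken, (rule c ev_Cons ev_Car ev_Param)+) simp_all
  have e: "ev the_code ?env (If_exp (Call 2 [Param 0, Car (Param 1), Param 2, Param 3, Param 4])
        (Cons_exp (Car (Param 1)) (Call 1 [Param 0, Cdr (Param 1), Param 2, Param 3, Param 4]))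
        (Call 1 [Param 0, Cdr (Param 1), Param 2, Param 3, Param 4]))
      (slist (filter P (x # xs))) ((B + 7) + max (?C + 10) (?C + 7) + 1)"
    by (rule ev_If[OF d]) (use h c in auto)
  have "evb the_code ?env (Param 1) True 1" by (rule evb_weaken[OF evb_ev[OF ev_Param(2)]]) auto
  then have "ev the_code ?env filter_body (slist (filter P (x # xs))) (1 + max ((B + 7) + max (?C + 10) (?C + 7) + 1) 1 + 1)"
    unfolding filter_body_def by (rule ev_If) (use e in auto)
  then show ?case
  proof (intro fnI, elim ev_weaken)
    have "0 \<le> ?C" using B by simp
    moreover have "(B + 30) * (real (length (x # xs)) + 1) = ?C + (B + 30)"
      by (simp add: algebra_simps)
    ultimately show "1 + max ((B + 7) + max (?C + 10) (?C + 7) + 1) 1 + 1 \<le> (B + 30) * (real (length (x # xs)) + 1)"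
      using B by linarith
  qed simp
qed

text \<open>The surcharge 80 is 4 for each of the 20 entries of the dispatch table.\<close>

lemma fnb_test:
  assumes "i < 20" "evb the_code (Sym i # vs) (tests ! i) p B"
  shows "fnb the_code 2 (Sym i # vs) p (B + 80)"
proof -
  obtain v where v: "ev the_code (Sym i # vs) (tests ! i) v B" "v \<noteq> NIL \<longleftrightarrow> p"
    using assms(2) by (auto simp: evb_def)
  have "ev the_code (Sym (0 + i) # vs) (dispatch 0 tests) v (B + 4 * real (length tests))"
    by (rule ev_dispatch) (use assms(1) v(1) in \<open>auto simp: tests_def\<close>)
  then have "fn the_code 2 (Sym i # vs) v (B + 80)"
    by (intro fnI) (simp add: test_body_def tests_def)
  then show ?thesis using v(2) by (auto simp: fnb_def)
qed

lemma testI: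
  "evb the_code (Sym 0 # vs) eq_test p B \<Longrightarrow> fnb the_code 2 (Sym 0 # vs) p (B + 80)"
  "evb the_code (Sym 1 # vs) clause_test p B \<Longrightarrow> fnb the_code 2 (Sym 1 # vs) p (B + 80)"
  "evb the_code (Sym 2 # vs) notin_test p B \<Longrightarrow> fnb the_code 2 (Sym 2 # vs) p (B + 80)"
  "evb the_code (Sym 3 # vs) hit_test p B \<Longrightarrow> fnb the_code 2 (Sym 3 # vs) p (B + 80)"
  "evb the_code (Sym 4 # vs) free_test p B \<Longrightarrow> fnb the_code 2 (Sym 4 # vs) p (B + 80)"
  "evb the_code (Sym 5 # vs) adj_test p B \<Longrightarrow> fnb the_code 2 (Sym 5 # vs) p (B + 80)"
  "evb the_code (Sym 6 # vs) in_test p B \<Longrightarrow> fnb the_code 2 (Sym 6 # vs) p (B + 80)"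
  "evb the_code (Sym 7 # vs) neq_test p B \<Longrightarrow> fnb the_code 2 (Sym 7 # vs) p (B + 80)"
  "evb the_code (Sym 8 # vs) unsat_test p B \<Longrightarrow> fnb the_code 2 (Sym 8 # vs) p (B + 80)"
  "evb the_code (Sym 9 # vs) unhit_test p B \<Longrightarrow> fnb the_code 2 (Sym 9 # vs) p (B + 80)"
  "evb the_code (Sym 10 # vs) unit_test p B \<Longrightarrow> fnb the_code 2 (Sym 10 # vs) p (B + 80)"
  "evb the_code (Sym 11 # vs) has_in_test p B \<Longrightarrow> fnb the_code 2 (Sym 11 # vs) p (B + 80)"
  "evb the_code (Sym 12 # vs) no_in_test p B \<Longrightarrow> fnb the_code 2 (Sym 12 # vs) p (B + 80)"
  "evb the_code (Sym 13 # vs) low_out2_test p B \<Longrightarrow> fnb the_code 2 (Sym 13 # vs) p (B + 80)"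
  "evb the_code (Sym 14 # vs) single_in_test p B \<Longrightarrow> fnb the_code 2 (Sym 14 # vs) p (B + 80)"
  "evb the_code (Sym 15 # vs) high_deg_test p B \<Longrightarrow> fnb the_code 2 (Sym 15 # vs) p (B + 80)"
  "evb the_code (Sym 16 # vs) low_out3_test p B \<Longrightarrow> fnb the_code 2 (Sym 16 # vs) p (B + 80)"
  "evb the_code (Sym 17 # vs) spread_test p B \<Longrightarrow> fnb the_code 2 (Sym 17 # vs) p (B + 80)"
  "evb the_code (Sym 18 # vs) spread_out_test p B \<Longrightarrow> fnb the_code 2 (Sym 18 # vs) p (B + 80)"
  "evb the_code (Sym 19 # vs) init_test p B \<Longrightarrow> fnb the_code 2 (Sym 19 # vs) p (B + 80)"
proof -
  show
    "evb the_code (Sym 0 # vs) eq_test p B \<Longrightarrow> fnb the_code 2 (Sym 0 # vs) p (B + 80)"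
    "evb the_code (Sym 1 # vs) clause_test p B \<Longrightarrow> fnb the_code 2 (Sym 1 # vs) p (B + 80)"
    "evb the_code (Sym 2 # vs) notin_test p B \<Longrightarrow> fnb the_code 2 (Sym 2 # vs) p (B + 80)"
    "evb the_code (Sym 3 # vs) hit_test p B \<Longrightarrow> fnb the_code 2 (Sym 3 # vs) p (B + 80)"
    "evb the_code (Sym 4 # vs) free_test p B \<Longrightarrow> fnb the_code 2 (Sym 4 # vs) p (B + 80)"
    "evb the_code (Sym 5 # vs) adj_test p B \<Longrightarrow> fnb the_code 2 (Sym 5 # vs) p (B + 80)"
    "evb the_code (Sym 6 # vs) in_test p B \<Longrightarrow> fnb the_code 2 (Sym 6 # vs) p (B + 80)"
    "evb the_code (Sym 7 # vs) neq_test p B \<Longrightarrow> fnb the_code 2 (Sym 7 # vs) p (B + 80)"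
    "evb the_code (Sym 8 # vs) unsat_test p B \<Longrightarrow> fnb the_code 2 (Sym 8 # vs) p (B + 80)"
    "evb the_code (Sym 9 # vs) unhit_test p B \<Longrightarrow> fnb the_code 2 (Sym 9 # vs) p (B + 80)"
    "evb the_code (Sym 10 # vs) unit_test p B \<Longrightarrow> fnb the_code 2 (Sym 10 # vs) p (B + 80)"
    "evb the_code (Sym 11 # vs) has_in_test p B \<Longrightarrow> fnb the_code 2 (Sym 11 # vs) p (B + 80)"
    "evb the_code (Sym 12 # vs) no_in_test p B \<Longrightarrow> fnb the_code 2 (Sym 12 # vs) p (B + 80)"
    "evb the_code (Sym 13 # vs) low_out2_test p B \<Longrightarrow> fnb the_code 2 (Sym 13 # vs) p (B + 80)"
    "evb the_code (Sym 14 # vs) single_in_test p B \<Longrightarrow> fnb the_code 2 (Sym 14 # vs) p (B + 80)"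
    "evb the_code (Sym 15 # vs) high_deg_test p B \<Longrightarrow> fnb the_code 2 (Sym 15 # vs) p (B + 80)"
    "evb the_code (Sym 16 # vs) low_out3_test p B \<Longrightarrow> fnb the_code 2 (Sym 16 # vs) p (B + 80)"
    "evb the_code (Sym 17 # vs) spread_test p B \<Longrightarrow> fnb the_code 2 (Sym 17 # vs) p (B + 80)"
    "evb the_code (Sym 18 # vs) spread_out_test p B \<Longrightarrow> fnb the_code 2 (Sym 18 # vs) p (B + 80)"
    "evb the_code (Sym 19 # vs) init_test p B \<Longrightarrow> fnb the_code 2 (Sym 19 # vs) p (B + 80)"
    by (rule fnb_test; simp add: tests_def)+
qed

lemma ev_Filt:
  assumes "ev F env xs vx B1" "ev F env a va B2" "ev F env b vb B3" "ev F env g vg B4"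
    "fn F 1 [Sym m, vx, va, vb, vg] r B"
  shows "ev F env (Filt m xs a b g) r (B1 + B2 + B3 + B4 + B + 2)"
  unfolding Filt_def
  by (rule ev_weaken, rule ev_Call, (rule evs_Cons evs_Nil ev_Quote assms)+) simp_all

lemma evb_Filt:
  assumes "ev F env xs vx B1" "ev F env a va B2" "ev F env b vb B3" "ev F env g vg B4"
    "fnb F 1 [Sym m, vx, va, vb, vg] p B"
  shows "evb F env (Filt m xs a b g) p (B1 + B2 + B3 + B4 + B + 2)"
proof -
  obtain r where "fn F 1 [Sym m, vx, va, vb, vg] r B" "r \<noteq> NIL \<longleftrightarrow> p"
    using assms(5) by (auto simp: fnb_def)
  then show ?thesis using ev_Filt[OF assms(1-4)] unfolding evb_def by blast
qed

section \<open>Encoding of atoms and clauses\<close>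

definition enc :: "nat list \<Rightarrow> sexp" where "enc xs = slist (map Sym xs)"

lemma enc_eq_NIL: "enc xs = NIL \<longleftrightarrow> xs = []"
  by (simp add: enc_def slist_eq_NIL)

lemma car_enc: "xs \<noteq> [] \<Longrightarrow> car (enc xs) = Sym (hd xs)"
  by (cases xs) (auto simp: enc_def)

lemma enc_Cons: "Cell (Sym x) (enc xs) = enc (x # xs)"
  by (simp add: enc_def)

fun enc_opt :: "nat option \<Rightarrow> sexp" where
  "enc_opt None = NIL"
| "enc_opt (Some q) = Sym q"

fun enc_clause :: "nat \<times> nat option \<Rightarrow> sexp" where
  "enc_clause (p, None) = Cell (Sym p) NIL"
| "enc_clause (p, Some q) = Cell (Sym p) (Cell (Cell NIL (Sym q)) NIL)"

lemma car_enc_clause: "car (enc_clause c) = Sym (fst c)"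
  by (cases c rule: enc_clause.cases) auto

lemma cdr_enc_clause: "cdr (car (cdr (enc_clause c))) = enc_opt (snd c)"
  by (cases c rule: enc_clause.cases) auto

lemma enc_opt_inject: "enc_opt p = enc_opt q \<longleftrightarrow> p = q"
  by (cases p; cases q) auto

lemma is_atom_enc_opt: "is_atom (enc_opt p)"
  by (cases p) auto

section \<open>Correctness and cost of the code\<close>

text \<open>A clause mentions at most two atoms, so \<open>N\<close> bounds the number of clauses as
  well as the number of atoms, and with it the length of every list that is scanned.\<close>

locale lisp_program =
  fixes cs :: "(nat \<times> nat option) list" and N :: nat
  assumes asym_cs: "(a, Some b) \<in> set cs \<Longrightarrow> (b, Some a) \<in> set cs \<Longrightarrow> a = b"
    and length_cs: "2 * length cs \<le> N"
begin

definition E :: "nat \<Rightarrow> nat \<Rightarrow> bool" where "E v u \<longleftrightarrow> (v, Some u) \<in> set cs"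
definition fact :: "nat \<Rightarrow> bool" where "fact v \<longleftrightarrow> (v, None) \<in> set cs"
definition At :: "nat set" where "At = fst ` set cs \<union> {q. \<exists>p. (p, Some q) \<in> set cs}"
definition T :: "nat set" where "T = {v \<in> At. \<not> fact v}"
definition G :: sexp where "G = slist (map enc_clause cs)"
text \<open>\<open>L k\<close> bounds the cost of \<open>k\<close> nested loops over lists of length at most \<open>N\<close>.\<close>
definition L :: "nat \<Rightarrow> real" where "L k = (1000 * (real N + 1)) ^ k"

sublocale kernel_search E T
  by unfold_locales (use asym_cs in \<open>auto simp: E_def\<close>)

lemma L_0: "L 0 = 1" by (simp add: L_def)
lemma L_Suc: "L (Suc k) = 1000 * (real N + 1) * L k" by (simp add: L_def)
lemma L_ge_1: "1 \<le> L k" by (simp add: L_def one_le_power)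

lemma L_mono: "1000 * L k \<le> L (Suc k)"
proof -
  have "1000 * L k * 1 \<le> 1000 * L k * (real N + 1)" using L_ge_1[of k] by (intro mult_left_mono) auto
  then show ?thesis by (simp add: L_Suc mult_ac)
qed

lemma L_facts:
  "L 0 = 1" "1000 \<le> L 1" "1000 * L 1 \<le> L 2" "1000 * L 2 \<le> L 3" "1000 * L 3 \<le> L 4" "1000 * L 4 \<le> L 5"
  "1000 * L 5 \<le> L 6" "1000 * L 6 \<le> L 7"
  using L_mono[of 0] L_mono[of 1] L_mono[of 2] L_mono[of 3] L_mono[of 4] L_mono[of 5] L_mono[of 6] L_0
  by (simp_all add: eval_nat_numeral)

text \<open>One more loop costs a factor of at most \<open>N + 1\<close>. Allowing 500 for a test
  while \<open>L\<close> grows by 1000 per level absorbs all additive constants.\<close>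

lemma filt_L:
  assumes "\<And>x. x \<in> set xs \<Longrightarrow> fnb the_code 2 [m, x, a, b, g] (P x) (500 * L k)"
    and "length xs \<le> N" "j = Suc k"
  shows "fn the_code 1 [m, slist xs, a, b, g] (slist (filter P xs)) (L j)"
proof (rule fn_weaken[OF fn_filt[OF assms(1)] refl])
  have "(500 * L k + 30) * (real (length xs) + 1) \<le> (1000 * L k) * (real N + 1)"
    using L_ge_1[of k] assms(2) by (intro mult_mono) auto
  then show "(500 * L k + 30) * (real (length xs) + 1) \<le> L j" by (simp add: L_Suc mult_ac assms(3))
qed (use L_ge_1[of k] in auto)

lemma filt_enc:
  assumes "\<And>x. x \<in> set xs \<Longrightarrow> fnb the_code 2 [m, Sym x, a, b, g] (P x) (500 * L k)"
    and "length xs \<le> N" "j = Suc k"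
  shows "fn the_code 1 [m, enc xs, a, b, g] (enc (filter P xs)) (L j)"
proof -
  define Q where "Q s \<longleftrightarrow> (case s of Sym x \<Rightarrow> P x | _ \<Rightarrow> False)" for s
  have "fn the_code 1 [m, slist (map Sym xs), a, b, g] (slist (filter Q (map Sym xs))) (L j)"
    by (rule filt_L) (use assms in \<open>auto simp: Q_def\<close>)
  then show ?thesis by (simp add: enc_def filter_map comp_def Q_def)
qed

lemma fnb_enc: "fn F f vs (enc xs) B \<Longrightarrow> fnb F f vs (xs \<noteq> []) B"
  by (rule fnb_weaken[OF fnb_fn]) (auto simp: enc_eq_NIL)

section \<open>Cost of the individual filters\<close>

lemma filt_eq:
  assumes "length xs \<le> N"
  shows "fn the_code 1 [Sym 0, enc xs, Sym a, b, g] (enc (filter (\<lambda>x. x = a) xs)) (L 1)"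
proof (rule filt_enc[OF _ assms, of _ _ _ _ _ 0])
  fix x
  show "fnb the_code 2 [Sym 0, Sym x, Sym a, b, g] (x = a) (500 * L 0)"
    by (rule fnb_weaken, rule testI, unfold eq_test_def, (rule evb_rules ev_rules)+) (auto simp: L_0)
qed simp

lemma filt_mem:
  assumes "length xs \<le> N"
  shows "fnb the_code 1 [Sym 0, enc xs, Sym a, b, g] (a \<in> set xs) (L 1)"
  by (rule fnb_weaken[OF fnb_enc[OF filt_eq[OF assms]]]) (auto simp: filter_empty_conv)

lemma filt_edge:
  "fnb the_code 1 [Sym 1, G, Sym v, enc_opt q, NIL] ((v, q) \<in> set cs) (L 1)"
proof -
  have *: "fnb the_code 2 [Sym 1, enc_clause c, Sym v, enc_opt q, NIL] (c = (v, q)) (500 * L 0)" for c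
    by (rule fnb_weaken, rule testI, unfold clause_test_def, (rule evb_rules ev_rules)+)
      (auto simp: L_0 car_enc_clause cdr_enc_clause enc_opt_inject is_atom_enc_opt prod_eq_iff)
  define Q where "Q s \<longleftrightarrow> s = enc_clause (v, q)" for s
  have inj: "enc_clause c = enc_clause (v, q) \<longleftrightarrow> c = (v, q)" for c
    using car_enc_clause cdr_enc_clause enc_opt_inject by (metis prod.collapse fst_conv snd_conv sexp.inject(1))
  have "fn the_code 1 [Sym 1, slist (map enc_clause cs), Sym v, enc_opt q, NIL] (slist (filter Q (map enc_clause cs))) (L 1)"
    by (rule filt_L) (use * length_cs in \<open>auto simp: Q_def inj\<close>)
  from fnb_fn[OF this] show ?thesis unfolding G_def
    by (rule fnb_weaken) (auto simp: slist_eq_NIL filter_empty_conv Q_def inj)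
qed

lemma evb_Edge:
  assumes "ev the_code [x0, x1, x2, x3, G] e1 (Sym v) 1" "ev the_code [x0, x1, x2, x3, G] e2 (Sym u) 1"
  shows "evb the_code [x0, x1, x2, x3, G] (Edge e1 e2) (E v u) (L 1 + 6)"
  unfolding Edge_def E_def
  by (rule evb_weaken, rule evb_Filt, (rule assms ev_rules filt_edge[of v "Some u", unfolded enc_opt.simps])+) simp_all

lemma evb_Edge_nil:
  assumes "ev the_code [x0, x1, x2, x3, G] e1 (Sym v) 1"
  shows "evb the_code [x0, x1, x2, x3, G] (Edge e1 nil) (fact v) (L 1 + 6)"
  unfolding Edge_def fact_def
  by (rule evb_weaken, rule evb_Filt, (rule assms ev_rules filt_edge[of v None, unfolded enc_opt.simps])+) simp_all

lemma filt_notin: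
  assumes "length xs \<le> N" "length ys \<le> N"
  shows "fn the_code 1 [Sym 2, enc xs, enc ys, b, g] (enc (filter (\<lambda>x. x \<notin> set ys) xs)) (L 2)"
proof (rule filt_enc[OF _ assms(1), of _ _ _ _ _ 1])
  fix x
  show "fnb the_code 2 [Sym 2, Sym x, enc ys, b, g] (x \<notin> set ys) (500 * L 1)"
    by (rule fnb_weaken, rule testI, unfold notin_test_def, (rule evb_Filt evb_rules ev_rules filt_mem[OF assms(2)])+)
      (use L_facts in auto)
qed simp

lemma filt_hit:
  assumes "length xs \<le> N"
  shows "fn the_code 1 [Sym 3, enc xs, Sym v, b, G] (enc (outs xs v)) (L 2)"
  unfolding outs_def
proof (rule filt_enc[OF _ assms, of _ _ _ _ _ 1])
  fix x
  show "fnb the_code 2 [Sym 3, Sym x, Sym v, b, G] (x = v \<or> E v x) (500 * L 1)"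
    by (rule fnb_weaken, rule testI, unfold hit_test_def, (rule evb_Edge evb_rules ev_rules)+)
      (use L_facts in auto)
qed simp

lemma filt_free:
  assumes "length xs \<le> N"
  shows "fn the_code 1 [Sym 4, enc xs, Sym v, b, G] (enc (filter (\<lambda>x. x \<notin> nbh v) xs)) (L 2)"
proof (rule filt_enc[OF _ assms, of _ _ _ _ _ 1])
  fix x
  show "fnb the_code 2 [Sym 4, Sym x, Sym v, b, G] (x \<notin> nbh v) (500 * L 1)"
    by (rule fnb_weaken, rule testI, unfold free_test_def, (rule evb_Edge evb_rules ev_rules)+)
      (use L_facts in \<open>auto simp: nbh_def\<close>)
qed simp

lemma filt_adj:
  assumes "length xs \<le> N"
  shows "fn the_code 1 [Sym 5, enc xs, Sym v, b, G] (enc (nbs xs v)) (L 2)"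
  unfolding nbs_def
proof (rule filt_enc[OF _ assms, of _ _ _ _ _ 1])
  fix x
  show "fnb the_code 2 [Sym 5, Sym x, Sym v, b, G] (x = v \<or> E v x \<or> E x v) (500 * L 1)"
    by (rule fnb_weaken, rule testI, unfold adj_test_def, (rule evb_Edge evb_rules ev_rules)+)
      (use L_facts in auto)
qed simp

lemma filt_in:
  assumes "length xs \<le> N"
  shows "fn the_code 1 [Sym 6, enc xs, Sym v, b, G] (enc (ins xs v)) (L 2)"
  unfolding ins_def
proof (rule filt_enc[OF _ assms, of _ _ _ _ _ 1])
  fix x
  show "fnb the_code 2 [Sym 6, Sym x, Sym v, b, G] (E x v) (500 * L 1)"
    by (rule fnb_weaken, rule testI, unfold in_test_def, (rule evb_Edge evb_rules ev_rules)+)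
      (use L_facts in auto)
qed simp

lemma filt_neq:
  assumes "length xs \<le> N"
  shows "fn the_code 1 [Sym 7, enc xs, Sym v, b, g] (enc (filter (\<lambda>x. x \<noteq> v) xs)) (L 1)"
proof (rule filt_enc[OF _ assms, of _ _ _ _ _ 0])
  fix x
  show "fnb the_code 2 [Sym 7, Sym x, Sym v, b, g] (x \<noteq> v) (500 * L 0)"
    by (rule fnb_weaken, rule testI, unfold neq_test_def, (rule evb_rules ev_rules)+)
      (use L_facts in auto)
qed simp

lemma filt_init:
  assumes "length xs \<le> N"
  shows "fn the_code 1 [Sym 19, enc xs, a, b, G] (enc (filter (\<lambda>x. \<not> fact x \<and> \<not> E x x) xs)) (L 2)"
proof (rule filt_enc[OF _ assms, of _ _ _ _ _ 1])
  fix x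
  show "fnb the_code 2 [Sym 19, Sym x, a, b, G] (\<not> fact x \<and> \<not> E x x) (500 * L 1)"
    by (rule fnb_weaken, rule testI, unfold init_test_def, (rule evb_Edge evb_Edge_nil evb_rules ev_rules)+)
      (use L_facts in auto)
qed simp

lemma length_filters:
  "length (outs xs v) \<le> length xs" "length (ins xs v) \<le> length xs" "length (nbs xs v) \<le> length xs"
  by (simp_all add: outs_def ins_def nbs_def)

lemma filt_unsat:
  assumes "length xs \<le> N" "length ks \<le> N"
  shows "fn the_code 1 [Sym 8, enc xs, enc ks, b, G] (enc (filter (\<lambda>x. \<not> fact x \<and> outs ks x = []) xs)) (L 3)"
proof (rule filt_enc[OF _ assms(1), of _ _ _ _ _ 2])
  fix x
  show "fnb the_code 2 [Sym 8, Sym x, enc ks, b, G] (\<not> fact x \<and> outs ks x = []) (500 * L 2)"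
    by (rule fnb_weaken, rule testI, unfold unsat_test_def,
        (rule evb_Edge_nil evb_Filt fnb_enc filt_hit[OF assms(2)] evb_rules ev_rules)+)
      (use L_facts in auto)
qed simp

lemma filt_unhit:
  assumes "length xs \<le> N" "length us \<le> N"
  shows "fn the_code 1 [Sym 9, enc xs, enc us, b, G] (enc (filter (\<lambda>x. outs us x = []) xs)) (L 3)"
proof (rule filt_enc[OF _ assms(1), of _ _ _ _ _ 2])
  fix x
  show "fnb the_code 2 [Sym 9, Sym x, enc us, b, G] (outs us x = []) (500 * L 2)"
    by (rule fnb_weaken, rule testI, unfold unhit_test_def,
        (rule evb_Filt fnb_enc filt_hit[OF assms(2)] evb_rules ev_rules)+)
      (use L_facts in auto)
qed simp

lemma evb_cdrs_enc:
  "ev F env e (enc xs) B \<Longrightarrow> evb F env (cdrs n e) (n < length xs) (B + n)"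
  using evb_cdrs[of F env e "map Sym xs" B n] by (simp add: enc_def)

lemma filt_unit:
  assumes "length xs \<le> N" "length us \<le> N"
  shows "fn the_code 1 [Sym 10, enc xs, enc us, b, G] (enc (filter (\<lambda>x. length (outs us x) \<le> 1) xs)) (L 3)"
proof (rule filt_enc[OF _ assms(1), of _ _ _ _ _ 2])
  fix x
  show "fnb the_code 2 [Sym 10, Sym x, enc us, b, G] (length (outs us x) \<le> 1) (500 * L 2)"
    by (rule fnb_weaken, rule testI, unfold unit_test_def,
        (rule evb_cdrs_enc ev_Filt filt_hit[OF assms(2)] evb_rules ev_rules)+)
      (use L_facts in auto)
qed simp

lemma filt_has_in:
  assumes "length xs \<le> N" "length us \<le> N"
  shows "fn the_code 1 [Sym 11, enc xs, enc us, b, G] (enc (filter (\<lambda>x. ins us x \<noteq> []) xs)) (L 3)"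
proof (rule filt_enc[OF _ assms(1), of _ _ _ _ _ 2])
  fix x
  show "fnb the_code 2 [Sym 11, Sym x, enc us, b, G] (ins us x \<noteq> []) (500 * L 2)"
    by (rule fnb_weaken, rule testI, unfold has_in_test_def,
        (rule evb_Filt fnb_enc filt_in[OF assms(2)] evb_rules ev_rules)+)
      (use L_facts in auto)
qed simp

lemma filt_no_in:
  assumes "length xs \<le> N" "length us \<le> N"
  shows "fn the_code 1 [Sym 12, enc xs, enc us, b, G] (enc (filter (\<lambda>x. ins us x = []) xs)) (L 3)"
proof (rule filt_enc[OF _ assms(1), of _ _ _ _ _ 2])
  fix x
  show "fnb the_code 2 [Sym 12, Sym x, enc us, b, G] (ins us x = []) (500 * L 2)"
    by (rule fnb_weaken, rule testI, unfold no_in_test_def,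
        (rule evb_Filt fnb_enc filt_in[OF assms(2)] evb_rules ev_rules)+)
      (use L_facts in auto)
qed simp

lemma filt_low_out2:
  assumes "length ws \<le> N"
  shows "fn the_code 1 [Sym 13, enc ws, enc ws, b, G] (enc (low_out 2 ws)) (L 3)"
  unfolding low_out_def
proof (rule filt_enc[OF _ assms(1), of _ _ _ _ _ 2])
  fix x
  show "fnb the_code 2 [Sym 13, Sym x, enc ws, b, G] (length (outs ws x) \<le> 2) (500 * L 2)"
    by (rule fnb_weaken, rule testI, unfold low_out2_test_def,
        (rule evb_cdrs_enc ev_Filt filt_hit[OF assms] evb_rules ev_rules)+)
      (use L_facts in auto)
qed simp

lemma filt_low_out3:
  assumes "length ws \<le> N"
  shows "fn the_code 1 [Sym 16, enc ws, enc ws, b, G] (enc (low_out 3 ws)) (L 3)"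
  unfolding low_out_def
proof (rule filt_enc[OF _ assms(1), of _ _ _ _ _ 2])
  fix x
  show "fnb the_code 2 [Sym 16, Sym x, enc ws, b, G] (length (outs ws x) \<le> 3) (500 * L 2)"
    by (rule fnb_weaken, rule testI, unfold low_out3_test_def,
        (rule evb_cdrs_enc ev_Filt filt_hit[OF assms] evb_rules ev_rules)+)
      (use L_facts in auto)
qed simp

lemma filt_single_in:
  assumes "length ws \<le> N"
  shows "fn the_code 1 [Sym 14, enc ws, enc ws, b, G] (enc (single_in ws)) (L 3)"
  unfolding single_in_def
proof (rule filt_enc[OF _ assms(1), of _ _ _ _ _ 2])
  fix x
  show "fnb the_code 2 [Sym 14, Sym x, enc ws, b, G] (length (ins ws x) \<le> 1) (500 * L 2)"
    by (rule fnb_weaken, rule testI, unfold single_in_test_def,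
        (rule evb_cdrs_enc ev_Filt filt_in[OF assms] evb_rules ev_rules)+)
      (use L_facts in auto)
qed simp

lemma filt_high_deg:
  assumes "length ws \<le> N"
  shows "fn the_code 1 [Sym 15, enc ws, enc ws, b, G] (enc (high_deg ws)) (L 3)"
  unfolding high_deg_def
proof (rule filt_enc[OF _ assms(1), of _ _ _ _ _ 2])
  fix x
  show "fnb the_code 2 [Sym 15, Sym x, enc ws, b, G] (8 \<le> length (nbs ws x)) (500 * L 2)"
    by (rule fnb_weaken, rule testI, unfold high_deg_test_def,
        (rule evb_cdrs_enc ev_Filt filt_adj[OF assms] evb_rules ev_rules)+)
      (use L_facts in auto)
qed simp

lemma filt_spread:
  assumes "length ws \<le> N"
  shows "fn the_code 1 [Sym 17, enc (outs ws v), enc ws, Sym v, G] (enc (filter (spread ws v) (outs ws v))) (L 3)"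
proof (rule filt_enc[of _ _ _ _ _ _ 2])
  fix x
  have outs: "length (outs ws v) \<le> N" using length_filters assms le_trans by blast
  show "fnb the_code 2 [Sym 17, Sym x, enc ws, Sym v, G] (spread ws v x) (500 * L 2)"
    by (rule fnb_weaken, rule testI, unfold spread_test_def,
        (rule evb_cdrs_enc evb_Filt fnb_enc filt_free[OF outs] ev_Filt filt_hit[OF assms]
          filt_adj[OF assms] evb_rules ev_rules)+)
      (use L_facts in \<open>auto simp: spread_def\<close>)
  show "length (outs ws v) \<le> N" by (rule outs)
qed simp

lemma filt_spread_out:
  assumes "length ws \<le> N"
  shows "fn the_code 1 [Sym 18, enc ws, enc ws, b, G] (enc (spread_out ws)) (L 4)"
  unfolding spread_out_def
proof (rule filt_enc[OF _ assms(1), of _ _ _ _ _ 3])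
  fix x
  show "fnb the_code 2 [Sym 18, Sym x, enc ws, b, G]
    (length (outs ws x) \<le> 3 \<and> filter (spread ws x) (outs ws x) \<noteq> []) (500 * L 3)"
    by (rule fnb_weaken, rule testI, unfold spread_out_test_def,
        (rule evb_cdrs_enc evb_Filt fnb_enc filt_spread[OF assms] ev_Filt filt_hit[OF assms] evb_rules ev_rules)+)
      (use L_facts in auto)
qed simp

end

section \<open>Computing the core, the pivots and the list of atoms\<close>

context lisp_program
begin

lemma finite_At: "finite At" and card_At: "card At \<le> N"
proof -
  \<comment> \<open>Facts have no body atom and are mapped to their heads instead, so that the image
    has at most \<open>length cs\<close> elements.\<close>
  let ?f = "\<lambda>c. case snd c of None \<Rightarrow> fst c | Some q \<Rightarrow> q"
  have *: "At \<subseteq> fst ` set cs \<union> ?f ` set cs"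
    unfolding At_def by (force simp: image_iff)
  then show "finite At" using finite_subset by blast
  have "card At \<le> card (fst ` set cs \<union> ?f ` set cs)" by (rule card_mono[OF _ *]) simp
  also have "\<dots> \<le> card (fst ` set cs) + card (?f ` set cs)" by (rule card_Un_le)
  also have "\<dots> \<le> length cs + length cs"
    by (intro add_mono order_trans[OF card_image_le card_length]) auto
  finally show "card At \<le> N" using length_cs by simp
qed

lemma length_le_N: "distinct xs \<Longrightarrow> set xs \<subseteq> At \<Longrightarrow> length xs \<le> N"
  using card_mono[OF finite_At, of "set xs"] card_At distinct_card[of xs] by simp

text \<open>Vertices without in-neighbours are discarded until none is left: they cannot belong to
  the core, and a set without them is its own core. Every round shortens the list and runs two
  filters of cost \<open>L 3\<close>.\<close>

lemma fn_core:
  assumes "distinct us" "length us \<le> N"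
  shows "\<exists>ws. distinct ws \<and> set ws = core (set us)
    \<and> fn the_code 5 [enc us, G] (enc ws) ((2 * L 3 + 50) * (real (length us) + 1))"
  using assms
proof (induction "length us" arbitrary: us rule: less_induct)
  case less
  let ?bad = "filter (\<lambda>x. ins us x = []) us" and ?vs = "filter (\<lambda>x. ins us x \<noteq> []) us"
  note len = less.prems(2)
  have c: "evb the_code [enc us, G] (Filt 12 (Param 0) (Param 0) nil (Param 1)) (?bad \<noteq> []) (L 3 + 10)"
    by (rule evb_weaken, (rule evb_Filt ev_rules fnb_enc filt_no_in[OF len len])+) auto
  show ?case
  proof (cases "?bad = []")
    case True
    have "core (set us) = set us"
      by (rule core_self) (use True in \<open>auto simp: filter_empty_conv ins_def\<close>)
    moreover have "ev the_code [enc us, G] core_body (enc us) (L 3 + 10 + max 0 1 + 1)"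
      unfolding core_body_def by (rule ev_If[OF c]) (use True in \<open>auto intro: ev_rules\<close>)
    then have "fn the_code 5 [enc us, G] (enc us) ((2 * L 3 + 50) * 1)"
      by (intro fnI, elim ev_weaken) (use L_ge_1[of 3] in auto)
    then have "fn the_code 5 [enc us, G] (enc us) ((2 * L 3 + 50) * (real (length us) + 1))"
      by (rule fn_weaken[OF _ refl]) (use L_ge_1[of 3] in \<open>intro mult_left_mono, auto\<close>)
    ultimately show ?thesis using less.prems by blast
  next
    case False
    have "length ?vs < length us"
      using False sum_length_filter_compl[of "\<lambda>x. ins us x = []" us]
      by (metis add_less_same_cancel2 add.commute length_greater_0_conv less_add_same_cancel1)
    moreover have "length ?vs \<le> N" using len length_filter_le order_trans by blast
    ultimately obtain ws where ws: "distinct ws" "set ws = core (set ?vs)"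
      "fn the_code 5 [enc ?vs, G] (enc ws) ((2 * L 3 + 50) * (real (length ?vs) + 1))"
      using less.hyps[of ?vs] less.prems by auto
    have "core (set us) \<subseteq> set ?vs"
    proof
      fix v assume v: "v \<in> core (set us)"
      then obtain w where "w \<in> core (set us)" "E w v" using core_in_edge by blast
      then show "v \<in> set ?vs" using v core_subset[of "set us"] by (auto simp: ins_def filter_empty_conv)
    qed
    then have "core (set us) = core (set ?vs)"
      using core_mono[of "set ?vs" "set us"] core_greatest[of "core (set us)" "set ?vs"] core_in_edge by auto
    moreover have "ev the_code [enc us, G] (Call 5 [Filt 11 (Param 0) (Param 0) nil (Param 1), Param 1]) (enc ws)
        (L 3 + 20 + (2 * L 3 + 50) * (real (length ?vs) + 1))"
      by (rule ev_weaken, (rule ev_Filt ev_rules filt_has_in[OF len len] ws(3))+) auto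
    then have "ev the_code [enc us, G] core_body (enc ws)
      (L 3 + 10 + max (L 3 + 20 + (2 * L 3 + 50) * (real (length ?vs) + 1)) 0 + 1)"
      unfolding core_body_def by (intro ev_If[OF c]) (use False in auto)
    then have "fn the_code 5 [enc us, G] (enc ws) ((2 * L 3 + 50) * (real (length us) + 1))"
    proof (intro fnI, elim ev_weaken)
      have "(2 * L 3 + 50) * (real (length ?vs) + 1) + (2 * L 3 + 50) = (2 * L 3 + 50) * (real (length ?vs) + 1 + 1)"
        by (simp add: algebra_simps)
      also have "\<dots> \<le> (2 * L 3 + 50) * (real (length us) + 1)"
        using \<open>length ?vs < length us\<close> L_ge_1[of 3] by (intro mult_left_mono) auto
      finally show "L 3 + 10 + max (L 3 + 20 + (2 * L 3 + 50) * (real (length ?vs) + 1)) 0 + 1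
        \<le> (2 * L 3 + 50) * (real (length us) + 1)"
        using L_ge_1[of 3] mult_nonneg_nonneg[of "2 * L 3 + 50" "real (length ?vs) + 1"] by linarith
    qed simp
    ultimately show ?thesis using ws(1,2) by auto
  qed
qed

lemma fn_core_L:
  assumes "distinct us" "length us \<le> N"
  obtains ws where "distinct ws" "set ws = core (set us)" "fn the_code 5 [enc us, G] (enc ws) (L 4)"
proof -
  obtain ws where ws: "distinct ws" "set ws = core (set us)"
      "fn the_code 5 [enc us, G] (enc ws) ((2 * L 3 + 50) * (real (length us) + 1))"
    using fn_core[OF assms] by blast
  have "(2 * L 3 + 50) * (real (length us) + 1) \<le> (1000 * L 3) * (real N + 1)"
    using assms(2) L_ge_1[of 3] by (intro mult_mono) auto
  also have "\<dots> = L 4" using L_Suc[of 3] by (simp add: eval_nat_numeral mult_ac)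
  finally show ?thesis using that[OF ws(1,2)] fn_weaken[OF ws(3) refl] by blast
qed

lemma ev_Car_enc:
  "ev F env e (enc xs) B \<Longrightarrow> xs \<noteq> [] \<Longrightarrow> ev F env (Car e) (Sym (hd xs)) (B + 1)"
  using ev_Car[of F env e "enc xs" B] by (simp add: car_enc)

lemma ev_nonneg: "ev F env e v B \<Longrightarrow> 0 \<le> B"
  unfolding ev_def by (auto intro: order_trans[OF of_nat_0_le_iff])

lemma ev_single: "ev F env e (Sym x) B \<Longrightarrow> ev F env (Cons_exp e nil) (enc [x]) (B + 2)"
  by (rule ev_weaken, rule ev_Cons, assumption, rule ev_Quote) (auto simp: enc_def)

lemma fn_single_in:
  assumes "length ws \<le> N" "ins ws p \<noteq> []"
  shows "fn the_code 7 [Sym p, enc ws, G] (enc (if 5 \<le> length (nbs ws p) then [p] else [hd (ins ws p)])) (3 * L 2)"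
proof -
  let ?env = "[Sym p, enc ws, G]"
  have c: "evb the_code ?env (cdrs 4 (Filt 5 (Param 1) (Param 0) nil (Param 2))) (5 \<le> length (nbs ws p)) (L 2 + 10)"
    by (rule evb_weaken, (rule evb_cdrs_enc ev_Filt ev_rules filt_adj[OF assms(1)])+) auto
  have "ev the_code ?env single_in_body (enc (if 5 \<le> length (nbs ws p) then [p] else [hd (ins ws p)]))
    (L 2 + 10 + max 3 (L 2 + 20) + 1)"
    unfolding single_in_body_def
  proof (rule ev_If[OF c])
    assume "5 \<le> length (nbs ws p)"
    then show "ev the_code ?env (Cons_exp (Param 0) nil) (enc (if 5 \<le> length (nbs ws p) then [p] else [hd (ins ws p)])) 3"
      using ev_single[OF ev_Param(1)] by (auto elim!: ev_weaken)
  next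
    assume *: "\<not> 5 \<le> length (nbs ws p)"
    have "ev the_code ?env (Cons_exp (Car (Filt 6 (Param 1) (Param 0) nil (Param 2))) nil) (enc [hd (ins ws p)]) (L 2 + 20)"
      by (rule ev_weaken, (rule ev_single ev_Car_enc ev_Filt ev_Param ev_Quote filt_in[OF assms(1)] assms(2))+) auto
    then show "ev the_code ?env (Cons_exp (Car (Filt 6 (Param 1) (Param 0) nil (Param 2))) nil)
       (enc (if 5 \<le> length (nbs ws p) then [p] else [hd (ins ws p)])) (L 2 + 20)"
      using * by simp
  qed
  then show ?thesis by (intro fnI, elim ev_weaken) (use L_facts in auto)
qed

text \<open>The filter for \<open>spread_out\<close> is the only one four loops deep; all others are
  cheaper, so \<open>L 4\<close> serves as a common bound.\<close>

lemma fn_pivots: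
  assumes len: "length ws \<le> N" and ne: "ws \<noteq> []" and ins: "\<And>v. v \<in> set ws \<Longrightarrow> ins ws v \<noteq> []"
  shows "fn the_code 6 [enc ws, G] (enc (pivots ws)) (L 5)"
proof -
  let ?env = "[enc ws, G]"
  let ?lo2 = "Filt 13 (Param 0) (Param 0) nil (Param 1)" and ?si = "Filt 14 (Param 0) (Param 0) nil (Param 1)"
  let ?hd = "Filt 15 (Param 0) (Param 0) nil (Param 1)" and ?so = "Filt 18 (Param 0) (Param 0) nil (Param 1)"
  let ?lo3 = "Filt 16 (Param 0) (Param 0) nil (Param 1)"
  have lo2: "ev the_code ?env ?lo2 (enc (low_out 2 ws)) (L 4 + 6)"
    and si: "ev the_code ?env ?si (enc (single_in ws)) (L 4 + 6)"
    and hd: "ev the_code ?env ?hd (enc (high_deg ws)) (L 4 + 6)"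
    and so: "ev the_code ?env ?so (enc (spread_out ws)) (L 4 + 6)"
    and lo3: "ev the_code ?env ?lo3 (enc (low_out 3 ws)) (L 4 + 6)"
    using L_facts L_ge_1[of 3]
    by - (rule ev_weaken, (rule ev_Filt ev_rules filt_low_out2 filt_single_in filt_high_deg filt_spread_out
        filt_low_out3 len)+; simp)+
  have bool: "ev the_code ?env e (enc xs) B \<Longrightarrow> evb the_code ?env e (xs \<noteq> []) B" for e xs B
    by (rule evb_weaken[OF evb_ev]) (auto simp: enc_eq_NIL)
  have outs: "ev the_code ?env (Filt 3 (Param 0) (Car e) nil (Param 1)) (enc (outs ws (hd xs))) (L 2 + B + 10)"
    if "ev the_code ?env e (enc xs) B" "xs \<noteq> []" for e xs B
    by (rule ev_weaken, (rule ev_Filt ev_Car_enc ev_Param ev_Quote filt_hit[OF len] that)+) auto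
  have single: "ev the_code ?env (Call 7 [Car (Filt 6 (Param 0) (Car ?si) nil (Param 1)), Param 0, Param 1])
     (enc (let p = hd (ins ws (hd (single_in ws))) in if 5 \<le> length (nbs ws p) then [p] else [hd (ins ws p)]))
     (2 * L 4 + 30)" if "single_in ws \<noteq> []"
  proof -
    have "hd (single_in ws) \<in> set ws" using that hd_filter unfolding single_in_def by blast
    then have i: "ins ws (hd (single_in ws)) \<noteq> []" by (rule ins)
    then have "hd (ins ws (hd (single_in ws))) \<in> set ws" using hd_filter unfolding ins_def by blast
    then have i2: "ins ws (hd (ins ws (hd (single_in ws)))) \<noteq> []" by (rule ins)
    show ?thesis unfolding Let_def
      by (rule ev_weaken, (rule ev_Call evs_Cons evs_Nil ev_Car_enc ev_Filt ev_Param ev_Quote filt_in[OF len] si that i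
            fn_single_in[OF len i2])+) (use L_facts L_ge_1[of 2] L_ge_1[of 3] in auto)
  qed
  have "ev the_code ?env pivots_body (enc (pivots ws)) (40 * L 4)"
    unfolding pivots_body_def Let_def
  proof (rule ev_weaken)
    show "ev the_code ?env
     (If_exp ?lo2 (Filt 3 (Param 0) (Car ?lo2) nil (Param 1))
     (If_exp ?si (Call 7 [Car (Filt 6 (Param 0) (Car ?si) nil (Param 1)), Param 0, Param 1])
     (If_exp ?hd (Cons_exp (Car ?hd) nil)
     (If_exp ?so (Filt 3 (Param 0) (Car ?so) nil (Param 1))
     (If_exp ?lo3 (Filt 3 (Param 0) (Car ?lo3) nil (Param 1))
       (Filt 3 (Param 0) (Car (Param 0)) nil (Param 1)))))))
     (enc (pivots ws))
     (L 4 + 6 + max (L 2 + (L 4 + 6) + 10) (L 4 + 6 + max (2 * L 4 + 30) (L 4 + 6 + max (L 4 + 6 + 1 + 2)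
       (L 4 + 6 + max (L 2 + (L 4 + 6) + 10) (L 4 + 6 + max (L 2 + (L 4 + 6) + 10) (L 2 + 1 + 10) + 1) + 1) + 1) + 1) + 1)"
    proof (intro ev_If[OF bool[OF lo2]] ev_If[OF bool[OF si]] ev_If[OF bool[OF hd]] ev_If[OF bool[OF so]]
        ev_If[OF bool[OF lo3]])
      assume "low_out 2 ws \<noteq> []"
      then show "ev the_code ?env (Filt 3 (Param 0) (Car ?lo2) nil (Param 1)) (enc (pivots ws)) (L 2 + (L 4 + 6) + 10)"
        using outs[OF lo2] by (simp add: pivots_def)
    next
      assume "\<not> low_out 2 ws \<noteq> []" "single_in ws \<noteq> []"
      then show "ev the_code ?env (Call 7 [Car (Filt 6 (Param 0) (Car ?si) nil (Param 1)), Param 0, Param 1])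
          (enc (pivots ws)) (2 * L 4 + 30)"
        using single unfolding pivots_def by simp
    next
      assume "\<not> low_out 2 ws \<noteq> []" "\<not> single_in ws \<noteq> []" "high_deg ws \<noteq> []"
      then show "ev the_code ?env (Cons_exp (Car ?hd) nil) (enc (pivots ws)) (L 4 + 6 + 1 + 2)"
        using ev_single[OF ev_Car_enc[OF hd]] by (simp add: pivots_def)
    next
      assume "\<not> low_out 2 ws \<noteq> []" "\<not> single_in ws \<noteq> []" "\<not> high_deg ws \<noteq> []" "spread_out ws \<noteq> []"
      then show "ev the_code ?env (Filt 3 (Param 0) (Car ?so) nil (Param 1)) (enc (pivots ws)) (L 2 + (L 4 + 6) + 10)"
        using outs[OF so] by (simp add: pivots_def)
    next
      assume "\<not> low_out 2 ws \<noteq> []" "\<not> single_in ws \<noteq> []" "\<not> high_deg ws \<noteq> []" "\<not> spread_out ws \<noteq> []"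
        "low_out 3 ws \<noteq> []"
      then show "ev the_code ?env (Filt 3 (Param 0) (Car ?lo3) nil (Param 1)) (enc (pivots ws)) (L 2 + (L 4 + 6) + 10)"
        using outs[OF lo3] by (simp add: pivots_def)
    next
      assume "\<not> low_out 2 ws \<noteq> []" "\<not> single_in ws \<noteq> []" "\<not> high_deg ws \<noteq> []" "\<not> spread_out ws \<noteq> []"
        "\<not> low_out 3 ws \<noteq> []"
      then show "ev the_code ?env (Filt 3 (Param 0) (Car (Param 0)) nil (Param 1)) (enc (pivots ws)) (L 2 + 1 + 10)"
        using outs[OF ev_Param(1) ne] by (simp add: pivots_def)
    qed
  qed (use L_facts L_ge_1[of 2] L_ge_1[of 3] in auto)
  then show ?thesis by (intro fnI, elim ev_weaken) (use L_facts L_ge_1[of 4] in auto)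
qed

definition insert_atom :: "nat option \<Rightarrow> nat list \<Rightarrow> nat list" where
  "insert_atom q xs = (case q of None \<Rightarrow> xs | Some x \<Rightarrow> if x \<in> set xs then xs else x # xs)"

lemma set_insert_atom: "set (insert_atom q xs) = set_option q \<union> set xs"
  and distinct_insert_atom: "distinct xs \<Longrightarrow> distinct (insert_atom q xs)"
  by (auto simp: insert_atom_def split: option.splits)

lemma fn_insert:
  assumes "length xs \<le> N"
  shows "fn the_code 4 [enc_opt q, enc xs] (enc (insert_atom q xs)) (2 * L 1)"
proof -
  let ?env = "[enc_opt q, enc xs]"
  have "ev the_code ?env insert_body (enc (insert_atom q xs)) (1 + max (L 1 + 6 + max 1 3 + 1) 1 + 1)"
    unfolding insert_body_def
  proof (rule ev_If[OF evb_ev[OF ev_Param(1)]])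
    assume "enc_opt q \<noteq> NIL"
    then obtain x where q: "q = Some x" by (cases q) auto
    have c: "evb the_code ?env (Filt 0 (Param 1) (Param 0) nil nil) (x \<in> set xs) (L 1 + 6)"
      unfolding q enc_opt.simps
      by (rule evb_weaken, (rule evb_Filt ev_Param ev_Quote filt_mem[OF assms])+) auto
    show "ev the_code ?env (If_exp (Filt 0 (Param 1) (Param 0) nil nil) (Param 1) (Cons_exp (Param 0) (Param 1)))
       (enc (insert_atom q xs)) (L 1 + 6 + max 1 3 + 1)"
    proof (rule ev_If[OF c])
      assume "x \<in> set xs"
      then show "ev the_code ?env (Param 1) (enc (insert_atom q xs)) 1"
        using ev_Param(2)[of the_code "enc_opt q" "enc xs" "[]"] by (simp add: q insert_atom_def)
    next
      assume "x \<notin> set xs"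
      then show "ev the_code ?env (Cons_exp (Param 0) (Param 1)) (enc (insert_atom q xs)) 3"
        using ev_Cons[OF ev_Param(1) ev_Param(2), of the_code "enc_opt q" "enc xs" "[]"]
        by (simp add: q insert_atom_def enc_def)
    qed
  next
    assume "\<not> enc_opt q \<noteq> NIL"
    then have q: "q = None" by (cases q) auto
    show "ev the_code ?env (Param 1) (enc (insert_atom q xs)) 1"
        using ev_Param(2)[of the_code "enc_opt q" "enc xs" "[]"] by (simp add: q insert_atom_def)
  qed
  then show ?thesis by (intro fnI, elim ev_weaken) (use L_facts in auto)
qed

text \<open>Each clause takes two insertions of cost \<open>2 * L 1\<close>; a fifth
  \<open>L 1\<close> pays for the rest.\<close>

lemma fn_atoms:
  assumes "set ds \<subseteq> set cs" "distinct xs" "set xs \<subseteq> At"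
  shows "\<exists>ys. distinct ys \<and> set ys = set xs \<union> fst ` set ds \<union> {q. \<exists>p. (p, Some q) \<in> set ds}
    \<and> fn the_code 3 [slist (map enc_clause ds), enc xs] (enc ys) (5 * L 1 * (real (length ds) + 1))"
  using assms
proof (induction ds arbitrary: xs)
  case Nil
  have "ev the_code [slist (map enc_clause []), enc xs] atoms_body (enc xs) (1 + max 0 1 + 1)"
    unfolding atoms_body_def
    by (rule ev_If[OF evb_ev[OF ev_Param(1)]]) (use ev_Param(2) in auto)
  then have "fn the_code 3 [slist (map enc_clause []), enc xs] (enc xs) (5 * L 1 * (real (length []) + 1))"
    by (intro fnI, elim ev_weaken) (use L_facts in auto)
  then show ?case using Nil by auto
next
  case (Cons d ds)
  define x1 where "x1 = insert_atom (Some (fst d)) xs"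
  define x2 where "x2 = insert_atom (snd d) x1"
  have d: "d \<in> set cs" using Cons.prems by simp
  have dAt: "insert (fst d) (set_option (snd d)) \<subseteq> At"
  proof -
    have "q \<in> At" if "snd d = Some q" for q using d that unfolding At_def by (metis (mono_tags) UnCI mem_Collect_eq prod.collapse)
    then show ?thesis using d by (auto simp: At_def)
  qed
  have s1: "set x1 = insert (fst d) (set xs)" by (auto simp: x1_def set_insert_atom)
  have s2: "set x2 = set_option (snd d) \<union> insert (fst d) (set xs)" by (auto simp: x2_def set_insert_atom s1)
  have d1: "distinct x1" "distinct x2" using Cons.prems(2) by (simp_all add: x1_def x2_def distinct_insert_atom)
  have sub: "set x1 \<subseteq> At" "set x2 \<subseteq> At" using s1 s2 dAt Cons.prems(3) by auto
  obtain ys where ys: "distinct ys" "set ys = set x2 \<union> fst ` set ds \<union> {q. \<exists>p. (p, Some q) \<in> set ds}"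
    "fn the_code 3 [slist (map enc_clause ds), enc x2] (enc ys) (5 * L 1 * (real (length ds) + 1))"
    using Cons.IH[OF _ d1(2) sub(2)] Cons.prems(1) by auto
  let ?env = "[slist (map enc_clause (d # ds)), enc xs]"
  have f1: "fn the_code 4 [car (car (slist (map enc_clause (d # ds)))), enc xs] (enc x1) (2 * L 1)"
    using fn_insert[of xs "Some (fst d)"] length_le_N[OF Cons.prems(2,3)] by (simp add: car_enc_clause x1_def)
  have f2: "fn the_code 4 [cdr (car (cdr (car (slist (map enc_clause (d # ds)))))), enc x1] (enc x2) (2 * L 1)"
    using fn_insert[of x1 "snd d"] length_le_N[OF d1(1) sub(1)] by (simp add: cdr_enc_clause x2_def)
  have f3: "fn the_code 3 [cdr (slist (map enc_clause (d # ds))), enc x2] (enc ys) (5 * L 1 * (real (length ds) + 1))"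
    using ys(3) by simp
  have "ev the_code ?env (Call 3 [Cdr (Param 0), Call 4 [Cdr (Car (Cdr (Car (Param 0)))), Call 4 [Car (Car (Param 0)), Param 1]]])
    (enc ys) (5 * L 1 * (real (length ds) + 1) + 4 * L 1 + 20)"
    by (rule ev_weaken, (rule ev_rules f1 f2 f3)+) auto
  then have "ev the_code ?env atoms_body (enc ys) (1 + max (5 * L 1 * (real (length ds) + 1) + 4 * L 1 + 20) 0 + 1)"
    unfolding atoms_body_def by (intro ev_If[OF evb_ev[OF ev_Param(1)]]) auto
  then have "fn the_code 3 ?env (enc ys) (5 * L 1 * (real (length (d # ds)) + 1))"
  proof (intro fnI, elim ev_weaken)
    have "0 \<le> 5 * L 1 * (real (length ds) + 1)" using L_facts by (intro mult_nonneg_nonneg) auto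
    moreover have "5 * L 1 * (real (length (d # ds)) + 1) = 5 * L 1 * (real (length ds) + 1) + 5 * L 1"
      by (simp add: algebra_simps)
    ultimately show "1 + max (5 * L 1 * (real (length ds) + 1) + 4 * L 1 + 20) 0 + 1 \<le> 5 * L 1 * (real (length (d # ds)) + 1)"
      using L_facts by linarith
  qed simp
  moreover have "set ys = set xs \<union> fst ` set (d # ds) \<union> {q. \<exists>p. (p, Some q) \<in> set (d # ds)}"
    using ys(2) s2 by (cases d) auto
  ultimately show ?case using ys(1) by blast
qed

section \<open>Enumerating the kernels of a state\<close>

definition complement :: "nat list \<Rightarrow> nat set \<Rightarrow> sexp" where
  "complement as X = enc (filter (\<lambda>a. a \<notin> X) as)"

text \<open>Quantifying over \<open>acc\<close> lets the result of one call be the accumulator of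
  the next. The bound does not depend on \<open>acc\<close>, of which only a pointer is passed
  on.\<close>

definition enumerates :: "nat list \<Rightarrow> nat \<Rightarrow> sexp list \<Rightarrow> nat set \<Rightarrow> nat set \<Rightarrow> real \<Rightarrow> bool" where
  "enumerates as f args K U B \<longleftrightarrow> (\<forall>acc. \<exists>Xs. distinct Xs \<and> set Xs = kernels K U \<and>
     fn the_code f (args @ [enc as, G, slist acc]) (slist (map (complement as) Xs @ acc)) B)"

abbreviation "solves as ks us \<equiv> enumerates as 8 [enc ks, enc us] (set ks) (set us)"
abbreviation "propagates as ts ks us \<equiv> enumerates as 9 [enc ts, enc ks, enc us] (set ks) (set us)"
abbreviation "selects as z ks us \<equiv> enumerates as 10 [Sym z, enc ks, enc us] (insert z (set ks)) (set us - nbh z)"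
abbreviation "branches as ps ks us \<equiv> enumerates as 11 [enc ps, enc ks, enc us] (set ks) (set us)"

definition state :: "nat list \<Rightarrow> nat list \<Rightarrow> bool" where
  "state ks us \<longleftrightarrow> distinct ks \<and> distinct us \<and> set ks \<subseteq> At \<and> valid (set ks) (set us)"

text \<open>The summand 1 pays for a failing state, whose weight is 0. Each level of the recursion
  decreases \<open>n\<close>, and a branching does not increase the total weight, which explains the
  product \<open>n * w\<close>. The factor 6 covers the constant parts of up to five children and
  the work of the node itself.\<close>

definition bound :: "nat \<Rightarrow> real \<Rightarrow> real" where
  "bound n w = L 6 * (1 + 6 * real n * w)"

lemma bound_mono: "n \<le> n' \<Longrightarrow> 0 \<le> w \<Longrightarrow> w \<le> w' \<Longrightarrow> bound n w \<le> bound n' w'"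
  unfolding bound_def using L_ge_1[of 6] by (intro mult_left_mono add_left_mono mult_mono) auto

lemma T_At: "T \<subseteq> At" by (auto simp: T_def)

lemma state_length: "state ks us \<Longrightarrow> length ks \<le> N \<and> length us \<le> N"
  using T_At length_le_N unfolding state_def valid_def by (meson order_trans)

lemma state_select:
  assumes "state ks us" "z \<in> set us"
  shows "state (z # ks) (filter (\<lambda>x. x \<notin> nbh z) us)"
proof -
  have "{x \<in> set us. x \<notin> nbh z} = set us - nbh z" by auto
  moreover have "z \<notin> set ks" using assms by (auto simp: state_def valid_def nbh_def)
  ultimately show ?thesis
    using assms valid_select[of "set ks" "set us" z] T_At by (auto simp: state_def valid_def)
qed

lemma state_reject: "state ks us \<Longrightarrow> state ks (filter (\<lambda>x. x \<noteq> z) us)"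
  using valid_subset[of "set ks" "set us" "set us - {z}"]
  by (auto simp: state_def set_diff_eq)

lemma selects:
  assumes "state ks us" "z \<in> set us"
    and "solves as (z # ks) (filter (\<lambda>x. x \<notin> nbh z) us) B"
  shows "selects as z ks us (B + L 2 + 20)"
  unfolding enumerates_def
proof
  fix acc
  have "set (filter (\<lambda>x. x \<notin> nbh z) us) = set us - nbh z" by auto
  then obtain Xs where Xs: "distinct Xs" "set Xs = kernels (insert z (set ks)) (set us - nbh z)"
    "fn the_code 8 ([Cell (Sym z) (enc ks), enc (filter (\<lambda>x. x \<notin> nbh z) us)] @ [enc as, G, slist acc])
       (slist (map (complement as) Xs @ acc)) B"
    using assms(3)[unfolded enumerates_def, rule_format, of acc] by (auto simp: enc_Cons)
  have len: "length us \<le> N" using state_length[OF assms(1)] by simp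
  have "ev the_code [Sym z, enc ks, enc us, enc as, G, slist acc] select_body
     (slist (map (complement as) Xs @ acc)) (B + L 2 + 20)"
    unfolding select_body_def
    by (rule ev_weaken, (rule ev_Call evs_Cons evs_Nil ev_Cons ev_Param ev_Filt ev_Quote filt_free[OF len]
          Xs(3)[simplified append_Cons append_Nil])+) auto
  then show "\<exists>Xs. distinct Xs \<and> set Xs = kernels (insert z (set ks)) (set us - nbh z) \<and>
     fn the_code 10 ([Sym z, enc ks, enc us] @ [enc as, G, slist acc]) (slist (map (complement as) Xs @ acc)) (B + L 2 + 20)"
    using Xs(1,2) by (auto intro: fnI)
qed

text \<open>\<open>n\<close> is the number of undecided atoms at the node that branches. All
  children have fewer, hence the factor \<open>n - 1\<close>; for the child that rejects all pivots
  this holds because at least one pivot has been removed, as the last assumption records.\<close>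

lemma branches:
  assumes IH: "\<And>ks' us'. state ks' us' \<Longrightarrow> length us' < n \<Longrightarrow>
      solves as ks' us' (bound (length us') (weight (set ks') (set us')))"
    and "state ks us" "distinct ps" "set ps \<subseteq> set us" "length us \<le> n" "ps = [] \<Longrightarrow> length us < n"
  shows "branches as ps ks us
    ((2 * L 2 + L 6) * (real (length ps) + 1) + 6 * L 6 * (real n - 1) * branch_weight (set ks) (set us) ps)"
  using assms(2-)
proof (induction ps arbitrary: us)
  case Nil
  have "bound (length us) (weight (set ks) (set us)) \<le> L 6 * (1 + 6 * (real n - 1) * weight (set ks) (set us))"
    unfolding bound_def
    using L_ge_1[of 6] weight_nonneg Nil.prems(5)
    by (intro mult_left_mono add_left_mono mult_right_mono) auto
  then have B: "bound (length us) (weight (set ks) (set us)) + 2 * L 2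
    \<le> (2 * L 2 + L 6) * (real (length []) + 1) + 6 * L 6 * (real n - 1) * branch_weight (set ks) (set us) []"
    by (simp add: algebra_simps)
  show ?case
    unfolding enumerates_def
  proof
    fix acc
    obtain Xs where Xs: "distinct Xs" "set Xs = kernels (set ks) (set us)"
      "fn the_code 8 [enc ks, enc us, enc as, G, slist acc]
       (slist (map (complement as) Xs @ acc)) (bound (length us) (weight (set ks) (set us)))"
      using IH[OF Nil.prems(1) Nil.prems(5)] unfolding enumerates_def by (auto dest: spec[of _ acc])
    let ?env = "[enc [], enc ks, enc us, enc as, G, slist acc]"
    have *: "ev the_code ?env (Call 8 [Param 1, Param 2, Param 3, Param 4, Param 5])
       (slist (map (complement as) Xs @ acc)) (bound (length us) (weight (set ks) (set us)) + 6)"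
      by (rule ev_weaken, (rule ev_rules Xs(3))+) auto
    have "ev the_code ?env branch_body (slist (map (complement as) Xs @ acc))
      (1 + max 0 (bound (length us) (weight (set ks) (set us)) + 6) + 1)"
      unfolding branch_body_def
      by (rule ev_If[OF evb_ev[OF ev_Param(1)]]) (use * in \<open>auto simp: enc_def\<close>)
    moreover have "0 \<le> bound (length us) (weight (set ks) (set us))"
      unfolding bound_def using L_ge_1[of 6] weight_nonneg by simp
    ultimately have "fn the_code 11 ?env (slist (map (complement as) Xs @ acc))
       (bound (length us) (weight (set ks) (set us)) + 2 * L 2)"
      by (intro fnI, elim ev_weaken) (use L_facts in auto)
    then show "\<exists>Xs. distinct Xs \<and> set Xs = kernels (set ks) (set us) \<and>
       fn the_code 11 ([enc [], enc ks, enc us] @ [enc as, G, slist acc]) (slist (map (complement as) Xs @ acc))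
        ((2 * L 2 + L 6) * (real (length []) + 1) + 6 * L 6 * (real n - 1) * branch_weight (set ks) (set us) [])"
      using Xs(1,2) B fn_weaken by fastforce
  qed
next
  case (Cons p ps)
  let ?vs = "filter (\<lambda>x. x \<noteq> p) us" and ?xs = "filter (\<lambda>x. x \<notin> nbh p) us"
  have p: "p \<in> set us" using Cons.prems by simp
  have vs: "set ?vs = set us - {p}" and xs: "set ?xs = set us - nbh p" by auto
  have v: "valid (set ks) (set us)" using Cons.prems(1) by (simp add: state_def)
  have len: "length us \<le> N" using state_length[OF Cons.prems(1)] by simp
  have l1: "length ?vs < length us" using length_filter_less[OF p] by simp
  have l2: "length ?xs < length us" using length_filter_less[OF p, of "\<lambda>x. x \<notin> nbh p"] nbh_self by simp
  let ?W1 = "weight (insert p (set ks)) (set us - nbh p)"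
  let ?B1 = "bound (length ?xs) ?W1"
  let ?B2 = "(2 * L 2 + L 6) * (real (length ps) + 1) + 6 * L 6 * (real n - 1) * branch_weight (set ks) (set us - {p}) ps"
  have sel: "selects as p ks us (?B1 + L 2 + 20)"
    using IH[OF state_select[OF Cons.prems(1) p]] l2 Cons.prems(4) xs
    by (intro selects[OF Cons.prems(1) p]) auto
  have rec: "branches as ps ks ?vs ?B2"
    unfolding vs[symmetric]
    by (rule Cons.IH) (use Cons.prems state_reject l1 in auto)
  have W1: "0 \<le> ?W1" by (rule weight_nonneg)
  have "?B1 \<le> L 6 * (1 + 6 * (real n - 1) * ?W1)"
    unfolding bound_def
    using L_ge_1[of 6] W1 l2 Cons.prems(4)
    by (intro mult_left_mono add_left_mono mult_right_mono) auto
  also have "\<dots> = L 6 + 6 * L 6 * (real n - 1) * ?W1" by (simp add: algebra_simps)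
  finally have B: "?B1 + ?B2 + 2 * L 2
    \<le> (2 * L 2 + L 6) * (real (length (p # ps)) + 1)
      + 6 * L 6 * (real n - 1) * branch_weight (set ks) (set us) (p # ps)"
    by (simp add: algebra_simps)
  show ?case
    unfolding enumerates_def
  proof
    fix acc
    obtain Xs where Xs: "distinct Xs" "set Xs = kernels (insert p (set ks)) (set us - nbh p)"
      "fn the_code 10 [Sym p, enc ks, enc us, enc as, G, slist acc]
         (slist (map (complement as) Xs @ acc)) (?B1 + L 2 + 20)"
      using sel unfolding enumerates_def by (auto dest: spec[of _ acc])
    obtain Ys where Ys: "distinct Ys" "set Ys = kernels (set ks) (set us - {p})"
      "fn the_code 11 [enc ps, enc ks, enc ?vs, enc as, G, slist (map (complement as) Xs @ acc)]
         (slist (map (complement as) Ys @ map (complement as) Xs @ acc)) ?B2"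
      using rec unfolding enumerates_def vs by (auto dest: spec[of _ "map (complement as) Xs @ acc"])
    let ?env = "[enc (p # ps), enc ks, enc us, enc as, G, slist acc]"
    have hd: "ev the_code ?env (Car (Param 0)) (Sym p) 2"
      by (rule ev_weaken, (rule ev_rules)+) (auto simp: enc_def)
    have tl: "ev the_code ?env (Cdr (Param 0)) (enc ps) 2"
      by (rule ev_weaken, (rule ev_rules)+) (auto simp: enc_def)
    have *: "ev the_code ?env (Call 11 [Cdr (Param 0), Param 1, Filt 7 (Param 2) (Car (Param 0)) nil nil, Param 3, Param 4,
         Call 10 [Car (Param 0), Param 1, Param 2, Param 3, Param 4, Param 5]])
       (slist (map (complement as) (Ys @ Xs) @ acc)) (?B1 + ?B2 + L 1 + L 2 + 60)"
      by (rule ev_weaken, (rule ev_Call evs_Cons evs_Nil hd tl ev_Param ev_Filt ev_Quote filt_neq[OF len] Xs(3) Ys(3))+) auto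
    have "ev the_code ?env branch_body (slist (map (complement as) (Ys @ Xs) @ acc))
      (1 + max (?B1 + ?B2 + L 1 + L 2 + 60) 0 + 1)"
      unfolding branch_body_def
      by (rule ev_If[OF evb_ev[OF ev_Param(1)]]) (use * in \<open>auto simp: enc_def\<close>)
    moreover have "0 \<le> ?B1 + ?B2 + L 1 + L 2 + 60"
      using * by (rule ev_nonneg)
    ultimately have "fn the_code 11 ?env (slist (map (complement as) (Ys @ Xs) @ acc)) (?B1 + ?B2 + 2 * L 2)"
      by (intro fnI, elim ev_weaken) (use L_facts in auto)
    moreover have "distinct (Ys @ Xs)" "set (Ys @ Xs) = kernels (set ks) (set us)"
      using kernels_branch[OF v p] Xs Ys by auto
    ultimately show "\<exists>Xs. distinct Xs \<and> set Xs = kernels (set ks) (set us) \<and>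
       fn the_code 11 ([enc (p # ps), enc ks, enc us] @ [enc as, G, slist acc]) (slist (map (complement as) Xs @ acc))
        ((2 * L 2 + L 6) * (real (length (p # ps)) + 1)
          + 6 * L 6 * (real n - 1) * branch_weight (set ks) (set us) (p # ps))"
      using fn_weaken[OF _ refl B] by (intro exI[of _ "Ys @ Xs"]) simp
  qed
qed

end

section \<open>Recursion over the states\<close>

context lisp_program
begin

lemma outs_eq_Nil: "outs xs v = [] \<longleftrightarrow> out_nbh v \<inter> set xs = {}"
  by (auto simp: outs_def out_nbh_def filter_empty_conv)

lemma set_outs: "set (outs xs v) = out_nbh v \<inter> set xs"
  by (auto simp: outs_def out_nbh_def)

lemma mem_T: "v \<in> T \<longleftrightarrow> v \<in> At \<and> \<not> fact v"
  by (simp add: T_def)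

lemma set_unsat:
  "set as = At \<Longrightarrow> set (filter (\<lambda>x. \<not> fact x \<and> outs ks x = []) as) = {v. unsat (set ks) v}"
  by (auto simp: outs_eq_Nil unsat_def mem_T)

text \<open>Passing from \<open>n - 1\<close> to \<open>n\<close> releases
  \<open>6 * L 6 * w\<close>; since a state that does not fail has weight at least 1, this pays for
  a node.\<close>

lemma bound_Suc:
  assumes "0 < n" "1 \<le> w"
  shows "L 6 * (1 + 6 * (real n - 1) * w) + 6 * L 6 \<le> bound n w"
proof -
  have "6 * L 6 * 1 \<le> 6 * L 6 * w" using assms L_ge_1[of 6] by (intro mult_left_mono) auto
  then show ?thesis by (simp add: bound_def algebra_simps)
qed

text \<open>The amount \<open>L 4\<close> is held back for the caller, which still has to pay for
  its two computations of the list of unmet atoms.\<close>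

lemma propagates:
  assumes IH: "\<And>ks' us'. state ks' us' \<Longrightarrow> length us' < length us \<Longrightarrow>
      solves as ks' us' (bound (length us') (weight (set ks') (set us')))"
    and st: "state ks us" and as: "distinct as" "set as = At"
    and ts: "ts = filter (\<lambda>x. \<not> fact x \<and> outs ks x = []) as" "ts \<noteq> []"
  shows "propagates as ts ks us (bound (length us) (weight (set ks) (set us)) - L 4)"
  unfolding enumerates_def
proof
  fix acc
  let ?env = "[enc ts, enc ks, enc us, enc as, G, slist acc]" and ?w = "weight (set ks) (set us)"
  have len: "length us \<le> N" using state_length[OF st] by simp
  have lt: "length ts \<le> N" using length_le_N[OF as(1)] as(2) ts(1) by (metis length_filter_le order_refl order_trans)
  have v: "valid (set ks) (set us)" and d: "distinct us" using st by (auto simp: state_def)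
  have set_ts: "v \<in> set ts \<longleftrightarrow> unsat (set ks) v" for v using set_unsat[OF as(2), of ks] ts(1) by auto
  let ?fails = "filter (\<lambda>x. outs us x = []) ts" and ?units = "filter (\<lambda>x. length (outs us x) \<le> 1) ts"
  have c1: "evb the_code ?env (Filt 9 (Param 0) (Param 2) nil (Param 4)) (?fails \<noteq> []) (L 3 + 10)"
    by (rule evb_weaken, (rule evb_Filt ev_Param ev_Quote fnb_enc filt_unhit[OF lt len])+) auto
  have units: "ev the_code ?env (Filt 10 (Param 0) (Param 2) nil (Param 4)) (enc ?units) (L 3 + 10)"
    by (rule ev_weaken, (rule ev_Filt ev_Param ev_Quote filt_unit[OF lt len])+) auto
  have c2: "evb the_code ?env (Filt 10 (Param 0) (Param 2) nil (Param 4)) (?units \<noteq> []) (L 3 + 10)"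
    by (rule evb_weaken[OF evb_ev[OF units]]) (auto simp: enc_eq_NIL)
  have failing: "failing (set ks) (set us) \<longleftrightarrow> ?fails \<noteq> []"
    using set_ts by (auto simp: failing_def outs_eq_Nil filter_empty_conv)
  let ?goal = "\<lambda>Xs B. distinct Xs \<and> set Xs = kernels (set ks) (set us) \<and>
     ev the_code ?env propagate_body (slist (map (complement as) Xs @ acc)) B"
  have L: "1 \<le> L 2" "1 \<le> L 3" "1 \<le> L 4" "1 \<le> L 5" "1 \<le> L 6" by (rule L_ge_1)+
  have "\<exists>Xs. ?goal Xs (bound (length us) ?w - L 4)"
  proof (cases "failing (set ks) (set us)")
    case True
    have "ev the_code ?env propagate_body (slist acc) (L 3 + 10 + max 1 0 + 1)"
      unfolding propagate_body_def
      by (rule ev_If[OF c1]) (use True failing in \<open>auto intro: ev_Param\<close>)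
    then have "ev the_code ?env propagate_body (slist acc) (bound (length us) ?w - L 4)"
      using L_facts L weight_failing[OF True] by (elim ev_weaken) (auto simp: bound_def)
    then show ?thesis using kernels_failing[OF True] by (intro exI[of _ "[]"]) simp
  next
    case nf: False
    then have w1: "1 \<le> ?w" by (rule weight_ge_1)
    show ?thesis
    proof (cases "?units = []")
      case False
      define t where "t = hd ?units"
      have t: "t \<in> set ts" "length (outs us t) \<le> 1" using hd_filter[OF False] by (auto simp: t_def)
      moreover have "outs us t \<noteq> []" using t(1) nf failing by (auto simp: filter_empty_conv)
      ultimately obtain z where z: "outs us t = [z]" by (cases "outs us t") auto
      then have zf: "z \<in> forced (set ks) (set us)" using set_ts t(1) set_outs[of us t] by (auto simp: forced_def)
      then have zU: "z \<in> set us" using kernels_forced(2)[OF v] by blast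
      let ?xs = "filter (\<lambda>x. x \<notin> nbh z) us"
      have xs: "set ?xs = set us - nbh z" by auto
      have l: "length ?xs < length us" using length_filter_less[OF zU, of "\<lambda>x. x \<notin> nbh z"] nbh_self by simp
      then have pos: "0 < length us" by linarith
      let ?B = "bound (length ?xs) (weight (insert z (set ks)) (set us - nbh z))"
      have "selects as z ks us (?B + L 2 + 20)"
        using IH[OF state_select[OF st zU] l] xs by (intro selects[OF st zU]) simp
      then obtain Xs where Xs: "distinct Xs" "set Xs = kernels (insert z (set ks)) (set us - nbh z)"
        "fn the_code 10 [Sym z, enc ks, enc us, enc as, G, slist acc]
           (slist (map (complement as) Xs @ acc)) (?B + L 2 + 20)"
        unfolding enumerates_def by (auto dest: spec[of _ acc])
      have tz: "ev the_code ?env (Car (Filt 3 (Param 2) (Car (Filt 10 (Param 0) (Param 2) nil (Param 4))) nil (Param 4)))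
          (Sym z) (L 2 + L 3 + 30)"
        by (rule ev_weaken, (rule ev_Car_enc ev_Filt ev_Param ev_Quote filt_hit[OF len] units False)+)
          (use z in \<open>auto simp: t_def\<close>)
      have *: "ev the_code ?env (Call 10 [Car (Filt 3 (Param 2) (Car (Filt 10 (Param 0) (Param 2) nil (Param 4))) nil (Param 4)),
           Param 1, Param 2, Param 3, Param 4, Param 5])
          (slist (map (complement as) Xs @ acc)) (?B + 2 * L 2 + L 3 + 60)"
        by (rule ev_weaken, (rule ev_Call evs_Cons evs_Nil tz ev_Param Xs(3))+) auto
      have "ev the_code ?env propagate_body (slist (map (complement as) Xs @ acc))
        (L 3 + 10 + max 0 (L 3 + 10 + max (?B + 2 * L 2 + L 3 + 60) 0 + 1) + 1)"
        unfolding propagate_body_def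
        by (rule ev_If[OF c1], use nf failing in simp, rule ev_If[OF c2]) (use * False in auto)
      moreover have "?B \<le> L 6 * (1 + 6 * (real (length us) - 1) * ?w)"
        unfolding bound_def
        using L l weight_nonneg weight_forced[OF _ zf] by (intro mult_left_mono add_left_mono mult_mono) auto
      moreover have "0 \<le> ?B + 2 * L 2 + L 3 + 60" using * by (rule ev_nonneg)
      ultimately have "ev the_code ?env propagate_body (slist (map (complement as) Xs @ acc))
         (bound (length us) ?w - L 4)"
        using bound_Suc[OF pos w1] L L_facts by (elim ev_weaken) auto
      then show ?thesis using Xs(1,2) kernels_forced(1)[OF v zf] by blast
    next
      case True
      have "forced (set ks) (set us) = {}"
      proof (rule ccontr)
        assume "forced (set ks) (set us) \<noteq> {}"
        then obtain z t where "unsat (set ks) t" "out_nbh t \<inter> set us = {z}" by (auto simp: forced_def)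
        moreover have "length (outs us t) = card (out_nbh t \<inter> set us)"
          using distinct_card[of "outs us t"] d set_outs by (simp add: outs_def)
        ultimately have "t \<in> set ?units" using set_ts[of t] by simp
        then show False unfolding True by simp
      qed
      then interpret branch_state E T "set ks" "set us" by (rule valid_branch_state[OF v nf])
      have "us \<noteq> []"
      proof
        assume "us = []"
        then have "?fails = ts" by (simp add: outs_def)
        then show False using ts(2) nf failing by simp
      qed
      then have ne: "set us \<noteq> {}" by simp
      obtain ws where ws: "distinct ws" "set ws = core (set us)" "fn the_code 5 [enc us, G] (enc ws) (L 4)"
        by (rule fn_core_L[OF d len])
      have W: "set ws = W" using ws(2) by (simp add: W_def)
      have lw: "length ws \<le> N"
        using W WU finW d ws(1) len by (metis card_mono distinct_card fin order_trans)
      have wne: "ws \<noteq> []" using W_nonempty[OF ne] W by auto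
      have wins: "ins ws v \<noteq> []" if "v \<in> set ws" for v
        using W_in[of v] that W by (auto simp: ins_def filter_empty_conv)
      note ps = pivots_spec[OF ne W ws(1)]
      have fp: "fn the_code 6 [enc ws, G] (enc (pivots ws)) (L 5)" by (rule fn_pivots[OF lw wne wins])
      let ?bw = "branch_weight (set ks) (set us) (pivots ws)"
      let ?B = "(2 * L 2 + L 6) * (real (length (pivots ws)) + 1) + 6 * L 6 * (real (length us) - 1) * ?bw"
      have "branches as (pivots ws) ks us ?B"
        using ps by (intro branches[OF IH] st) auto
      then obtain Xs where Xs: "distinct Xs" "set Xs = kernels (set ks) (set us)"
        "fn the_code 11 [enc (pivots ws), enc ks, enc us, enc as, G, slist acc]
           (slist (map (complement as) Xs @ acc)) ?B"
        unfolding enumerates_def by (auto dest: spec[of _ acc])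
      have *: "ev the_code ?env (Call 11 [Call 6 [Call 5 [Param 2, Param 4], Param 4],
           Param 1, Param 2, Param 3, Param 4, Param 5])
          (slist (map (complement as) Xs @ acc)) (?B + L 4 + L 5 + 60)"
        by (rule ev_weaken, (rule ev_Call evs_Cons evs_Nil ev_Param ws(3) fp Xs(3))+) auto
      have "ev the_code ?env propagate_body (slist (map (complement as) Xs @ acc))
        (L 3 + 10 + max 0 (L 3 + 10 + max 0 (?B + L 4 + L 5 + 60) + 1) + 1)"
        unfolding propagate_body_def
        by (rule ev_If[OF c1], use nf failing in simp, rule ev_If[OF c2]) (use * True in auto)
      \<comment> \<open>The 5 stands for at most four pivots and the final child; replacing
        \<open>?bw\<close> by \<open>?w\<close> is where the analysis of the branchings enters the
        running time.\<close>
      moreover have "?B \<le> (2 * L 2 + L 6) * 5 + 6 * L 6 * (real (length us) - 1) * ?w"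
        using ps L \<open>us \<noteq> []\<close> by (intro add_mono mult_left_mono) (auto simp: Suc_le_eq)
      moreover have "L 6 * (1 + 6 * (real (length us) - 1) * ?w) = L 6 + 6 * L 6 * (real (length us) - 1) * ?w"
        by (simp add: algebra_simps)
      moreover have "0 \<le> ?B + L 4 + L 5 + 60" using * by (rule ev_nonneg)
      ultimately have "ev the_code ?env propagate_body (slist (map (complement as) Xs @ acc))
         (bound (length us) ?w - L 4)"
        using bound_Suc[of "length us" ?w] w1 \<open>us \<noteq> []\<close> L L_facts by (elim ev_weaken) auto
      then show ?thesis using Xs(1,2) by blast
    qed
  qed
  then show "\<exists>Xs. distinct Xs \<and> set Xs = kernels (set ks) (set us) \<and>
     fn the_code 9 ([enc ts, enc ks, enc us] @ [enc as, G, slist acc]) (slist (map (complement as) Xs @ acc))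
       (bound (length us) ?w - L 4)"
    by (auto intro: fnI)
qed

lemma solves:
  assumes as: "distinct as" "set as = At" and "state ks us"
  shows "solves as ks us (bound (length us) (weight (set ks) (set us)))"
  using assms(3)
proof (induction "length us" arbitrary: ks us rule: less_induct)
  case less
  note st = less.prems
  have len: "length ks \<le> N" using state_length[OF st] by simp
  have la: "length as \<le> N" using length_le_N[OF as(1)] as(2) by simp
  have v: "valid (set ks) (set us)" using st by (auto simp: state_def)
  let ?ts = "filter (\<lambda>x. \<not> fact x \<and> outs ks x = []) as" and ?w = "weight (set ks) (set us)"
  have L: "1 \<le> L 2" "1 \<le> L 3" "1 \<le> L 4" "1 \<le> L 5" "1 \<le> L 6" by (rule L_ge_1)+
  show ?case
    unfolding enumerates_def
  proof
    fix acc
    let ?env = "[enc ks, enc us, enc as, G, slist acc]"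
    have ts: "ev the_code ?env (Filt 8 (Param 2) (Param 0) nil (Param 3)) (enc ?ts) (L 3 + 10)"
      by (rule ev_weaken, (rule ev_Filt ev_Param ev_Quote filt_unsat[OF la len])+) auto
    have c: "evb the_code ?env (Filt 8 (Param 2) (Param 0) nil (Param 3)) (?ts \<noteq> []) (L 3 + 10)"
      by (rule evb_weaken[OF evb_ev[OF ts]]) (auto simp: enc_eq_NIL)
    have "\<exists>Xs. distinct Xs \<and> set Xs = kernels (set ks) (set us) \<and>
      ev the_code ?env solve_body (slist (map (complement as) Xs @ acc)) (bound (length us) ?w)"
    proof (cases "?ts = []")
      case True
      then have "{v. unsat (set ks) v} = {}" using set_unsat[OF as(2), of ks] by (metis list.set(1))
      then have u: "\<not> unsat (set ks) x" for x by blast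
      have "ev the_code ?env (Cons_exp (Filt 2 (Param 2) (Param 0) nil nil) (Param 4))
        (slist (map (complement as) [set ks] @ acc)) (L 2 + 10)"
        by (rule ev_weaken, (rule ev_Cons ev_Filt ev_Param ev_Quote filt_notin[OF la len])+) (auto simp: complement_def)
      then have "ev the_code ?env solve_body (slist (map (complement as) [set ks] @ acc)) (L 3 + 10 + max 0 (L 2 + 10) + 1)"
        unfolding solve_body_def by (intro ev_If[OF c]) (use True in auto)
      then have "ev the_code ?env solve_body (slist (map (complement as) [set ks] @ acc)) (bound (length us) ?w)"
        using kernels_leaf(2)[OF v u] L L_facts by (elim ev_weaken) (auto simp: bound_def)
      then show ?thesis using kernels_leaf(1)[OF v u] by (intro exI[of _ "[set ks]"]) simp
    next
      case False
      have "propagates as ?ts ks us (bound (length us) ?w - L 4)"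
        by (rule propagates[OF less.hyps st as refl False])
      then obtain Xs where Xs: "distinct Xs" "set Xs = kernels (set ks) (set us)"
        "fn the_code 9 [enc ?ts, enc ks, enc us, enc as, G, slist acc]
           (slist (map (complement as) Xs @ acc)) (bound (length us) ?w - L 4)"
        unfolding enumerates_def by (auto dest: spec[of _ acc])
      have *: "ev the_code ?env
          (Call 9 [Filt 8 (Param 2) (Param 0) nil (Param 3), Param 0, Param 1, Param 2, Param 3, Param 4])
          (slist (map (complement as) Xs @ acc)) (bound (length us) ?w - L 4 + L 3 + 30)"
        by (rule ev_weaken, (rule ev_Call evs_Cons evs_Nil ts ev_Param Xs(3))+) auto
      then have "ev the_code ?env solve_body (slist (map (complement as) Xs @ acc))
         (L 3 + 10 + max (bound (length us) ?w - L 4 + L 3 + 30) 0 + 1)"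
        unfolding solve_body_def by (intro ev_If[OF c]) (use False in auto)
      moreover have "0 \<le> bound (length us) ?w - L 4 + L 3 + 30" using * by (rule ev_nonneg)
      ultimately have "ev the_code ?env solve_body (slist (map (complement as) Xs @ acc)) (bound (length us) ?w)"
        using L L_facts by (elim ev_weaken) auto
      then show ?thesis using Xs(1,2) by blast
    qed
    then show "\<exists>Xs. distinct Xs \<and> set Xs = kernels (set ks) (set us) \<and>
      fn the_code 8 ([enc ks, enc us] @ [enc as, G, slist acc]) (slist (map (complement as) Xs @ acc)) (bound (length us) ?w)"
      by (auto intro: fnI)
  qed
qed

text \<open>Facts belong to every stable model, and a kernel contains no loop, so neither may be
  selected. A loop that is not a fact remains in \<open>T\<close> and must be met by another
  atom.\<close>

definition candidates :: "nat set" where "candidates = {v \<in> T. \<not> E v v}"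

text \<open>The overhead of list processing is collected in \<open>L 6\<close>, the depth of the
  search in \<open>card At + 1\<close>.\<close>

lemma fn_main:
  obtains as Xs where "distinct as" "set as = At" "distinct Xs" "set Xs = kernels {} candidates"
    "fn the_code 0 [G] (slist (map (complement as) Xs)) (10 * L 6 * (real (card At) + 1) * lam ^ card At)"
proof -
  obtain as where as: "distinct as" "set as = At"
    "fn the_code 3 [G, NIL] (enc as) (5 * L 1 * (real (length cs) + 1))"
    using fn_atoms[of cs "[]"] by (auto simp: At_def G_def enc_def)
  have la: "length as \<le> N" using length_le_N[OF as(1)] as(2) by simp
  let ?us = "filter (\<lambda>x. \<not> fact x \<and> \<not> E x x) as"
  have us: "set ?us = candidates" using as(2) by (auto simp: candidates_def mem_T)
  have st: "state [] ?us" using as finite_At by (auto simp: state_def valid_def mem_T)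
  let ?B = "bound (length ?us) (weight (set []) (set ?us))"
  obtain Xs where Xs: "distinct Xs" "set Xs = kernels {} candidates"
    "fn the_code 8 [NIL, enc ?us, enc as, G, NIL] (slist (map (complement as) Xs)) ?B"
  proof -
    obtain Xs where "distinct Xs" "set Xs = kernels (set []) (set ?us)"
      "fn the_code 8 ([enc [], enc ?us] @ [enc as, G, slist []]) (slist (map (complement as) Xs @ [])) ?B"
      using solves[OF as(1,2) st] unfolding enumerates_def by blast
    then show thesis using us by (intro that) (auto simp: enc_def)
  qed
  have "ev the_code [enc as, G] init_body (slist (map (complement as) Xs)) (?B + L 2 + 30)"
    unfolding init_body_def
    by (rule ev_weaken, (rule ev_Call evs_Cons evs_Nil ev_Filt ev_Quote ev_Param filt_init[OF la] Xs(3))+) auto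
  then have init: "fn the_code 12 [enc as, G] (slist (map (complement as) Xs)) (?B + L 2 + 30)"
    by (rule fnI)
  have main: "ev the_code [G] main_body (slist (map (complement as) Xs))
    (5 * L 1 * (real (length cs) + 1) + ?B + L 2 + 50)"
    unfolding main_body_def
    by (rule ev_weaken, (rule ev_rules as(3) init)+) auto
  have L: "1 \<le> L 2" "1 \<le> L 3" "1 \<le> L 4" "1 \<le> L 5" "1 \<le> L 6" by (rule L_ge_1)+
  have atoms: "5 * L 1 * (real (length cs) + 1) \<le> L 2"
  proof -
    have "5 * L 1 * (real (length cs) + 1) \<le> (1000 * L 1) * (real N + 1)"
      using length_cs L_ge_1[of 1] by (intro mult_mono) auto
    also have "\<dots> = L 2" using L_Suc[of 1] by (simp add: numeral_2_eq_2)
    finally show ?thesis .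
  qed
  have card: "card (set ?us) \<le> card At" using finite_At as(2) by (intro card_mono) auto
  have wt: "weight (set []) (set ?us) \<le> lam ^ card At"
  proof -
    have "card (core (star (set []) (set ?us))) \<le> card (set ?us)"
      by (rule card_mono[OF _ order_trans[OF core_subset star_subset]]) simp
    then show ?thesis using card lam_ge_1 by (auto simp: weight_def intro: power_increasing)
  qed
  have lam1: "1 \<le> lam ^ card At" using lam_ge_1 by (rule one_le_power)
  have "?B \<le> bound (card At) (lam ^ card At)"
    using distinct_card[of ?us] as(1) card wt by (intro bound_mono weight_nonneg) auto
  also have "bound (card At) (lam ^ card At) \<le> L 6 * (7 * ((real (card At) + 1) * lam ^ card At))"
    unfolding bound_def
  proof (intro mult_left_mono)
    have "1 + 6 * real (card At) * lam ^ card At \<le> lam ^ card At + 6 * (real (card At) * lam ^ card At)"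
      using lam1 by simp
    also have "\<dots> \<le> 7 * ((real (card At) + 1) * lam ^ card At)"
      using lam1 by (simp add: algebra_simps)
    finally show "1 + 6 * real (card At) * lam ^ card At \<le> 7 * ((real (card At) + 1) * lam ^ card At)" .
  qed (use L in auto)
  finally have B: "?B \<le> 7 * (L 6 * ((real (card At) + 1) * lam ^ card At))" by simp
  define Z where "Z = L 6 * ((real (card At) + 1) * lam ^ card At)"
  have "L 6 * (1 * 1) \<le> Z"
    unfolding Z_def using L lam1 by (intro mult_left_mono mult_mono) auto
  moreover have "10 * L 6 * (real (card At) + 1) * lam ^ card At = 10 * Z" by (simp add: Z_def mult.assoc)
  ultimately have "5 * L 1 * (real (length cs) + 1) + ?B + L 2 + 50 \<le> 10 * L 6 * (real (card At) + 1) * lam ^ card At"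
    using B[folded Z_def] atoms L L_facts by linarith
  then have "fn the_code 0 [G] (slist (map (complement as) Xs)) (10 * L 6 * (real (card At) + 1) * lam ^ card At)"
    using main by (intro fnI) (rule ev_weaken[OF _ refl])
  then show ?thesis using that as(1,2) Xs(1,2) by blast
qed

end

section \<open>Stable models as kernels\<close>

text \<open>Splitting \<open>x\<close> into two factors \<open>sqrt x\<close> lets one half of the
  decay absorb a linear factor by Bernoulli's inequality, and leaves the other half to the induction
  on \<open>k\<close>.\<close>

lemma poly_times_geometric_bounded:
  fixes x :: real
  assumes "0 < x" "x < 1"
  shows "\<exists>C. \<forall>n. real (n + 1) ^ k * x ^ n \<le> C"
  using assms
proof (induction k arbitrary: x)
  case 0
  then show ?case by (intro exI[of _ 1]) (simp add: power_le_one)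
next
  case (Suc k)
  define y where "y = sqrt x"
  have y: "0 < y" "y < 1" "x = y * y" using Suc.prems by (auto simp: y_def)
  obtain C where C: "\<And>n. real (n + 1) ^ k * y ^ n \<le> C" using Suc.IH[OF y(1,2)] by blast
  \<comment> \<open>The second entry matches Bernoulli's inequality for \<open>1 / y\<close>; the
    first bounds by 1 the summand \<open>d\<close> that comes from \<open>n + 1\<close>.\<close>
  define d where "d = min 1 (1 / y - 1)"
  have d: "0 < d" using y by (simp add: d_def)
  have "real (n + 1) ^ Suc k * x ^ n \<le> C * (1 / d)" for n
  proof -
    have "d * real (n + 1) = d + real n * d" by (simp add: algebra_simps)
    also have "\<dots> \<le> 1 + real n * (1 / y - 1)" by (intro add_mono mult_left_mono) (auto simp: d_def)
    also have "\<dots> \<le> (1 + (1 / y - 1)) ^ n" by (rule Bernoulli_inequality) (use y in simp)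
    finally have "d * real (n + 1) \<le> 1 / y ^ n" by (simp add: power_one_over)
    then have *: "real (n + 1) * y ^ n \<le> 1 / d" using d y by (simp add: field_simps)
    have "real (n + 1) ^ Suc k * x ^ n = (real (n + 1) ^ k * y ^ n) * (real (n + 1) * y ^ n)"
      by (simp add: y(3) power_mult_distrib algebra_simps)
    also have "\<dots> \<le> C * (1 / d)"
    proof (rule mult_mono[OF C *])
      have "0 \<le> real (0 + 1) ^ k * y ^ 0" by simp
      then show "0 \<le> C" using C[of 0] by linarith
    qed (use y in auto)
    finally show ?thesis .
  qed
  then show ?case by blast
qed

section \<open>Programs as lists of pairs\<close>

fun dec :: "nat \<times> nat option \<Rightarrow> nat clause" where
  "dec (p, None) = (Some p, {})"
| "dec (p, Some q) = (Some p, {Neg q})"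

lemma P2n_clauses:
  assumes "P \<in> P2n"
  shows "P \<subseteq> range dec"
proof
  fix c assume c: "c \<in> P"
  obtain h B where hB: "c = (h, B)" by (cases c)
  have *: "h \<noteq> None" "1 + card B \<le> 2" "\<forall>a. Pos a \<notin> B" "finite B"
    using assms c hB by (auto simp: P2n_def logic_program_def)
  obtain p where p: "h = Some p" using *(1) by auto
  have "card B = 0 \<or> card B = 1" using *(2) by linarith
  then show "c \<in> range dec"
  proof
    assume "card B = 0"
    then have "c = dec (p, None)" using *(4) p hB by simp
    then show ?thesis by blast
  next
    assume "card B = 1"
    then obtain l where l: "B = {l}" by (auto simp: card_1_singleton_iff)
    then obtain q where "l = Neg q" using *(3) by (cases l) auto
    then have "c = dec (p, Some q)" using l p hB by simp
    then show ?thesis by blast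
  qed
qed

text \<open>A body with at most one literal has only one list representation.\<close>

lemma rep_clause_dec: "rep_clause (dec c) z \<Longrightarrow> z = enc_clause c"
proof (cases c rule: dec.cases)
  case (1 p)
  assume "rep_clause (dec c) z"
  then show ?thesis by (auto simp: 1 rep_set_def)
next
  case (2 p q)
  assume "rep_clause (dec c) z"
  then obtain y ls zs where *: "z = Cell (Sym p) y" "distinct ls" "set ls = {Neg q}" "list_all2 rep_literal ls zs" "y = slist zs"
    by (auto simp: 2 rep_set_def)
  have "length ls = 1" using distinct_card[OF *(2)] *(3) by simp
  then have "ls = [Neg q]" using *(3) by (cases ls) auto
  then show ?thesis using * by (auto simp: 2 list_all2_Cons1)
qed

text \<open>The input may list the clauses in any order; \<open>cs\<close> follows that
  order.\<close>

lemma rep_program: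
  assumes "P \<in> P2n" "rep_set rep_clause P x"
  obtains cs where "distinct cs" "P = dec ` set cs" "x = slist (map enc_clause cs)"
proof -
  obtain ps zs where ps: "distinct ps" "set ps = P" "list_all2 rep_clause ps zs" "x = slist zs"
    using assms(2) by (auto simp: rep_set_def)
  define cs where "cs = map (inv dec) ps"
  have dec_inv: "dec (inv dec p) = p" if "p \<in> P" for p
    using P2n_clauses[OF assms(1)] that by (intro f_inv_into_f) auto
  have map_dec: "map dec cs = ps" using dec_inv ps(2) by (auto simp: cs_def intro: map_idI)
  have "distinct cs" using ps(1) map_dec by (metis distinct_map)
  moreover have "P = dec ` set cs" using map_dec ps(2) by (metis set_map)
  moreover have "zs = map enc_clause cs"
  proof (rule nth_equalityI)
    show "length zs = length (map enc_clause cs)" using ps(3) list_all2_lengthD by (fastforce simp: cs_def)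
    fix i assume "i < length zs"
    then have "rep_clause (dec (cs ! i)) (zs ! i)" "i < length cs"
      using ps(3) unfolding map_dec[symmetric] by (auto simp: list_all2_conv_all_nth)
    then show "zs ! i = map enc_clause cs ! i" using rep_clause_dec by simp
  qed
  ultimately show ?thesis using that ps(4) by blast
qed

text \<open>Bodies are purely negative, so the reduct consists of facts and its models are the
  supersets of the set of their heads, which is therefore the least model.\<close>

lemma reduct_model:
  assumes "P = dec ` C"
  shows "is_model M' (reduct P M) \<longleftrightarrow> {p. (p, None) \<in> C \<or> (\<exists>q. (p, Some q) \<in> C \<and> q \<notin> M)} \<subseteq> M'"
proof -
  have "reduct P M = {(Some p, {}) | p. (p, None) \<in> C \<or> (\<exists>q. (p, Some q) \<in> C \<and> q \<notin> M)}" (is "_ = ?R")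
  proof (intro set_eqI iffI)
    fix r assume "r \<in> reduct P M"
    then obtain h B where r: "r = (h, B - range Neg)" "(h, B) \<in> P" "\<forall>a\<in>M. Neg a \<notin> B"
      by (auto simp: reduct_def)
    then obtain c where c: "c \<in> C" "dec c = (h, B)" using assms by (metis imageE)
    then show "r \<in> ?R" using r by (cases c rule: dec.cases) auto
  next
    fix r assume "r \<in> ?R"
    then obtain p where r: "r = (Some p, {})" "(p, None) \<in> C \<or> (\<exists>q. (p, Some q) \<in> C \<and> q \<notin> M)" by blast
    from r(2) show "r \<in> reduct P M"
    proof
      assume "(p, None) \<in> C"
      then have "(Some p, {}) \<in> P" using assms by (metis dec.simps(1) image_eqI)
      then show ?thesis unfolding reduct_def r(1) by fastforce
    next
      assume "\<exists>q. (p, Some q) \<in> C \<and> q \<notin> M"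
      then obtain q where q: "(p, Some q) \<in> C" "q \<notin> M" by blast
      then have "(Some p, {Neg q}) \<in> P" using assms by (metis dec.simps(2) image_eqI)
      moreover have "{} = {Neg q} - range Neg" by blast
      ultimately show ?thesis unfolding reduct_def r(1) using q(2) by blast
    qed
  qed
  moreover have "is_model M' {(Some p, {}) | p. Q p} \<longleftrightarrow> Collect Q \<subseteq> M'" for Q
    by (auto simp: is_model_def)
  ultimately show ?thesis by simp
qed

lemma stable_model_iff:
  assumes "P = dec ` C"
  shows "stable_model P M \<longleftrightarrow> M \<subseteq> atoms P \<and> M = {p. (p, None) \<in> C \<or> (\<exists>q. (p, Some q) \<in> C \<and> q \<notin> M)}"
  unfolding stable_model_def is_least_model_def reduct_model[OF assms] by blast

lemma atoms_dec: "atoms (dec ` C) = fst ` C \<union> {q. \<exists>p. (p, Some q) \<in> C}"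
proof -
  have "(case dec c of (h, B) \<Rightarrow> set_option h \<union> lit_atom ` B) = insert (fst c) (set_option (snd c))" for c
    by (cases c rule: dec.cases) auto
  then have "atoms (dec ` C) = (\<Union>c\<in>C. insert (fst c) (set_option (snd c)))"
    by (auto simp: atoms_def)
  then show ?thesis by (force simp: image_iff)
qed

section \<open>Stable models as complements of kernels\<close>

context lisp_program
begin

text \<open>Stability of the complement says that an atom lies outside \<open>X\<close> exactly if
  it is a fact or has an out-neighbour in \<open>X\<close>. One direction is independence and the
  exclusion of facts, the other says that the remaining atoms are met.\<close>

lemma kernels_stable:
  assumes P: "P = dec ` set cs" and X: "X \<subseteq> At"
  shows "X \<in> kernels {} candidates \<longleftrightarrow> stable_model P (At - X)"
proof -
  have at: "atoms P = At" by (simp add: P atoms_dec At_def)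
  have EAt: "u \<in> At" "v \<in> At" if "E v u" for u v
    using that by (force simp: E_def At_def)+
  have factAt: "v \<in> At" if "fact v" for v using that by (force simp: fact_def At_def)
  have "stable_model P (At - X) \<longleftrightarrow> At - X = {p. fact p \<or> (\<exists>q. E p q \<and> q \<notin> At - X)}"
    unfolding stable_model_iff[OF P] at fact_def E_def by blast
  also have "{p. fact p \<or> (\<exists>q. E p q \<and> q \<notin> At - X)} = {p. fact p \<or> (\<exists>q\<in>X. E p q)}"
    using EAt by blast
  also have "At - X = {p. fact p \<or> (\<exists>q\<in>X. E p q)} \<longleftrightarrow>
     (\<forall>p\<in>At. p \<notin> X \<longleftrightarrow> fact p \<or> (\<exists>q\<in>X. E p q))"
    using EAt factAt by blast
  also have "\<dots> \<longleftrightarrow> X \<in> kernels {} candidates"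
  proof
    assume *: "\<forall>p\<in>At. p \<notin> X \<longleftrightarrow> fact p \<or> (\<exists>q\<in>X. E p q)"
    then have cand: "X \<subseteq> candidates" and indep: "\<forall>v\<in>X. \<forall>u\<in>X. \<not> E v u"
      using X by (auto simp: candidates_def mem_T)
    have "out_nbh v \<inter> X \<noteq> {}" if v: "v \<in> T" for v
    proof (cases "v \<in> X")
      case True
      then show ?thesis by (auto simp: out_nbh_def)
    next
      case False
      then obtain q where "q \<in> X" "E v q" using * v by (auto simp: mem_T)
      then show ?thesis by (auto simp: out_nbh_def)
    qed
    then show "X \<in> kernels {} candidates" using cand indep by (simp add: kernels_def)
  next
    assume *: "X \<in> kernels {} candidates"
    have "p \<notin> X \<longleftrightarrow> fact p \<or> (\<exists>q\<in>X. E p q)" if p: "p \<in> At" for p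
    proof (cases "p \<in> X")
      case True
      then have "p \<in> T" using * by (auto simp: kernels_def candidates_def)
      then show ?thesis using * True by (auto simp: kernels_def mem_T)
    next
      case False
      have "\<exists>q\<in>X. E p q" if "\<not> fact p"
      proof -
        have "out_nbh p \<inter> X \<noteq> {}" using * p that by (simp add: kernels_def mem_T)
        then show ?thesis using False by (auto simp: out_nbh_def)
      qed
      then show ?thesis using False by blast
    qed
    then show "\<forall>p\<in>At. p \<notin> X \<longleftrightarrow> fact p \<or> (\<exists>q\<in>X. E p q)" by blast
  qed
  finally show ?thesis by blast
qed

lemma kernels_At: "X \<in> kernels {} candidates \<Longrightarrow> X \<subseteq> At"
  by (auto simp: kernels_def candidates_def mem_T)

lemma stable_models_eq:
  assumes "P = dec ` set cs"
  shows "{M. stable_model P M} = (\<lambda>X. At - X) ` kernels {} candidates"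
proof (intro set_eqI iffI)
  have at: "atoms P = At" by (simp add: assms atoms_dec At_def)
  fix M assume M: "M \<in> {M. stable_model P M}"
  then have "At - (At - M) = M" using stable_model_iff[OF assms] at by blast
  then show "M \<in> (\<lambda>X. At - X) ` kernels {} candidates"
    using kernels_stable[OF assms, of "At - M"] M by (metis Diff_subset image_eqI mem_Collect_eq)
next
  fix M assume "M \<in> (\<lambda>X. At - X) ` kernels {} candidates"
  then show "M \<in> {M. stable_model P M}"
    using kernels_stable[OF assms] kernels_At by auto
qed

text \<open>Complementation in \<open>At\<close> is injective on subsets, so distinct kernels yield
  distinct models.\<close>

lemma rep_stable_models:
  assumes P: "P = dec ` set cs" and as: "set as = At" "distinct as"
    and Xs: "distinct Xs" "set Xs = kernels {} candidates"
  shows "rep_set (rep_set rep_atom) {M. stable_model P M} (slist (map (complement as) Xs))"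
proof -
  have "inj_on (\<lambda>X. At - X) (set Xs)"
    using kernels_At Xs(2) by (intro inj_onI) (metis double_diff subset_refl)
  then have "distinct (map (\<lambda>X. At - X) Xs)" using Xs(1) by (simp add: distinct_map)
  moreover have "set (map (\<lambda>X. At - X) Xs) = {M. stable_model P M}"
    using stable_models_eq[OF P] Xs(2) by simp
  moreover have "rep_set rep_atom (At - X) (complement as X)" for X
    unfolding rep_set_def complement_def enc_def
    by (intro exI[of _ "filter (\<lambda>a. a \<notin> X) as"] exI[of _ "map Sym (filter (\<lambda>a. a \<notin> X) as)"])
      (use as in \<open>auto simp: list_all2_conv_all_nth rep_atom_def\<close>)
  then have "list_all2 (rep_set rep_atom) (map (\<lambda>X. At - X) Xs) (map (complement as) Xs)"
    by (simp add: list_all2_conv_all_nth)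
  ultimately show ?thesis unfolding rep_set_def[of "rep_set rep_atom"] by blast
qed

end

text \<open>The code and the constant are chosen before the program. The empty program has size 0,
  where the right-hand side vanishes but a run still has positive cost.\<close>

theorem theorem7:
  "\<exists>(F :: code) (C :: real). \<forall>(P :: nat clause set) x.
     P \<in> P2n \<and> rep_set rep_clause P x \<longrightarrow>
     (\<exists>y t. runs F x y t
        \<and> rep_set (rep_set rep_atom) {M. stable_model P M} y
        \<and> (P \<noteq> {} \<longrightarrow>
             real t \<le> C * (real (program_size P) * 1.23651 ^ card (atoms P))))"
proof -
  \<comment> \<open>\<open>L 6\<close> is a sixth power of a term quadratic in \<open>n\<close>,
    which gives the exponent 12; the depth factor \<open>n + 1\<close> gives one more.\<close>
  obtain C0 where C0: "\<And>n. real (n + 1) ^ 13 * (lam / 1.23651) ^ n \<le> C0"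
    using poly_times_geometric_bounded[of "lam / 1.23651" 13] by (auto simp: lam_def)
  \<comment> \<open>12 is 10 from the main run and 2 for the initial call; 2000 is the 1000 of
    \<open>L\<close> times the 2 in the bound for the number of clauses.\<close>
  define C where "C = 12 * 2000 ^ 6 * C0"
  have "\<exists>y t. runs the_code x y t \<and> rep_set (rep_set rep_atom) {M. stable_model P M} y
      \<and> (P \<noteq> {} \<longrightarrow> real t \<le> C * (real (program_size P) * 1.23651 ^ card (atoms P)))"
    if P: "P \<in> P2n" and rep: "rep_set rep_clause P x" for P x
  proof -
    obtain cs where cs: "distinct cs" "P = dec ` set cs" "x = slist (map enc_clause cs)"
      by (rule rep_program[OF P rep])
    interpret lisp_program cs "2 * length cs"
    proof
      fix a b assume "(a, Some b) \<in> set cs" "(b, Some a) \<in> set cs"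
      then have "(Some a, {Neg b}) \<in> P" "(Some b, {Neg a}) \<in> P"
        using cs(2) by (metis dec.simps(2) image_eqI)+
      then show "a = b" using P by (auto simp: P2n_def)
    qed simp
    define n where "n = card At"
    have at: "atoms P = At" by (simp add: cs(2) atoms_dec At_def)
    have x: "x = G" by (simp add: cs(3) G_def)
    obtain as Xs where as: "distinct as" "set as = At" and Xs: "distinct Xs" "set Xs = kernels {} candidates"
      and run: "fn the_code 0 [G] (slist (map (complement as) Xs)) (10 * L 6 * (real n + 1) * lam ^ n)"
      unfolding n_def by (rule fn_main)
    have "ev the_code [G] (Call 0 [Param 0]) (slist (map (complement as) Xs)) (10 * L 6 * (real n + 1) * lam ^ n + 2)"
      by (rule ev_weaken, (rule ev_rules run)+) auto
    then obtain t where t: "runs the_code x (slist (map (complement as) Xs)) t"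
      "real t \<le> 10 * L 6 * (real n + 1) * lam ^ n + 2"
      unfolding ev_def runs_def x by blast
    have "real t \<le> C * (real (program_size P) * 1.23651 ^ card (atoms P))" if "P \<noteq> {}"
    proof -
      \<comment> \<open>A clause is a head together with at most one body atom, and clauses do not
        repeat.\<close>
      have "length cs \<le> n * (n + 1)"
      proof -
        have "set cs \<subseteq> At \<times> insert None (Some ` At)"
        proof
          fix c assume c: "c \<in> set cs"
          then show "c \<in> At \<times> insert None (Some ` At)"
            by (cases c rule: dec.cases) (force simp: At_def)+
        qed
        then have "card (set cs) \<le> card (At \<times> insert None (Some ` At))"
          using finite_At by (intro card_mono) auto
        also have "\<dots> = n * (n + 1)"
          using finite_At by (simp add: card_cartesian_product card_image n_def)
        finally show ?thesis using distinct_card[OF cs(1)] by simp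
      qed
      then have "2 * length cs + 1 \<le> 2 * (n + 1) ^ 2" by (simp add: power2_eq_square)
      then have "real (2 * length cs + 1) \<le> real (2 * (n + 1) ^ 2)" by (rule of_nat_mono)
      then have "1000 * (real (2 * length cs) + 1) \<le> 2000 * real (n + 1) ^ 2" by simp
      then have "L 6 \<le> (2000 * real (n + 1) ^ 2) ^ 6" unfolding L_def by (rule power_mono) simp
      then have L6: "L 6 \<le> 2000 ^ 6 * real (n + 1) ^ 12" by (simp only: power_mult_distrib power_mult[symmetric]) simp
      have lam1: "1 \<le> lam ^ n" using lam_ge_1 by (rule one_le_power)
      have "1 * 1 * 1 \<le> L 6 * (real n + 1) * lam ^ n"
        using L_ge_1[of 6] lam1 by (intro mult_mono) auto
      then have "real t \<le> 12 * (L 6 * ((real n + 1) * lam ^ n))"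
        using t(2) by (simp add: mult_ac)
      also have "\<dots> \<le> 12 * ((2000 ^ 6 * real (n + 1) ^ 12) * ((real n + 1) * lam ^ n))"
        using L6 lam1 by (intro mult_left_mono mult_right_mono) auto
      also have "\<dots> = 12 * 2000 ^ 6 * ((real (n + 1) ^ 13 * (lam / 1.23651) ^ n) * 1.23651 ^ n)"
      proof -
        have "lam ^ n = (lam / 1.23651) ^ n * 1.23651 ^ n" by (simp add: power_mult_distrib[symmetric])
        moreover have "real (n + 1) ^ 13 = real (n + 1) ^ 12 * (real n + 1)" 
          using power_add[of "real (n + 1)" 12 1] by (simp add: add.commute)
        ultimately show ?thesis by simp
      qed
      also have "\<dots> \<le> 12 * 2000 ^ 6 * (C0 * 1.23651 ^ n)"
        by (intro mult_left_mono mult_right_mono C0) auto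
      also have "\<dots> = C * (1 * 1.23651 ^ n)" by (simp add: C_def)
      also have "\<dots> \<le> C * (real (program_size P) * 1.23651 ^ n)"
      proof (intro mult_left_mono mult_right_mono)
        obtain c where c: "c \<in> set cs" using \<open>P \<noteq> {}\<close> cs(2) by (metis hd_in_set image_is_empty set_empty)
        have "1 \<le> (case dec c of (h, B) \<Rightarrow> card (set_option h) + card B)"
          by (cases c rule: dec.cases) auto
        also have "\<dots> \<le> program_size P"
          unfolding program_size_def using cs(2) c
          by (intro member_le_sum[of "dec c" P "\<lambda>(h, B). card (set_option h) + card B"]) auto
        finally show "1 \<le> real (program_size P)" by simp
        have "0 \<le> C0" using C0[of 0] by simp
        then show "0 \<le> C" by (simp add: C_def)
      qed simp
      finally show ?thesis by (simp add: at n_def)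
    qed
    then show ?thesis using t(1) rep_stable_models[OF cs(2) as(2,1) Xs] by blast
  qed
  then show ?thesis by blast
qed

end
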